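(* Let $\theta,\tau$ be cancelative permutation sets determining the spaces $$\Omega_\theta\subseteq\mathbb C^n=\mathbb C^{n_1}\times\dots\times\mathbb C^{n_s},\qquad \Omega_\tau\subseteq\mathbb C^m=\mathbb C^{m_1}\times\dots\times\mathbb C^{m_t},$$ and let $\gamma$ be a biholomorphic map from $\Omega_\theta$ onto $\Omega_\tau$ with $\gamma(0)=0$. Then $n=m$ and there is a unitary matrix $X$ such that $\gamma(z)=Xz$ for $z\in\Omega_\theta$. Moreover, up to a permutation, $(n_1,\dots,n_s)=(m_1,\dots,m_t)$, and with respect to this identification $X$ is a block diagonal unitary matrix.
   Context: A permutation set $\theta=\{\theta_{ij}:1\le i<j\le s\}$ with multiplicities $(n_1,\dots,n_s)$ consists of permutations $\theta_{ij}$ of $\{1,\dots,n_i\}\times\{1,\dots,n_j\}$; write $n=n_1+\dots+n_s$. It is cancelative if the unital semigroup with generators $e_{ip}$ ($1\le i\le s$, $1\le p\le n_i$) and relations $e_{ip}e_{jq}=e_{jq'}e_{ip'}$ whenever $i<j$, $\theta_{ij}(p,q)=(p',q')$, is left and right cancellative. $V_\theta\subseteq\mathbb C^{n_1}\times\dots\times\mathbb C^{n_s}$ is the complex algebraic variety of points $z=(z_{i,p})$ with $z_{i,p}z_{j,q}=z_{i,p'}z_{j,q'}$ whenever $i<j$ and $\theta_{ij}(p,q)=(p',q')$. $\Omega_\theta=V_\theta\cap(\overline{\mathbb B}_{n_1}\times\dots\times\overline{\mathbb B}_{n_s})$, where $\overline{\mathbb B}_d$ is the closed Euclidean unit ball of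 $\mathbb C^d$, with the relative Euclidean topology. Similarly for $\tau$ with multiplicities $(m_1,\dots,m_t)$, $m=m_1+\dots+m_t$. A continuous function on $\Omega_\theta$ is called holomorphic if its restrictions to the domains that make up the interior $V_\theta\cap(\mathbb B_{n_1}\times\dots\times\mathbb B_{n_s})$ (the parts determined by the algebraic components of $V_\theta$; $\mathbb B_d$ is the open unit ball) are holomorphic. A map $\gamma:\Omega_\theta\to\Omega_\tau$ is biholomorphic if it is a homeomorphism and the coordinate functions of both $\gamma$ and $\gamma^{-1}$ are holomorphic in this sense. *)

theory Defs
  imports "HOL-Analysis.Analysis" "HOL-Algebra.Divisibility"
begin

text \<open>
  The pair \<open>(i, p)\<close> indexes both the generator \<open>e\<^bsub>ip\<^esub>\<close> and the coordinate \<open>z\<^bsub>i,p\<^esub>\<close>; a system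
  of multiplicities \<open>(n\<^sub>1, \<dots>, n\<^sub>s)\<close> is a number \<open>s\<close> together with a function \<open>n\<close> of which only
  the values on \<open>{1..s}\<close> matter.
\<close>

definition idx :: "nat \<Rightarrow> (nat \<Rightarrow> nat) \<Rightarrow> (nat \<times> nat) set" where
  "idx s n = (SIGMA i:{1..s}. {1..n i})"

type_synonym perms = "nat \<Rightarrow> nat \<Rightarrow> nat \<times> nat \<Rightarrow> nat \<times> nat"

text \<open>Multiplicities are positive: an empty block would be invisible in \<open>\<Omega>\<^bsub>\<theta>\<^esub>\<close>.\<close>

definition permutation_set :: "nat \<Rightarrow> (nat \<Rightarrow> nat) \<Rightarrow> perms \<Rightarrow> bool" where
  "permutation_set s n \<theta> \<longleftrightarrow>
     (\<forall>i\<in>{1..s}. 1 \<le> n i) \<and>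
     (\<forall>i j. 1 \<le> i \<and> i < j \<and> j \<le> s \<longrightarrow>
        bij_betw (\<theta> i j) ({1..n i} \<times> {1..n j}) ({1..n i} \<times> {1..n j}))"


section \<open>The semigroup of a permutation set\<close>

inductive word_cong ::
  "nat \<Rightarrow> (nat \<Rightarrow> nat) \<Rightarrow> perms \<Rightarrow> (nat \<times> nat) list \<Rightarrow> (nat \<times> nat) list \<Rightarrow> bool"
  for s n \<theta>
where
  relation: "\<lbrakk>1 \<le> i; i < j; j \<le> s; p \<in> {1..n i}; q \<in> {1..n j}; \<theta> i j (p, q) = (p', q');
      u \<in> lists (idx s n); v \<in> lists (idx s n)\<rbrakk>
    \<Longrightarrow> word_cong s n \<theta> (u @ [(i, p), (j, q)] @ v) (u @ [(j, q'), (i, p')] @ v)"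
| refl: "u \<in> lists (idx s n) \<Longrightarrow> word_cong s n \<theta> u u"
| sym: "word_cong s n \<theta> u v \<Longrightarrow> word_cong s n \<theta> v u"
| trans: "\<lbrakk>word_cong s n \<theta> u v; word_cong s n \<theta> v w\<rbrakk> \<Longrightarrow> word_cong s n \<theta> u w"

definition semigroup_of :: "nat \<Rightarrow> (nat \<Rightarrow> nat) \<Rightarrow> perms \<Rightarrow> (nat \<times> nat) list set monoid" where
  "semigroup_of s n \<theta> =
     \<lparr>carrier = lists (idx s n) // {(u, v). word_cong s n \<theta> u v},
      mult = (\<lambda>A B. {w. \<exists>u\<in>A. \<exists>v\<in>B. word_cong s n \<theta> (u @ v) w}),
      one = {w. word_cong s n \<theta> [] w}\<rparr>"

definition cancelative :: "nat \<Rightarrow> (nat \<Rightarrow> nat) \<Rightarrow> perms \<Rightarrow> bool" where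
  "cancelative s n \<theta> \<longleftrightarrow> monoid_cancel (semigroup_of s n \<theta>)"


section \<open>The variety and the space of a permutation set\<close>

text \<open>
  \<open>\<complex>\<^sup>K\<close> for a finite index set \<open>K\<close>, as the functions vanishing off \<open>K\<close>. Its Euclidean topology is
  the subspace topology from the product topology on the function type.
\<close>

definition cspace :: "'k set \<Rightarrow> ('k \<Rightarrow> complex) set" where
  "cspace K = {z. \<forall>k. k \<notin> K \<longrightarrow> z k = 0}"

definition V :: "nat \<Rightarrow> (nat \<Rightarrow> nat) \<Rightarrow> perms \<Rightarrow> (nat \<times> nat \<Rightarrow> complex) set" where
  "V s n \<theta> = {z \<in> cspace (idx s n).
     \<forall>i j p q p' q'. 1 \<le> i \<and> i < j \<and> j \<le> s \<and> p \<in> {1..n i} \<and> q \<in> {1..n j} \<and>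
       \<theta> i j (p, q) = (p', q') \<longrightarrow> z (i, p) * z (j, q) = z (i, p') * z (j, q')}"

definition block_norm :: "(nat \<Rightarrow> nat) \<Rightarrow> nat \<Rightarrow> (nat \<times> nat \<Rightarrow> complex) \<Rightarrow> real" where
  "block_norm n i z = L2_set (\<lambda>p. cmod (z (i, p))) {1..n i}"

definition \<Omega> :: "nat \<Rightarrow> (nat \<Rightarrow> nat) \<Rightarrow> perms \<Rightarrow> (nat \<times> nat \<Rightarrow> complex) set" where
  "\<Omega> s n \<theta> = {z \<in> V s n \<theta>. \<forall>i\<in>{1..s}. block_norm n i z \<le> 1}"

definition \<Omega>_interior :: "nat \<Rightarrow> (nat \<Rightarrow> nat) \<Rightarrow> perms \<Rightarrow> (nat \<times> nat \<Rightarrow> complex) set" where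
  "\<Omega>_interior s n \<theta> = {z \<in> V s n \<theta>. \<forall>i\<in>{1..s}. block_norm n i z < 1}"


section \<open>Algebraic components\<close>

inductive_set polynomial_functions :: "'k set \<Rightarrow> (('k \<Rightarrow> complex) \<Rightarrow> complex) set" for K where
  const: "(\<lambda>z. c) \<in> polynomial_functions K"
| coord: "k \<in> K \<Longrightarrow> (\<lambda>z. z k) \<in> polynomial_functions K"
| add: "\<lbrakk>f \<in> polynomial_functions K; g \<in> polynomial_functions K\<rbrakk>
    \<Longrightarrow> (\<lambda>z. f z + g z) \<in> polynomial_functions K"
| mult: "\<lbrakk>f \<in> polynomial_functions K; g \<in> polynomial_functions K\<rbrakk>
    \<Longrightarrow> (\<lambda>z. f z * g z) \<in> polynomial_functions K"

definition algebraic_set :: "'k set \<Rightarrow> ('k \<Rightarrow> complex) set \<Rightarrow> bool" where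
  "algebraic_set K A \<longleftrightarrow>
     (\<exists>P \<subseteq> polynomial_functions K. A = {z \<in> cspace K. \<forall>f\<in>P. f z = 0})"

definition irreducible_algebraic_set :: "'k set \<Rightarrow> ('k \<Rightarrow> complex) set \<Rightarrow> bool" where
  "irreducible_algebraic_set K A \<longleftrightarrow>
     algebraic_set K A \<and> A \<noteq> {} \<and>
     (\<forall>B C. algebraic_set K B \<and> algebraic_set K C \<and> A = B \<union> C \<longrightarrow> A = B \<or> A = C)"

definition algebraic_component ::
    "'k set \<Rightarrow> ('k \<Rightarrow> complex) set \<Rightarrow> ('k \<Rightarrow> complex) set \<Rightarrow> bool" where
  "algebraic_component K W C \<longleftrightarrow>
     irreducible_algebraic_set K C \<and> C \<subseteq> W \<and>
     (\<forall>D. irreducible_algebraic_set K D \<and> C \<subseteq> D \<and> D \<subseteq> W \<longrightarrow> D = C)"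


section \<open>Holomorphic functions and biholomorphic maps\<close>

text \<open>
  Complex (Frechet) differentiability in \<open>\<complex>\<^sup>K\<close>. The derivative is written out because the type
  \<open>'k \<Rightarrow> complex\<close> is not a normed space, so \<open>has_derivative\<close> is not available for it.
\<close>

definition complex_differentiable_at ::
    "'k set \<Rightarrow> (('k \<Rightarrow> complex) \<Rightarrow> complex) \<Rightarrow> ('k \<Rightarrow> complex) \<Rightarrow> bool" where
  "complex_differentiable_at K F z \<longleftrightarrow>
     (\<exists>c. ((\<lambda>w. (F w - F z - (\<Sum>k\<in>K. c k * (w k - z k)))
               / of_real (L2_set (\<lambda>k. cmod (w k - z k)) K)) \<longlongrightarrow> 0) (at z within cspace K))"

text \<open>
  Algebraic components may be singular (for instance \<open>z\<^sub>1 w\<^sub>1 = z\<^sub>2 w\<^sub>2\<close> at the origin), so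
  holomorphy on a subset \<open>D\<close> of \<open>\<complex>\<^sup>K\<close> has the usual meaning from analytic spaces: locally the
  restriction of a holomorphic function on an open subset of \<open>\<complex>\<^sup>K\<close>.
\<close>

definition holomorphic_on_subvariety ::
    "'k set \<Rightarrow> ('k \<Rightarrow> complex) set \<Rightarrow> (('k \<Rightarrow> complex) \<Rightarrow> complex) \<Rightarrow> bool" where
  "holomorphic_on_subvariety K D f \<longleftrightarrow>
     (\<forall>z\<in>D. \<exists>U F. open U \<and> z \<in> U \<and>
        (\<forall>w \<in> U \<inter> cspace K. complex_differentiable_at K F w) \<and>
        (\<forall>w \<in> U \<inter> D. f w = F w))"

definition holomorphic_on_\<Omega> ::
    "nat \<Rightarrow> (nat \<Rightarrow> nat) \<Rightarrow> perms \<Rightarrow> ((nat \<times> nat \<Rightarrow> complex) \<Rightarrow> complex) \<Rightarrow> bool" where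
  "holomorphic_on_\<Omega> s n \<theta> f \<longleftrightarrow>
     continuous_on (\<Omega> s n \<theta>) f \<and>
     (\<forall>C. algebraic_component (idx s n) (V s n \<theta>) C \<longrightarrow>
        holomorphic_on_subvariety (idx s n) (C \<inter> \<Omega>_interior s n \<theta>) f)"

definition biholomorphic_map ::
    "nat \<Rightarrow> (nat \<Rightarrow> nat) \<Rightarrow> perms \<Rightarrow> nat \<Rightarrow> (nat \<Rightarrow> nat) \<Rightarrow> perms \<Rightarrow>
     ((nat \<times> nat \<Rightarrow> complex) \<Rightarrow> (nat \<times> nat \<Rightarrow> complex)) \<Rightarrow> bool" where
  "biholomorphic_map s n \<theta> t m \<tau> \<gamma> \<longleftrightarrow>
     (\<exists>\<delta>. homeomorphism (\<Omega> s n \<theta>) (\<Omega> t m \<tau>) \<gamma> \<delta> \<and>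
        (\<forall>k \<in> idx t m. holomorphic_on_\<Omega> s n \<theta> (\<lambda>z. \<gamma> z k)) \<and>
        (\<forall>k \<in> idx s n. holomorphic_on_\<Omega> t m \<tau> (\<lambda>w. \<delta> w k)))"


section \<open>Unitary matrices\<close>

text \<open>
  A matrix with rows indexed by \<open>L\<close> and columns indexed by \<open>K\<close>; both \<open>X\<^sup>*X = 1\<close> and \<open>XX\<^sup>* = 1\<close>
  are required.
\<close>

definition unitary_matrix :: "'l set \<Rightarrow> 'k set \<Rightarrow> ('l \<Rightarrow> 'k \<Rightarrow> complex) \<Rightarrow> bool" where
  "unitary_matrix L K X \<longleftrightarrow>
     (\<forall>k\<in>K. \<forall>k'\<in>K. (\<Sum>l\<in>L. cnj (X l k) * X l k') = (if k = k' then 1 else 0)) \<and>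
     (\<forall>l\<in>L. \<forall>l'\<in>L. (\<Sum>k\<in>K. X l k * cnj (X l' k)) = (if l = l' then 1 else 0))"

end

theory Submission
  imports Defs "HOL-Complex_Analysis.Complex_Analysis"
begin

text \<open>
The variety \<open>V\<close> is a cone in each block separately: multiplying the coordinates of block \<open>i\<close> by a
  number \<open>a\<^sub>i\<close>, possibly zero, preserves the defining equations and even every algebraic component
  (\<open>component_scale_closed\<close>). A holomorphic disc in \<open>V\<close> stays inside a single component, because its
  image is Zariski irreducible (\<open>disc_curve_component\<close>). These two facts reduce the analysis on a
  possibly singular and reducible variety to functions of one complex variable.

  The proof has two parts. The first one shows that \<open>\<gamma>\<close> is linear. Near the origin, on each
  component, a holomorphic function is approximated to first order by a linear form, and uniformly so
  for differences (\<open>strict_derivative_at_0\<close>). Since a component contains the projections of its points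
  to the blocks, and the blocks themselves are irreducible subsets of \<open>V\<close>, the form can be chosen
  independently of the component (\<open>common_strict_derivative\<close>). Thus \<open>\<gamma>\<close> and its inverse have
  derivatives \<open>X\<close> and \<open>Y\<close> at the origin. By the Schwarz lemma they map the spaces into each other, and
  they are mutually inverse (\<open>derivative_maps_\<Omega>\<close>, \<open>derivative_left_inverse\<close>). The self-map \<open>Y \<circ> \<gamma>\<close> has
  derivative \<open>1\<close> at the origin, so Cartan's argument applies: if it were different from the identity
  along some line, the lowest non-linear Taylor coefficient of its iterates would grow without bound
  (\<open>Cartan_uniqueness\<close>). Hence \<open>\<gamma> = X\<close>.

  The second part is linear algebra with the norm \<open>max\<^sub>i \<parallel>z\<^sub>i\<parallel>\<close>, which \<open>Y\<close> preserves on the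
  variety. For \<open>w\<close> in one block \<open>k\<close>, some block of \<open>Y w\<close> has the norm of \<open>w\<close>. A complex vector space
  is not a finite union of proper subspaces, so one block \<open>\<kappa> k\<close> serves all \<open>w\<close>
  (\<open>B_block_isometric\<close>). If \<open>y\<close> lies in the variety and \<open>y\<^sub>k \<noteq> 0\<close>, then the normalised vectors
  \<open>y\<^sub>k \<plusminus> y\<^sub>l\<close> also lie in it, and the parallelogram law leaves no room for a contribution of
  \<open>y\<^sub>l\<close> to block \<open>\<kappa> k\<close> of \<open>Y y\<close> (\<open>B_other_block\<close>). So \<open>Y y\<close> is non-zero in block \<open>\<kappa> k\<close> whenever
  \<open>y\<^sub>k \<noteq> 0\<close>. Applied to \<open>y = X z\<close> with \<open>z\<close> in block \<open>i\<close>, this says that \<open>X z\<close> lives in the only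
  block \<open>k\<close> with \<open>\<kappa> k = i\<close>, and that its norm there is that of \<open>z\<close> (\<open>blocks_correspond\<close>).
\<close>

section \<open>Irreducible sets and algebraic components\<close>

text \<open>
  Irreducibility in the Zariski topology, for sets that need not be closed. This is the notion that
  images of holomorphic curves satisfy.
\<close>

definition irreducible_set :: "'k set \<Rightarrow> ('k \<Rightarrow> complex) set \<Rightarrow> bool" where
  "irreducible_set K S \<longleftrightarrow> S \<noteq> {} \<and> S \<subseteq> cspace K \<and>
     (\<forall>A B. algebraic_set K A \<and> algebraic_set K B \<and> S \<subseteq> A \<union> B \<longrightarrow> S \<subseteq> A \<or> S \<subseteq> B)"

definition zariski_closure :: "'k set \<Rightarrow> ('k \<Rightarrow> complex) set \<Rightarrow> ('k \<Rightarrow> complex) set" where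
  "zariski_closure K S =
     {z \<in> cspace K. \<forall>f\<in>polynomial_functions K. (\<forall>x\<in>S. f x = 0) \<longrightarrow> f z = 0}"

lemma algebraic_set_zariski_closure: "algebraic_set K (zariski_closure K S)"
  unfolding algebraic_set_def zariski_closure_def
  by (rule exI[of _ "{f \<in> polynomial_functions K. \<forall>x\<in>S. f x = 0}"]) auto

lemma zariski_closure_superset: "S \<subseteq> cspace K \<Longrightarrow> S \<subseteq> zariski_closure K S"
  unfolding zariski_closure_def by auto

lemma zariski_closure_minimal:
  assumes "algebraic_set K A" "S \<subseteq> A"
  shows "zariski_closure K S \<subseteq> A"
proof -
  obtain P where P: "P \<subseteq> polynomial_functions K" "A = {z \<in> cspace K. \<forall>f\<in>P. f z = 0}"
    using assms(1) unfolding algebraic_set_def by auto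
  have "f z = 0" if "z \<in> zariski_closure K S" "f \<in> P" for f z
  proof -
    have "\<forall>x\<in>S. f x = 0" using P(2) assms(2) that(2) by auto
    then show ?thesis using that P(1) unfolding zariski_closure_def by auto
  qed
  then show ?thesis using P(2) unfolding zariski_closure_def by auto
qed

lemma algebraic_set_subset_cspace: "algebraic_set K A \<Longrightarrow> A \<subseteq> cspace K"
  unfolding algebraic_set_def by auto

lemma algebraic_set_Int:
  assumes "algebraic_set K A" "algebraic_set K B"
  shows "algebraic_set K (A \<inter> B)"
proof -
  obtain P where P: "P \<subseteq> polynomial_functions K" "A = {z \<in> cspace K. \<forall>f\<in>P. f z = 0}"
    using assms(1) unfolding algebraic_set_def by auto
  obtain Q where Q: "Q \<subseteq> polynomial_functions K" "B = {z \<in> cspace K. \<forall>f\<in>Q. f z = 0}"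
    using assms(2) unfolding algebraic_set_def by auto
  show ?thesis unfolding algebraic_set_def
    by (rule exI[of _ "P \<union> Q"]) (use P Q in auto)
qed

lemma irreducible_algebraic_setD:
  assumes "irreducible_algebraic_set K C"
  shows "irreducible_set K C"
  unfolding irreducible_set_def
proof (intro conjI allI impI)
  show "C \<noteq> {}" "C \<subseteq> cspace K"
    using assms algebraic_set_subset_cspace unfolding irreducible_algebraic_set_def by auto
  fix A B assume AB: "algebraic_set K A \<and> algebraic_set K B \<and> C \<subseteq> A \<union> B"
  have "algebraic_set K (C \<inter> A)" "algebraic_set K (C \<inter> B)" "C = (C \<inter> A) \<union> (C \<inter> B)"
    using AB assms algebraic_set_Int unfolding irreducible_algebraic_set_def by auto
  then show "C \<subseteq> A \<or> C \<subseteq> B"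
    using assms unfolding irreducible_algebraic_set_def by blast
qed

lemma irreducible_algebraic_set_zariski_closure:
  assumes "irreducible_set K S"
  shows "irreducible_algebraic_set K (zariski_closure K S)"
  unfolding irreducible_algebraic_set_def
proof (intro conjI allI impI)
  have sub: "S \<subseteq> zariski_closure K S"
    using assms zariski_closure_superset unfolding irreducible_set_def by blast
  then show "zariski_closure K S \<noteq> {}"
    using assms unfolding irreducible_set_def by auto
  fix B C assume BC: "algebraic_set K B \<and> algebraic_set K C \<and> zariski_closure K S = B \<union> C"
  then have "S \<subseteq> B \<or> S \<subseteq> C"
    using assms sub unfolding irreducible_set_def by blast
  then show "zariski_closure K S = B \<or> zariski_closure K S = C"
    using BC zariski_closure_minimal by blast
qed (rule algebraic_set_zariski_closure)

lemma irreducible_set_Union_chain: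
  assumes ch: "\<And>D E. D \<in> \<C> \<Longrightarrow> E \<in> \<C> \<Longrightarrow> D \<subseteq> E \<or> E \<subseteq> D"
    and irr: "\<And>D. D \<in> \<C> \<Longrightarrow> irreducible_set K D" and ne: "\<C> \<noteq> {}"
  shows "irreducible_set K (\<Union>\<C>)"
  unfolding irreducible_set_def
proof (intro conjI allI impI)
  show "\<Union>\<C> \<noteq> {}" using irr ne unfolding irreducible_set_def by fastforce
  show "\<Union>\<C> \<subseteq> cspace K" using irr unfolding irreducible_set_def by blast
  fix A B assume AB: "algebraic_set K A \<and> algebraic_set K B \<and> \<Union>\<C> \<subseteq> A \<union> B"
  have each: "D \<subseteq> A \<or> D \<subseteq> B" if "D \<in> \<C>" for D
    using irr[OF that] AB that unfolding irreducible_set_def by blast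
  show "\<Union>\<C> \<subseteq> A \<or> \<Union>\<C> \<subseteq> B"
  proof (rule ccontr)
    assume "\<not> ?thesis"
    then obtain D E where "D \<in> \<C>" "\<not> D \<subseteq> A" "E \<in> \<C>" "\<not> E \<subseteq> B" by blast
    then show False using each ch by (meson subset_trans)
  qed
qed

text \<open>
  Zorn's lemma yields a maximal irreducible algebraic set. The upper bound of a chain is the Zariski
  closure of its union: irreducibility passes to the union of the chain and to the closure, and the
  closure remains inside \<open>W\<close> because \<open>W\<close> is algebraic.
\<close>

lemma irreducible_set_in_component:
  assumes S: "irreducible_set K S" "S \<subseteq> W" and W: "algebraic_set K W"
  obtains C where "algebraic_component K W C" "S \<subseteq> C"
proof -
  define \<A> where "\<A> = {D. irreducible_algebraic_set K D \<and> S \<subseteq> D \<and> D \<subseteq> W}"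
  have "\<exists>M\<in>\<A>. \<forall>X\<in>\<A>. M \<subseteq> X \<longrightarrow> X = M"
  proof (rule subset_Zorn)
    fix \<C> assume ch: "subset.chain \<A> \<C>"
    show "\<exists>U\<in>\<A>. \<forall>X\<in>\<C>. X \<subseteq> U"
    proof (cases "\<C> = {}")
      case True
      have "S \<subseteq> cspace K" using S(1) unfolding irreducible_set_def by simp
      then have "zariski_closure K S \<in> \<A>"
        using irreducible_algebraic_set_zariski_closure[OF S(1)]
          zariski_closure_minimal[OF W S(2)] zariski_closure_superset unfolding \<A>_def by simp
      with True show ?thesis by auto
    next
      case False
      have \<C>: "\<C> \<subseteq> \<A>" and lin: "\<And>D E. D \<in> \<C> \<Longrightarrow> E \<in> \<C> \<Longrightarrow> D \<subseteq> E \<or> E \<subseteq> D"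
        using ch unfolding subset.chain_def by blast+
      have irr: "irreducible_set K (\<Union>\<C>)"
      proof (rule irreducible_set_Union_chain[OF lin _ False])
        show "irreducible_set K D" if "D \<in> \<C>" for D
          by (rule irreducible_algebraic_setD) (use that \<C> in \<open>auto simp: \<A>_def\<close>)
      qed
      then have sup: "\<Union>\<C> \<subseteq> zariski_closure K (\<Union>\<C>)"
        by (intro zariski_closure_superset) (simp add: irreducible_set_def)
      have "\<Union>\<C> \<subseteq> W" using \<C> unfolding \<A>_def by blast
      then have "zariski_closure K (\<Union>\<C>) \<subseteq> W" by (rule zariski_closure_minimal[OF W])
      moreover have "S \<subseteq> \<Union>\<C>" using \<C> False unfolding \<A>_def by blast
      ultimately have "zariski_closure K (\<Union>\<C>) \<in> \<A>"
        using sup irreducible_algebraic_set_zariski_closure[OF irr] unfolding \<A>_def by blast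
      then show ?thesis using sup by blast
    qed
  qed
  then obtain C where C: "C \<in> \<A>" "\<forall>X\<in>\<A>. C \<subseteq> X \<longrightarrow> X = C" by blast
  have "algebraic_component K W C"
    using C unfolding algebraic_component_def \<A>_def by blast
  then show ?thesis using that C(1) unfolding \<A>_def by blast
qed

section \<open>Holomorphic curves\<close>

definition holomorphic_curve :: "'k set \<Rightarrow> complex set \<Rightarrow> (complex \<Rightarrow> 'k \<Rightarrow> complex) \<Rightarrow> bool" where
  "holomorphic_curve K D w \<longleftrightarrow> (\<forall>\<zeta>\<in>D. w \<zeta> \<in> cspace K) \<and> (\<forall>k\<in>K. (\<lambda>\<zeta>. w \<zeta> k) holomorphic_on D)"

lemma polynomial_holomorphic_on_curve:
  assumes "f \<in> polynomial_functions K" "holomorphic_curve K D w"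
  shows "(\<lambda>\<zeta>. f (w \<zeta>)) holomorphic_on D"
  using assms(1)
proof induction
  case (coord k)
  then show ?case using assms(2) unfolding holomorphic_curve_def by auto
qed (auto intro: holomorphic_intros)

text \<open>
  The ring of holomorphic functions on a domain has no zero divisors.
\<close>

lemma holomorphic_mult_eq_0:
  assumes "open D" "connected D" "f holomorphic_on D" "g holomorphic_on D"
    and "\<And>\<zeta>. \<zeta> \<in> D \<Longrightarrow> f \<zeta> * g \<zeta> = 0"
  shows "(\<forall>\<zeta>\<in>D. f \<zeta> = 0) \<or> (\<forall>\<zeta>\<in>D. g \<zeta> = 0)"
proof (rule ccontr)
  assume "\<not> ?thesis"
  then obtain a b where a: "a \<in> D" "f a \<noteq> 0" and b: "b \<in> D" "g b \<noteq> 0" by blast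
  have "continuous_on D f" using assms by (simp add: holomorphic_on_imp_continuous_on)
  then have op: "open (D \<inter> f -` (-{0}))"
    using assms(1) by (intro continuous_open_preimage) auto
  have "g b = 0"
  proof (rule analytic_continuation_open[where s = "D \<inter> f -` (-{0})" and s' = D and f = g and g = "\<lambda>_. 0"])
    show "g z = 0" if "z \<in> D \<inter> f -` (-{0})" for z using assms(5)[of z] that by auto
  qed (use assms op a b in auto)
  with b show False by simp
qed

text \<open>
  If the curve left both \<open>A\<close> and \<open>B\<close>, there would be polynomials vanishing on \<open>A\<close> and on \<open>B\<close>
  respectively, neither of them zero along the curve, although their product is.
\<close>

lemma irreducible_set_curve:
  assumes D: "open D" "connected D" "D \<noteq> {}" and w: "holomorphic_curve K D w"
  shows "irreducible_set K (w ` D)"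
  unfolding irreducible_set_def
proof (intro conjI allI impI)
  show "w ` D \<noteq> {}" "w ` D \<subseteq> cspace K" using D w unfolding holomorphic_curve_def by auto
  fix A B assume AB: "algebraic_set K A \<and> algebraic_set K B \<and> w ` D \<subseteq> A \<union> B"
  obtain P where P: "P \<subseteq> polynomial_functions K" "A = {z \<in> cspace K. \<forall>f\<in>P. f z = 0}"
    using AB unfolding algebraic_set_def by auto
  obtain Q where Q: "Q \<subseteq> polynomial_functions K" "B = {z \<in> cspace K. \<forall>f\<in>Q. f z = 0}"
    using AB unfolding algebraic_set_def by auto
  show "w ` D \<subseteq> A \<or> w ` D \<subseteq> B"
  proof (rule ccontr)
    assume "\<not> ?thesis"
    then obtain a b where "a \<in> D" "w a \<notin> A" "b \<in> D" "w b \<notin> B" by blast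
    then obtain f g where fg: "f \<in> P" "f (w a) \<noteq> 0" "g \<in> Q" "g (w b) \<noteq> 0"
      using P Q w unfolding holomorphic_curve_def by auto
    have "(\<forall>\<zeta>\<in>D. f (w \<zeta>) = 0) \<or> (\<forall>\<zeta>\<in>D. g (w \<zeta>) = 0)"
    proof (rule holomorphic_mult_eq_0[OF D(1,2)])
      show "(\<lambda>\<zeta>. f (w \<zeta>)) holomorphic_on D" "(\<lambda>\<zeta>. g (w \<zeta>)) holomorphic_on D"
        using P Q fg polynomial_holomorphic_on_curve[OF _ w] by auto
      show "f (w \<zeta>) * g (w \<zeta>) = 0" if "\<zeta> \<in> D" for \<zeta>
      proof -
        have "w \<zeta> \<in> A \<union> B" using AB that by blast
        then show ?thesis using P Q fg by auto
      qed
    qed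
    then show False using fg \<open>a \<in> D\<close> \<open>b \<in> D\<close> by auto
  qed
qed

text \<open>
  A line through a point outside \<open>A\<close> and a point outside \<open>B\<close> would contradict the irreducibility of
  holomorphic curves.
\<close>

lemma irreducible_set_if_complex_lines:
  assumes ne: "S \<noteq> {}" and sub: "S \<subseteq> cspace K"
    and line: "\<And>x y \<zeta>. x \<in> S \<Longrightarrow> y \<in> S \<Longrightarrow> (\<lambda>k. x k + \<zeta> * (y k - x k)) \<in> S"
  shows "irreducible_set K S"
  unfolding irreducible_set_def
proof (intro conjI allI impI)
  fix A B assume AB: "algebraic_set K A \<and> algebraic_set K B \<and> S \<subseteq> A \<union> B"
  show "S \<subseteq> A \<or> S \<subseteq> B"
  proof (rule ccontr)
    assume "\<not> ?thesis"
    then obtain x y where xy: "x \<in> S" "x \<notin> A" "y \<in> S" "y \<notin> B" by blast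
    define w where "w \<zeta> = (\<lambda>k. x k + \<zeta> * (y k - x k))" for \<zeta>
    have "holomorphic_curve K UNIV w"
      using subsetD[OF sub xy(1)] subsetD[OF sub xy(3)]
      unfolding holomorphic_curve_def w_def cspace_def by (auto intro!: holomorphic_intros)
    then have "irreducible_set K (range w)" by (intro irreducible_set_curve) auto
    moreover have "range w \<subseteq> A \<union> B" using line[OF xy(1,3)] AB unfolding w_def by blast
    ultimately have "range w \<subseteq> A \<or> range w \<subseteq> B" using AB unfolding irreducible_set_def by blast
    moreover have "w 0 = x" "w 1 = y" by (auto simp: w_def)
    ultimately show False using xy by (metis rangeI subset_iff)
  qed
qed (use ne sub in auto)

section \<open>Block scalings\<close>

definition block_scale :: "(nat \<Rightarrow> complex) \<Rightarrow> (nat \<times> nat \<Rightarrow> complex) \<Rightarrow> nat \<times> nat \<Rightarrow> complex" where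
  "block_scale a z = (\<lambda>k. a (fst k) * z k)"

lemma block_scale_in_cspace: "z \<in> cspace K \<Longrightarrow> block_scale a z \<in> cspace K"
  unfolding block_scale_def cspace_def by auto

lemma block_scale_1 [simp]: "block_scale (\<lambda>_. 1) z = z" by (simp add: block_scale_def)

lemma V_subset_cspace: "z \<in> V s n \<theta> \<Longrightarrow> z \<in> cspace (idx s n)"
  by (simp add: V_def)

lemma block_scale_in_V: 
  assumes "z \<in> V s n \<theta>" shows "block_scale a z \<in> V s n \<theta>"
  unfolding V_def
proof (intro CollectI conjI allI impI)
  show "block_scale a z \<in> cspace (idx s n)" using assms by (intro block_scale_in_cspace V_subset_cspace)
  fix i j p q p' q'
  assume h: "1 \<le> i \<and> i < j \<and> j \<le> s \<and> p \<in> {1..n i} \<and> q \<in> {1..n j} \<and> \<theta> i j (p, q) = (p', q')"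
  then have "z (i, p) * z (j, q) = z (i, p') * z (j, q')"
    using assms unfolding V_def by blast
  then show "block_scale a z (i, p) * block_scale a z (j, q) = block_scale a z (i, p') * block_scale a z (j, q')"
    by (simp add: block_scale_def algebra_simps)
qed

lemma algebraic_set_V:
  assumes "permutation_set s n \<theta>"
  shows "algebraic_set (idx s n) (V s n \<theta>)"
proof -
  define P where "P = {(\<lambda>z :: nat \<times> nat \<Rightarrow> complex. z (i, p) * z (j, q) + (-1) * (z (i, p') * z (j, q'))) | i j p q p' q'.
     1 \<le> i \<and> i < j \<and> j \<le> s \<and> p \<in> {1..n i} \<and> q \<in> {1..n j} \<and> \<theta> i j (p, q) = (p', q')}"
  have "P \<subseteq> polynomial_functions (idx s n)"
  proof
    fix f assume "f \<in> P"
    then obtain i j p q p' q' where f: "f = (\<lambda>z. z (i, p) * z (j, q) + (-1) * (z (i, p') * z (j, q')))"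
      and h: "1 \<le> i" "i < j" "j \<le> s" "p \<in> {1..n i}" "q \<in> {1..n j}" "\<theta> i j (p, q) = (p', q')"
      unfolding P_def by blast
    have "(p', q') \<in> {1..n i} \<times> {1..n j}"
      using assms h bij_betwE unfolding permutation_set_def by (metis SigmaI)
    then have "(i, p) \<in> idx s n" "(j, q) \<in> idx s n" "(i, p') \<in> idx s n" "(j, q') \<in> idx s n"
      using h unfolding idx_def by auto
    then show "f \<in> polynomial_functions (idx s n)"
      unfolding f by (intro polynomial_functions.intros)
  qed
  moreover have V_eq: "V s n \<theta> = {z \<in> cspace (idx s n). \<forall>f\<in>P. f z = 0}" 
  proof (rule subset_antisym; rule subsetI)
    fix z assume z: "z \<in> V s n \<theta>"
    have "f z = 0" if "f \<in> P" for f
    proof -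
      obtain i j p q p' q' where f: "f = (\<lambda>z. z (i, p) * z (j, q) + (-1) * (z (i, p') * z (j, q')))"
        and h: "1 \<le> i \<and> i < j \<and> j \<le> s \<and> p \<in> {1..n i} \<and> q \<in> {1..n j} \<and> \<theta> i j (p, q) = (p', q')"
        using \<open>f \<in> P\<close> unfolding P_def by blast
      have "z (i, p) * z (j, q) = z (i, p') * z (j, q')" using z h unfolding V_def by blast
      then show ?thesis by (simp add: f)
    qed
    then show "z \<in> {z \<in> cspace (idx s n). \<forall>f\<in>P. f z = 0}" using z V_subset_cspace by blast
  next
    fix z assume z: "z \<in> {z \<in> cspace (idx s n). \<forall>f\<in>P. f z = 0}"
    have "z (i, p) * z (j, q) = z (i, p') * z (j, q')"
      if h: "1 \<le> i \<and> i < j \<and> j \<le> s \<and> p \<in> {1..n i} \<and> q \<in> {1..n j} \<and> \<theta> i j (p, q) = (p', q')"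
      for i j p q p' q'
    proof -
      have "(\<lambda>z. z (i, p) * z (j, q) + (-1) * (z (i, p') * z (j, q'))) \<in> P"
        unfolding P_def mem_Collect_eq
        by (rule exI[of _ i], rule exI[of _ j], rule exI[of _ p], rule exI[of _ q],
            rule exI[of _ p'], rule exI[of _ q']) (use h in simp)
      then have "z (i, p) * z (j, q) + (-1) * (z (i, p') * z (j, q')) = 0" using z by fast
      then show ?thesis by simp
    qed
    then show "z \<in> V s n \<theta>" using z unfolding V_def by blast
  qed
  ultimately show ?thesis unfolding algebraic_set_def V_eq by blast
qed

lemma polynomial_compose_block_scale:
  assumes "f \<in> polynomial_functions K"
  shows "(\<lambda>z. f (block_scale a z)) \<in> polynomial_functions K"
  using assms
proof induction
  case (coord k)
  have "(\<lambda>z. (\<lambda>z. a (fst k)) z * z k) \<in> polynomial_functions K"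
    using coord by (intro polynomial_functions.intros)
  then show ?case by (simp add: block_scale_def)
qed (auto intro: polynomial_functions.intros)

lemma algebraic_set_block_scale_vimage:
  assumes "algebraic_set K A"
  shows "algebraic_set K {z \<in> cspace K. \<forall>a\<in>I. block_scale a z \<in> A}"
proof -
  obtain P where P: "P \<subseteq> polynomial_functions K" "A = {z \<in> cspace K. \<forall>f\<in>P. f z = 0}"
    using assms unfolding algebraic_set_def by auto
  show ?thesis unfolding algebraic_set_def
    by (rule exI[of _ "{\<lambda>z. f (block_scale a z) | f a. f \<in> P \<and> a \<in> I}"])
       (use P in \<open>auto intro: polynomial_compose_block_scale block_scale_in_cspace\<close>)
qed

text \<open>
  The block scaling by \<open>a\<close> is joined to the identity by the complex line \<open>\<zeta> \<mapsto> 1 + \<zeta> (a - 1)\<close> of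
  block scalings. The union of the images of \<open>C\<close> under this family is irreducible: each orbit is a
  holomorphic curve, so it lies in one of any two algebraic sets covering the union, and the points
  whose orbit lies in a given algebraic set form an algebraic set. By maximality the Zariski closure of
  the union is \<open>C\<close> itself.
\<close>

lemma component_scale_closed:
  assumes perm: "permutation_set s n \<theta>"
    and C: "algebraic_component (idx s n) (V s n \<theta>) C" and z: "z \<in> C"
  shows "block_scale a z \<in> C"
proof -
  let ?K = "idx s n"
  define A where "A \<zeta> = (\<lambda>i. 1 + \<zeta> * (a i - 1))" for \<zeta> :: complex
  define S where "S = (\<Union>\<zeta>. block_scale (A \<zeta>) ` C)"
  have Cirr: "irreducible_algebraic_set ?K C" and CV: "C \<subseteq> V s n \<theta>"
    using C unfolding algebraic_component_def by auto
  have Ccsp: "C \<subseteq> cspace ?K" using CV V_subset_cspace by blast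
  have SV: "S \<subseteq> V s n \<theta>" unfolding S_def using CV block_scale_in_V by blast
  have "irreducible_set ?K S"
    unfolding irreducible_set_def
  proof (intro conjI allI impI)
    show "S \<noteq> {}" using z unfolding S_def by blast
    show "S \<subseteq> cspace ?K" using SV V_subset_cspace by blast
    fix X Y assume XY: "algebraic_set ?K X \<and> algebraic_set ?K Y \<and> S \<subseteq> X \<union> Y"
    let ?X = "{z \<in> cspace ?K. \<forall>a\<in>range A. block_scale a z \<in> X}"
    let ?Y = "{z \<in> cspace ?K. \<forall>a\<in>range A. block_scale a z \<in> Y}"
    have "C \<subseteq> ?X \<union> ?Y"
    proof
      fix x assume x: "x \<in> C"
      have "holomorphic_curve ?K UNIV (\<lambda>\<zeta>. block_scale (A \<zeta>) x)"
        using block_scale_in_cspace[OF subsetD[OF Ccsp x]] unfolding holomorphic_curve_def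
        by (auto intro!: holomorphic_intros) (auto intro!: holomorphic_intros simp: block_scale_def A_def)
      then have "irreducible_set ?K (range (\<lambda>\<zeta>. block_scale (A \<zeta>) x))"
        by (intro irreducible_set_curve) auto
      moreover have "range (\<lambda>\<zeta>. block_scale (A \<zeta>) x) \<subseteq> X \<union> Y" using XY x unfolding S_def by blast
      ultimately have "range (\<lambda>\<zeta>. block_scale (A \<zeta>) x) \<subseteq> X \<or> range (\<lambda>\<zeta>. block_scale (A \<zeta>) x) \<subseteq> Y"
        using XY unfolding irreducible_set_def by blast
      then show "x \<in> ?X \<union> ?Y" using x Ccsp by blast
    qed
    moreover have "algebraic_set ?K ?X" "algebraic_set ?K ?Y"
      using XY algebraic_set_block_scale_vimage by blast+
    ultimately have "C \<subseteq> ?X \<or> C \<subseteq> ?Y"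
      using irreducible_algebraic_setD[OF Cirr] unfolding irreducible_set_def by blast
    then show "S \<subseteq> X \<or> S \<subseteq> Y" unfolding S_def by blast
  qed
  then have irr: "irreducible_algebraic_set ?K (zariski_closure ?K S)"
    by (rule irreducible_algebraic_set_zariski_closure)
  have sub: "S \<subseteq> zariski_closure ?K S"
    using SV V_subset_cspace by (intro zariski_closure_superset) blast
  have "C \<subseteq> S"
  proof
    fix x assume "x \<in> C"
    then have "block_scale (A 0) x \<in> S" unfolding S_def by blast
    then show "x \<in> S" by (simp add: A_def)
  qed
  then have "zariski_closure ?K S = C"
    using C irr sub zariski_closure_minimal[OF algebraic_set_V[OF perm] SV]
    unfolding algebraic_component_def by blast
  moreover have "A 1 = a" by (auto simp: A_def)
  then have "block_scale a z \<in> S" unfolding S_def using z by blast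
  ultimately show ?thesis using sub by blast
qed

lemma polynomial_tendsto:
  assumes "f \<in> polynomial_functions K" "\<And>k. k \<in> K \<Longrightarrow> ((\<lambda>x. w x k) \<longlongrightarrow> z k) F"
  shows "((\<lambda>x. f (w x)) \<longlongrightarrow> f z) F"
  using assms(1)
proof induction
  case (coord k)
  then show ?case by (rule assms(2))
qed (simp_all add: tendsto_add tendsto_mult)

lemma algebraic_set_limit:
  assumes A: "algebraic_set K A" and lim: "\<And>k. k \<in> K \<Longrightarrow> ((\<lambda>x. w x k) \<longlongrightarrow> z k) F"
    and ev: "eventually (\<lambda>x. w x \<in> A) F" and F: "F \<noteq> bot" and z: "z \<in> cspace K"
  shows "z \<in> A"
proof -
  obtain P where P: "P \<subseteq> polynomial_functions K" "A = {z \<in> cspace K. \<forall>f\<in>P. f z = 0}"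
    using A unfolding algebraic_set_def by auto
  have "f z = 0" if f: "f \<in> P" for f
  proof -
    have "((\<lambda>x. f (w x)) \<longlongrightarrow> f z) F"
      by (rule polynomial_tendsto[where w = w, OF subsetD[OF P(1) f] lim])
    moreover have "eventually (\<lambda>x. f (w x) = 0) F"
      by (rule eventually_mono[OF ev]) (use P(2) f in blast)
    ultimately show ?thesis
      using tendsto_unique[OF F] tendsto_eventually[of "\<lambda>x. f (w x)"] by blast
  qed
  then show ?thesis using P(2) z by blast
qed

section \<open>Euclidean norm and complex differentiability on finite index sets\<close>

definition cnorm :: "'k set \<Rightarrow> ('k \<Rightarrow> complex) \<Rightarrow> real" where
  "cnorm K z = L2_set (\<lambda>k. cmod (z k)) K"

lemma cnorm_nonneg [simp]: "0 \<le> cnorm K z"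
  by (simp add: cnorm_def)

lemma cnorm_zero [simp]: "cnorm K (\<lambda>k. 0) = 0"
  by (simp add: cnorm_def L2_set_0')

lemma cmod_le_cnorm: "finite K \<Longrightarrow> k \<in> K \<Longrightarrow> cmod (z k) \<le> cnorm K z"
  unfolding cnorm_def by (rule member_le_L2_set)

lemma cnorm_triangle: "cnorm K (\<lambda>k. w k + z k) \<le> cnorm K w + cnorm K z"
  unfolding cnorm_def
  by (rule order_trans[OF L2_set_mono L2_set_triangle_ineq]) (auto simp: norm_triangle_ineq)

lemma cnorm_mult: "cnorm K (\<lambda>k. \<zeta> * z k) = cmod \<zeta> * cnorm K z"
  unfolding cnorm_def by (simp add: norm_mult L2_set_right_distrib)

lemma cnorm_divide: "cnorm K (\<lambda>k. z k / \<zeta>) = cnorm K z / cmod \<zeta>"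
  using cnorm_mult[of K "1 / \<zeta>" z] by (simp add: norm_divide)

lemma cnorm_diff: "cnorm K (\<lambda>k. w k - z k) \<le> cnorm K w + cnorm K z"
  using cnorm_triangle[of K w "\<lambda>k. - z k"] by (simp add: cnorm_def)

lemma cnorm_eq_0_iff: "finite K \<Longrightarrow> cnorm K z = 0 \<longleftrightarrow> (\<forall>k\<in>K. z k = 0)"
  by (simp add: cnorm_def L2_set_eq_0_iff)

lemma tendsto_cnorm:
  assumes "\<And>k. k \<in> K \<Longrightarrow> ((\<lambda>x. w x k) \<longlongrightarrow> z k) F"
  shows "((\<lambda>x. cnorm K (w x)) \<longlongrightarrow> cnorm K z) F"
  unfolding cnorm_def L2_set_def
  by (rule tendsto_real_sqrt, rule tendsto_sum, rule tendsto_power, rule tendsto_norm, rule assms)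

lemma cspace_eqI:
  assumes "w \<in> cspace K" "z \<in> cspace K" "\<And>k. k \<in> K \<Longrightarrow> w k = z k"
  shows "w = z"
proof
  show "w k = z k" for k using assms unfolding cspace_def by (cases "k \<in> K") auto
qed

text \<open>
  On \<open>cspace K\<close> with \<open>K\<close> finite, the product topology is the norm topology; this is the half needed
  to turn the topological definitions into estimates.
\<close>

lemma cspace_neighbourhood:
  fixes z :: "'k \<Rightarrow> complex"
  assumes K: "finite K" and U: "open U" "z \<in> U" and z: "z \<in> cspace K"
  obtains r where "r > 0" "\<And>w. w \<in> cspace K \<Longrightarrow> cnorm K (\<lambda>k. w k - z k) < r \<Longrightarrow> w \<in> U"
proof -
  have "openin (product_topology (\<lambda>_. euclidean) UNIV) U"
    using U(1) by (simp add: open_fun_def)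
  from product_topology_open_contains_basis[OF this U(2)]
  obtain X where X: "z \<in> Pi\<^sub>E UNIV X" "\<And>i. open (X i)" "Pi\<^sub>E UNIV X \<subseteq> U"
    by auto
  have "\<exists>r>0. ball (z k) r \<subseteq> X k" for k
    using X(1,2) by (auto simp: open_contains_ball)
  then obtain \<rho> where \<rho>: "\<And>k. \<rho> k > 0" "\<And>k. ball (z k) (\<rho> k) \<subseteq> X k" by metis
  define r where "r = Min (insert 1 (\<rho> ` K))"
  have r: "r > 0" "\<And>k. k \<in> K \<Longrightarrow> r \<le> \<rho> k"
    unfolding r_def using K \<rho>(1) by auto
  have "w \<in> U" if w: "w \<in> cspace K" "cnorm K (\<lambda>k. w k - z k) < r" for w
  proof -
    have "w k \<in> X k" for k
    proof (cases "k \<in> K")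
      case True
      have "cmod (w k - z k) < \<rho> k"
        using cmod_le_cnorm[OF K True, of "\<lambda>k. w k - z k"] w(2) r(2)[OF True] by linarith
      then show ?thesis using \<rho>(2)[of k] by (auto simp: dist_norm norm_minus_commute)
    next
      case False
      then have "w k = z k" using w(1) z unfolding cspace_def by simp
      then show ?thesis using X(1) by auto
    qed
    then show ?thesis using X(3) by auto
  qed
  then show ?thesis using that r(1) by blast
qed

lemma complex_differentiable_atD:
  assumes K: "finite K" and z: "z \<in> cspace K" and F: "complex_differentiable_at K F z"
  obtains c where "\<And>\<epsilon>. \<epsilon> > 0 \<Longrightarrow> \<exists>r>0. \<forall>w\<in>cspace K. cnorm K (\<lambda>k. w k - z k) < r \<longrightarrow>
     cmod (F w - F z - (\<Sum>k\<in>K. c k * (w k - z k))) \<le> \<epsilon> * cnorm K (\<lambda>k. w k - z k)"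
proof -
  obtain c where c: "((\<lambda>w. (F w - F z - (\<Sum>k\<in>K. c k * (w k - z k)))
               / of_real (cnorm K (\<lambda>k. w k - z k))) \<longlongrightarrow> 0) (at z within cspace K)"
    using F unfolding complex_differentiable_at_def cnorm_def by blast
  have "\<exists>r>0. \<forall>w\<in>cspace K. cnorm K (\<lambda>k. w k - z k) < r \<longrightarrow>
     cmod (F w - F z - (\<Sum>k\<in>K. c k * (w k - z k))) \<le> \<epsilon> * cnorm K (\<lambda>k. w k - z k)"
    if "\<epsilon> > 0" for \<epsilon>
  proof -
    from tendstoD[OF c that] obtain U where U: "open U" "z \<in> U"
      "\<And>w. w \<in> U \<Longrightarrow> w \<noteq> z \<Longrightarrow> w \<in> cspace K \<Longrightarrow>
         dist ((F w - F z - (\<Sum>k\<in>K. c k * (w k - z k))) / of_real (cnorm K (\<lambda>k. w k - z k))) 0 < \<epsilon>"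
      unfolding eventually_at_topological by blast
    obtain r where r: "r > 0" "\<And>w. w \<in> cspace K \<Longrightarrow> cnorm K (\<lambda>k. w k - z k) < r \<Longrightarrow> w \<in> U"
      using cspace_neighbourhood[OF K U(1,2) z] by blast
    have "cmod (F w - F z - (\<Sum>k\<in>K. c k * (w k - z k))) \<le> \<epsilon> * cnorm K (\<lambda>k. w k - z k)"
      if w: "w \<in> cspace K" "cnorm K (\<lambda>k. w k - z k) < r" for w
    proof (cases "w = z")
      case False
      have "\<not> (\<forall>k\<in>K. w k - z k = 0)" using cspace_eqI[OF w(1) z] False by auto
      then have pos: "cnorm K (\<lambda>k. w k - z k) > 0"
        using cnorm_eq_0_iff[OF K, of "\<lambda>k. w k - z k"] cnorm_nonneg[of K "\<lambda>k. w k - z k"] by linarith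
      then show ?thesis
        using U(3)[OF r(2)[OF w] False w(1)] by (simp add: norm_divide field_simps)
    qed simp
    then show ?thesis using r(1) by blast
  qed
  then show ?thesis using that by blast
qed

text \<open>
  The common core of the chain rule and of all first order expansions below: a quantity that is
  approximated by a linear form of \<open>d\<close> up to \<open>o(\<parallel>d\<parallel>)\<close> has the expected limit after division by any
  \<open>g\<close> for which \<open>d / g\<close> converges.
\<close>

lemma tendsto_quotient_little_o:
  fixes d :: "'x \<Rightarrow> 'k \<Rightarrow> complex"
  assumes o: "\<And>\<epsilon>. \<epsilon> > 0 \<Longrightarrow>
      \<forall>\<^sub>F x in F. cmod (\<Delta> x - (\<Sum>k\<in>K. c k * d x k)) \<le> \<epsilon> * cnorm K (d x)"
    and P: "\<And>k. k \<in> K \<Longrightarrow> ((\<lambda>x. d x k / g x) \<longlongrightarrow> P k) F"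
  shows "((\<lambda>x. \<Delta> x / g x) \<longlongrightarrow> (\<Sum>k\<in>K. c k * P k)) F"
proof -
  define q where "q x = (\<lambda>k. d x k / g x)" for x
  have "((\<lambda>x. cnorm K (q x)) \<longlongrightarrow> cnorm K P) F"
    unfolding q_def by (rule tendsto_cnorm) (rule P)
  then have bounded: "\<forall>\<^sub>F x in F. cnorm K (q x) < cnorm K P + 1"
    by (rule order_tendstoD) simp
  have err: "((\<lambda>x. (\<Delta> x - (\<Sum>k\<in>K. c k * d x k)) / g x) \<longlongrightarrow> 0) F"
  proof (rule tendstoI)
    fix e :: real assume e: "e > 0"
    define \<epsilon> where "\<epsilon> = e / (cnorm K P + 1)"
    have pos: "cnorm K P + 1 > 0" using cnorm_nonneg[of K P] by linarith
    then have \<epsilon>: "\<epsilon> > 0" using e by (simp add: \<epsilon>_def)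
    show "\<forall>\<^sub>F x in F. dist ((\<Delta> x - (\<Sum>k\<in>K. c k * d x k)) / g x) 0 < e"
      using o[OF \<epsilon>] bounded
    proof eventually_elim
      case (elim x)
      have "cmod (\<Delta> x - (\<Sum>k\<in>K. c k * d x k)) / cmod (g x) \<le> \<epsilon> * cnorm K (d x) / cmod (g x)"
        using elim(1) by (rule divide_right_mono) simp
      also have "\<dots> = \<epsilon> * cnorm K (q x)"
        unfolding q_def cnorm_divide by simp
      also have "\<dots> < \<epsilon> * (cnorm K P + 1)" using elim(2) \<epsilon> by simp
      also have "\<dots> = e" using pos by (simp add: \<epsilon>_def)
      finally show ?case by (simp add: norm_divide)
    qed
  qed
  have "((\<lambda>x. \<Sum>k\<in>K. c k * q x k) \<longlongrightarrow> (\<Sum>k\<in>K. c k * P k)) F"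
    unfolding q_def by (rule tendsto_sum, rule tendsto_mult_left, rule P)
  from tendsto_add[OF err this]
  have "((\<lambda>x. (\<Delta> x - (\<Sum>k\<in>K. c k * d x k)) / g x + (\<Sum>k\<in>K. c k * q x k))
      \<longlongrightarrow> (\<Sum>k\<in>K. c k * P k)) F" by simp
  moreover have "(\<Delta> x - (\<Sum>k\<in>K. c k * d x k)) / g x + (\<Sum>k\<in>K. c k * q x k) = \<Delta> x / g x" for x
  proof -
    have "(\<Sum>k\<in>K. c k * q x k) = (\<Sum>k\<in>K. c k * d x k) / g x"
      unfolding q_def sum_divide_distrib by simp
    then show ?thesis by (simp flip: add_divide_distrib)
  qed
  ultimately show ?thesis by simp
qed

lemma complex_differentiable_compose_curve:
  assumes K: "finite K" and D: "open D" "\<xi> \<in> D" and w: "holomorphic_curve K D w"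
    and F: "complex_differentiable_at K F (w \<xi>)"
  shows "(\<lambda>\<zeta>. F (w \<zeta>)) field_differentiable at \<xi>"
proof -
  have wcs: "w \<zeta> \<in> cspace K" if "\<zeta> \<in> D" for \<zeta> using w that unfolding holomorphic_curve_def by blast
  obtain c where c: "\<And>\<epsilon>. \<epsilon> > 0 \<Longrightarrow> \<exists>r>0. \<forall>z\<in>cspace K. cnorm K (\<lambda>k. z k - w \<xi> k) < r \<longrightarrow>
     cmod (F z - F (w \<xi>) - (\<Sum>k\<in>K. c k * (z k - w \<xi> k))) \<le> \<epsilon> * cnorm K (\<lambda>k. z k - w \<xi> k)"
    using complex_differentiable_atD[OF K wcs[OF D(2)] F] by blast
  define a where "a k = deriv (\<lambda>\<zeta>. w \<zeta> k) \<xi>" for k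
  have quot: "((\<lambda>\<zeta>. (w \<zeta> k - w \<xi> k) / (\<zeta> - \<xi>)) \<longlongrightarrow> a k) (at \<xi>)" if "k \<in> K" for k
  proof -
    have "((\<lambda>\<zeta>. w \<zeta> k) has_field_derivative a k) (at \<xi>)"
      using w D that unfolding holomorphic_curve_def a_def by (auto intro: holomorphic_derivI)
    then show ?thesis by (simp add: has_field_derivative_iff)
  qed
  have "((\<lambda>\<zeta>. w \<zeta> k - w \<xi> k) \<longlongrightarrow> 0) (at \<xi>)" if "k \<in> K" for k
  proof -
    have "((\<lambda>\<zeta>. w \<zeta> k) \<longlongrightarrow> w \<xi> k) (at \<xi>)"
      using w D that unfolding holomorphic_curve_def
      by (metis continuous_on_eq_continuous_at holomorphic_on_imp_continuous_on isContD)
    then show ?thesis by (simp add: LIM_zero)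
  qed
  then have small: "((\<lambda>\<zeta>. cnorm K (\<lambda>k. w \<zeta> k - w \<xi> k)) \<longlongrightarrow> 0) (at \<xi>)"
    using tendsto_cnorm[of K "\<lambda>\<zeta> k. w \<zeta> k - w \<xi> k" "\<lambda>_. 0"] by simp
  have "((\<lambda>\<zeta>. (F (w \<zeta>) - F (w \<xi>)) / (\<zeta> - \<xi>)) \<longlongrightarrow> (\<Sum>k\<in>K. c k * a k)) (at \<xi>)"
  proof (rule tendsto_quotient_little_o[OF _ quot])
    fix \<epsilon> :: real assume "\<epsilon> > 0"
    then obtain r where r: "r > 0" "\<forall>z\<in>cspace K. cnorm K (\<lambda>k. z k - w \<xi> k) < r \<longrightarrow>
     cmod (F z - F (w \<xi>) - (\<Sum>k\<in>K. c k * (z k - w \<xi> k))) \<le> \<epsilon> * cnorm K (\<lambda>k. z k - w \<xi> k)"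
      using c by blast
    show "\<forall>\<^sub>F \<zeta> in at \<xi>. cmod (F (w \<zeta>) - F (w \<xi>) - (\<Sum>k\<in>K. c k * (w \<zeta> k - w \<xi> k)))
        \<le> \<epsilon> * cnorm K (\<lambda>k. w \<zeta> k - w \<xi> k)"
      using order_tendstoD(2)[OF small r(1)] eventually_at_in_open'[OF D]
      by eventually_elim (use r(2) wcs in blast)
  qed
  then have "((\<lambda>\<zeta>. F (w \<zeta>)) has_field_derivative (\<Sum>k\<in>K. c k * a k)) (at \<xi>)"
    by (simp add: has_field_derivative_iff)
  then show ?thesis by (auto simp: field_differentiable_def)
qed

section \<open>Variants of the Schwarz lemma\<close>

lemma Schwarz_ball:
  assumes h: "h holomorphic_on ball 0 R" "h 0 = 0" and M: "\<And>\<zeta>. cmod \<zeta> < R \<Longrightarrow> cmod (h \<zeta>) \<le> M"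
    and \<zeta>: "cmod \<zeta> < R"
  shows "cmod (h \<zeta>) \<le> M * cmod \<zeta> / R"
proof -
  have R: "R > 0" using \<zeta> norm_ge_zero[of \<zeta>] by linarith
  have M0: "M \<ge> 0" using M[of 0] R norm_ge_zero[of "h 0"] by (metis norm_zero order_trans)
  have le: "cmod (h \<zeta>) \<le> (M + e) * cmod \<zeta> / R" if e: "e > 0" for e
  proof -
    define f where "f \<xi> = h (of_real R * \<xi>) / of_real (M + e)" for \<xi>
    have "f holomorphic_on ball 0 1"
      unfolding f_def using R M0 e
      by (intro holomorphic_intros holomorphic_on_compose_gen[OF _ h(1), unfolded o_def])
         (auto simp: norm_mult simp flip: of_real_add)
    moreover have "cmod (f \<xi>) < 1" if "cmod \<xi> < 1" for \<xi>
    proof -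
      have "cmod (of_real R * \<xi>) < R" using that R by (simp add: norm_mult)
      from M[OF this] show ?thesis unfolding f_def using M0 e
        by (simp add: norm_divide field_simps flip: of_real_add)
    qed
    moreover have "cmod (\<zeta> / of_real R) < 1" using \<zeta> R by (simp add: norm_divide)
    moreover have "f 0 = 0" by (simp add: f_def h)
    ultimately have "cmod (f (\<zeta> / of_real R)) \<le> cmod (\<zeta> / of_real R)"
      by (intro Schwarz_Lemma(1)) auto
    then show ?thesis unfolding f_def using R M0 e
      by (simp add: norm_divide field_simps flip: of_real_add)
  qed
  show ?thesis
  proof (rule field_le_epsilon)
    fix e :: real assume e: "e > 0"
    have "cmod (h \<zeta>) \<le> (M + e) * cmod \<zeta> / R" by (rule le[OF e])
    also have "\<dots> = M * cmod \<zeta> / R + e * (cmod \<zeta> / R)" by (simp add: field_simps add_divide_distrib)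
    also have "e * (cmod \<zeta> / R) \<le> e" using \<zeta> R e by (intro mult_left_le) auto
    finally show "cmod (h \<zeta>) \<le> M * cmod \<zeta> / R + e" by simp
  qed
qed

text \<open>
  Dividing by \<open>\<zeta>\<close> and applying the Schwarz lemma \<open>q\<close> times. For \<open>\<zeta> = 0\<close> the bound on \<open>g\<close> is Cauchy's
  estimate for the coefficient of \<open>\<zeta>\<^sup>q\<close>; with \<open>L = 0\<close> and all \<open>q\<close> at once, \<open>cmod (f \<zeta>) \<le> M (cmod \<zeta>)\<^sup>q\<close> shows that a
  function vanishing to every order at the origin is zero.
\<close>

lemma Schwarz_power:
  assumes f: "f holomorphic_on ball 0 1" and M: "\<And>\<zeta>. cmod \<zeta> < 1 \<Longrightarrow> cmod (f \<zeta>) \<le> M"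
    and lim: "((\<lambda>\<zeta>. f \<zeta> / \<zeta> ^ q) \<longlongrightarrow> L) (at 0)"
  shows "\<exists>g. g holomorphic_on ball 0 1 \<and> (\<forall>\<zeta>. cmod \<zeta> < 1 \<longrightarrow> cmod (g \<zeta>) \<le> M \<and> f \<zeta> = \<zeta> ^ q * g \<zeta>)
     \<and> g 0 = L"
  using lim
proof (induction q arbitrary: L)
  case 0
  have "(f \<longlongrightarrow> f 0) (at 0)"
    using f by (metis centre_in_ball continuous_on_eq_continuous_at holomorphic_on_imp_continuous_on
        isContD open_ball zero_less_one)
  then have "L = f 0" using 0 by (auto intro: LIM_unique)
  then show ?case using f M by auto
next
  case (Suc q)
  have z: "((\<lambda>\<zeta>. \<zeta> * (f \<zeta> / \<zeta> ^ Suc q)) \<longlongrightarrow> 0 * L) (at 0)"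
    by (intro tendsto_mult Suc.prems) auto
  have z': "\<forall>\<^sub>F \<zeta> in at 0. \<zeta> * (f \<zeta> / \<zeta> ^ Suc q) = f \<zeta> / \<zeta> ^ q"
    by (simp add: eventually_at_filter)
  have "((\<lambda>\<zeta>. f \<zeta> / \<zeta> ^ q) \<longlongrightarrow> 0) (at 0)"
    using Lim_transform_eventually[OF z z'] unfolding mult_zero_left .
  then obtain g where g: "g holomorphic_on ball 0 1" "\<And>\<zeta>. cmod \<zeta> < 1 \<Longrightarrow> cmod (g \<zeta>) \<le> M"
    "\<And>\<zeta>. cmod \<zeta> < 1 \<Longrightarrow> f \<zeta> = \<zeta> ^ q * g \<zeta>" "g 0 = 0"
    using Suc.IH[of 0] by blast
  obtain h where h: "h holomorphic_on ball 0 1" "\<And>\<zeta>. cmod \<zeta> < 1 \<Longrightarrow> g \<zeta> = \<zeta> * h \<zeta>"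
    using Schwarz3[OF g(1,4)] by blast
  have hc: "(h \<longlongrightarrow> h 0) (at 0)"
    using h(1) by (metis centre_in_ball continuous_on_eq_continuous_at holomorphic_on_imp_continuous_on
        isContD open_ball zero_less_one)
  have hle: "cmod (h \<zeta>) \<le> M" if "cmod \<zeta> < 1" "\<zeta> \<noteq> 0" for \<zeta>
  proof -
    have "cmod (g \<zeta>) \<le> M * cmod \<zeta>"
      using Schwarz_ball[OF g(1,4), of M \<zeta>] g(2) that by simp
    then show ?thesis using h(2)[OF that(1)] that by (simp add: norm_mult)
  qed
  have ev: "\<forall>\<^sub>F \<zeta> in at (0::complex). \<zeta> \<in> ball 0 1 - {0}"
    by (rule eventually_at_in_open) auto
  have "cmod (h 0) \<le> M"
    by (rule Lim_norm_ubound[OF _ hc]) (use ev hle in \<open>auto elim: eventually_mono\<close>)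
  moreover have "\<forall>\<^sub>F \<zeta> in at 0. f \<zeta> / \<zeta> ^ Suc q = h \<zeta>"
    using ev by eventually_elim (use g(3) h(2) in auto)
  then have "((\<lambda>\<zeta>. f \<zeta> / \<zeta> ^ Suc q) \<longlongrightarrow> h 0) (at 0)"
    using tendsto_cong[of "\<lambda>\<zeta>. f \<zeta> / \<zeta> ^ Suc q" h] hc by blast
  then have "h 0 = L" using Suc.prems by (rule LIM_unique)
  moreover have "f \<zeta> = \<zeta> ^ Suc q * h \<zeta>" if "cmod \<zeta> < 1" for \<zeta>
    using g(3)[OF that] h(2)[OF that] by simp
  ultimately show ?case using h(1) hle by (intro exI[of _ h] conjI allI impI) (metis+)
qed

text \<open>
  Subtracting the derivative at the origin leaves a function \<open>G\<close> with \<open>G w = o(\<parallel>w\<parallel>)\<close>. On the complex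
  line through \<open>w'\<close> and \<open>w\<close>, the function \<open>G\<close> is bounded by a small multiple of \<open>r\<close> on a disc of radius
  comparable to \<open>r / \<parallel>w - w'\<parallel>\<close>, so the Schwarz lemma bounds \<open>G w - G w'\<close> by a small multiple of
  \<open>\<parallel>w - w'\<parallel>\<close>. Estimating differences, not just values, is what allows iterating a map.
\<close>

lemma strict_derivative_at_0:
  assumes K: "finite K" and U: "open U" "(\<lambda>_. 0) \<in> U"
    and F: "\<And>w. w \<in> U \<inter> cspace K \<Longrightarrow> complex_differentiable_at K F w"
  obtains c where "\<And>\<epsilon>. \<epsilon> > 0 \<Longrightarrow> \<exists>r>0. \<forall>w\<in>cspace K. \<forall>w'\<in>cspace K. cnorm K w < r \<longrightarrow> cnorm K w' < r \<longrightarrow>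
     cmod (F w - F w' - (\<Sum>k\<in>K. c k * (w k - w' k))) \<le> \<epsilon> * cnorm K (\<lambda>k. w k - w' k)"
proof -
  have 0: "(\<lambda>_. 0) \<in> cspace K" by (simp add: cspace_def)
  obtain R where R: "R > 0" "\<And>w. w \<in> cspace K \<Longrightarrow> cnorm K w < R \<Longrightarrow> w \<in> U"
    using cspace_neighbourhood[OF K U 0] by auto
  obtain c where c: "\<And>\<epsilon>. \<epsilon> > 0 \<Longrightarrow> \<exists>r>0. \<forall>w\<in>cspace K. cnorm K w < r \<longrightarrow>
     cmod (F w - F (\<lambda>_. 0) - (\<Sum>k\<in>K. c k * w k)) \<le> \<epsilon> * cnorm K w"
    using complex_differentiable_atD[OF K 0 F] U 0 by auto
  have "\<exists>r>0. \<forall>w\<in>cspace K. \<forall>w'\<in>cspace K. cnorm K w < r \<longrightarrow> cnorm K w' < r \<longrightarrow>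
     cmod (F w - F w' - (\<Sum>k\<in>K. c k * (w k - w' k))) \<le> \<epsilon> * cnorm K (\<lambda>k. w k - w' k)"
    if \<epsilon>: "\<epsilon> > 0" for \<epsilon>
  proof -
    define G where "G w = F w - F (\<lambda>_. 0) - (\<Sum>k\<in>K. c k * w k)" for w
    obtain r0 where r0: "r0 > 0" "\<And>w. w\<in>cspace K \<Longrightarrow> cnorm K w < r0 \<Longrightarrow> cmod (G w) \<le> \<epsilon> / 4 * cnorm K w"
      using c[of "\<epsilon> / 4"] \<epsilon> unfolding G_def by auto
    define r where "r = min r0 R"
    have r: "r > 0" "r \<le> r0" "r \<le> R" using r0 R by (auto simp: r_def)
    have "cmod (F w - F w' - (\<Sum>k\<in>K. c k * (w k - w' k))) \<le> \<epsilon> * cnorm K (\<lambda>k. w k - w' k)"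
      if w: "w \<in> cspace K" "w' \<in> cspace K" "cnorm K w < r / 4" "cnorm K w' < r / 4" for w w'
    proof (cases "w = w'")
      case False
      define \<delta> where "\<delta> = cnorm K (\<lambda>k. w k - w' k)"
      have "\<not> (\<forall>k\<in>K. w k - w' k = 0)" using cspace_eqI[OF w(1,2)] False by auto
      then have \<delta>: "\<delta> > 0" unfolding \<delta>_def
        using cnorm_eq_0_iff[OF K, of "\<lambda>k. w k - w' k"] cnorm_nonneg[of K "\<lambda>k. w k - w' k"] by linarith
      have \<delta>r: "\<delta> < r / 2" using cnorm_diff[of K w w'] w unfolding \<delta>_def by linarith
      define p where "p \<zeta> = (\<lambda>k. w' k + \<zeta> * (w k - w' k))" for \<zeta>
      \<comment> \<open>the radius up to which the line through \<open>w'\<close> and \<open>w\<close> stays in the ball of radius \<open>r\<close>\<close>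
      define Q where "Q = r / (2 * \<delta>)"
      have Q: "1 < Q" using \<delta>r \<delta> by (simp add: Q_def field_simps)
      have pcs: "p \<zeta> \<in> cspace K" for \<zeta> using w(1,2) by (simp add: p_def cspace_def)
      have pcurve: "holomorphic_curve K (ball 0 Q) p"
        using pcs unfolding holomorphic_curve_def by (auto simp: p_def intro!: holomorphic_intros)
      have pn: "cnorm K (p \<zeta>) < r" if "cmod \<zeta> < Q" for \<zeta>
      proof -
        have "cnorm K (p \<zeta>) \<le> cnorm K w' + cmod \<zeta> * \<delta>"
          unfolding p_def \<delta>_def using cnorm_triangle[of K w' "\<lambda>k. \<zeta> * (w k - w' k)"]
          by (simp add: cnorm_mult)
        also have "cmod \<zeta> * \<delta> < r / 2" using that \<delta> by (simp add: Q_def field_simps)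
        finally show ?thesis using w(4) r(1) by linarith
      qed
      define h where "h \<zeta> = G (p \<zeta>) - G (p 0)" for \<zeta>
      have "(\<lambda>\<zeta>. F (p \<zeta>)) holomorphic_on ball 0 Q"
        unfolding holomorphic_on_def
      proof
        fix \<xi> :: complex assume \<xi>: "\<xi> \<in> ball 0 Q"
        have "p \<xi> \<in> U" using R(2)[OF pcs] pn[of \<xi>] \<xi> r(3) by simp
        then have "(\<lambda>\<zeta>. F (p \<zeta>)) field_differentiable at \<xi>"
          using pcs F by (intro complex_differentiable_compose_curve[OF K open_ball \<xi> pcurve]) blast
        then show "(\<lambda>\<zeta>. F (p \<zeta>)) field_differentiable at \<xi> within ball 0 Q"
          by (rule field_differentiable_at_within)
      qed
      then have hol: "h holomorphic_on ball 0 Q"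
        unfolding h_def G_def p_def by (intro holomorphic_intros)
      have Gle: "cmod (G (p \<zeta>)) \<le> \<epsilon> / 4 * r" if "cmod \<zeta> < Q" for \<zeta>
      proof -
        have "cmod (G (p \<zeta>)) \<le> \<epsilon> / 4 * cnorm K (p \<zeta>)"
          using r0(2)[OF pcs] pn[OF that] r(2) by simp
        also have "\<dots> \<le> \<epsilon> / 4 * r" using pn[OF that] \<epsilon> by simp
        finally show ?thesis .
      qed
      have "cmod (h 1) \<le> (\<epsilon> / 2 * r) * cmod 1 / Q"
      proof (rule Schwarz_ball[OF hol])
        show "cmod (h \<zeta>) \<le> \<epsilon> / 2 * r" if "cmod \<zeta> < Q" for \<zeta>
          using norm_triangle_ineq4[of "G (p \<zeta>)" "G (p 0)"] Gle[OF that] Gle[of 0] Q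
          unfolding h_def by simp
      qed (use Q in \<open>auto simp: h_def\<close>)
      also have "\<dots> = \<epsilon> * \<delta>" using r(1) \<delta> by (simp add: Q_def field_simps)
      finally have "cmod (h 1) \<le> \<epsilon> * \<delta>" .
      moreover have "h 1 = F w - F w' - (\<Sum>k\<in>K. c k * (w k - w' k))"
        unfolding h_def G_def p_def by (simp add: right_diff_distrib sum_subtractf)
      ultimately show ?thesis unfolding \<delta>_def by simp
    qed simp
    then show ?thesis using r(1) by (intro exI[of _ "r / 4"]) auto
  qed
  then show ?thesis using that by blast
qed

section \<open>Disc curves\<close>

lemma finite_idx [simp]: "finite (idx s n)"
  by (simp add: idx_def)

lemma zero_in_cspace [simp]: "(\<lambda>_. 0) \<in> cspace K"
  by (simp add: cspace_def)

lemma block_norm_le_cnorm: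
  assumes "i \<in> {1..s}" shows "block_norm n i z \<le> cnorm (idx s n) z"
proof -
  have "(\<Sum>p\<in>{1..n i}. (cmod (z (i, p)))\<^sup>2) = (\<Sum>k\<in>Pair i ` {1..n i}. (cmod (z k))\<^sup>2)"
    by (simp add: sum.reindex inj_on_def)
  also have "\<dots> \<le> (\<Sum>k\<in>idx s n. (cmod (z k))\<^sup>2)"
    using assms by (intro sum_mono2) (auto simp: idx_def)
  finally show ?thesis unfolding block_norm_def cnorm_def L2_set_def by (rule real_sqrt_le_mono)
qed

lemma block_norm_scale: "block_norm n i (block_scale a z) = cmod (a i) * block_norm n i z"
  unfolding block_norm_def block_scale_def by (simp add: norm_mult L2_set_right_distrib)

lemma cmod_le_block_norm: "p \<in> {1..n i} \<Longrightarrow> cmod (z (i, p)) \<le> block_norm n i z"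
  unfolding block_norm_def using member_le_L2_set[of "{1..n i}" p "\<lambda>p. cmod (z (i, p))"] by simp

lemma block_norm_nonneg [simp]: "0 \<le> block_norm n i z"
  by (simp add: block_norm_def)

lemma cmod_le_1_of_\<Omega>:
  assumes "z \<in> \<Omega> s n \<theta>" "k \<in> idx s n" shows "cmod (z k) \<le> 1"
proof -
  obtain i p where k: "k = (i, p)" "i \<in> {1..s}" "p \<in> {1..n i}"
    using assms(2) unfolding idx_def by auto
  show ?thesis using cmod_le_block_norm[of p n i z] k assms(1) unfolding \<Omega>_def by fastforce
qed

lemma block_scale_in_\<Omega>:
  assumes "z \<in> \<Omega> s n \<theta>" "\<And>i. i \<in> {1..s} \<Longrightarrow> cmod (a i) \<le> 1"
  shows "block_scale a z \<in> \<Omega> s n \<theta>"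
proof -
  have "cmod (a i) * block_norm n i z \<le> 1 * 1" if "i \<in> {1..s}" for i
    using assms that unfolding \<Omega>_def by (intro mult_mono) auto
  then show ?thesis using assms block_scale_in_V unfolding \<Omega>_def by (auto simp: block_norm_scale)
qed

lemma tendsto_block_norm:
  assumes "\<And>p. p \<in> {1..n i} \<Longrightarrow> ((\<lambda>x. w x (i, p)) \<longlongrightarrow> z (i, p)) F"
  shows "((\<lambda>x. block_norm n i (w x)) \<longlongrightarrow> block_norm n i z) F"
  unfolding block_norm_def L2_set_def
  by (rule tendsto_real_sqrt, rule tendsto_sum, rule tendsto_power, rule tendsto_norm, rule assms)

definition disc_curve ::
  "nat \<Rightarrow> (nat \<Rightarrow> nat) \<Rightarrow> perms \<Rightarrow> (complex \<Rightarrow> nat \<times> nat \<Rightarrow> complex) \<Rightarrow> bool" where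
  "disc_curve s n \<theta> v \<longleftrightarrow> holomorphic_curve (idx s n) (ball 0 1) v \<and>
     (\<forall>\<zeta>\<in>ball 0 1. v \<zeta> \<in> \<Omega> s n \<theta>) \<and> v 0 = (\<lambda>_. 0)"

text \<open>
  The Schwarz lemma for the scalar function obtained by pairing block \<open>i\<close> of \<open>v\<close> with its value at \<open>\<zeta>\<close>.
\<close>

lemma disc_curve_Schwarz:
  assumes v: "disc_curve s n \<theta> v" and i: "i \<in> {1..s}" and \<zeta>: "cmod \<zeta> < 1"
  shows "block_norm n i (v \<zeta>) \<le> cmod \<zeta>"
proof -
  define u where "u p = v \<zeta> (i, p)" for p
  define b where "b = block_norm n i (v \<zeta>)"
  define h where "h \<xi> = (\<Sum>p\<in>{1..n i}. cnj (u p) * v \<xi> (i, p))" for \<xi>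
  have hol: "h holomorphic_on ball 0 1"
    using v i unfolding h_def disc_curve_def holomorphic_curve_def idx_def
    by (auto intro!: holomorphic_intros)
  have "h 0 = 0" using v by (simp add: h_def disc_curve_def)
  moreover have "cmod (h \<xi>) \<le> b" if "cmod \<xi> < 1" for \<xi>
  proof -
    have "cmod (h \<xi>) \<le> (\<Sum>p\<in>{1..n i}. \<bar>cmod (u p)\<bar> * \<bar>cmod (v \<xi> (i, p))\<bar>)"
      unfolding h_def by (rule order_trans[OF norm_sum]) (simp add: norm_mult)
    also have "\<dots> \<le> L2_set (\<lambda>p. cmod (u p)) {1..n i} * L2_set (\<lambda>p. cmod (v \<xi> (i, p))) {1..n i}"
      by (rule L2_set_mult_ineq)
    also have "\<dots> = b * block_norm n i (v \<xi>)"
      by (simp add: b_def block_norm_def u_def)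
    also have "\<dots> \<le> b * 1"
      using v that i unfolding disc_curve_def \<Omega>_def by (intro mult_left_mono) (auto simp: b_def)
    finally show ?thesis by simp
  qed
  ultimately have "cmod (h \<zeta>) \<le> b * cmod \<zeta> / 1" using \<zeta> hol by (intro Schwarz_ball) auto
  moreover have "h \<zeta> = of_real (b\<^sup>2)"
  proof -
    have "b\<^sup>2 = (\<Sum>p\<in>{1..n i}. (cmod (u p))\<^sup>2)"
      unfolding b_def block_norm_def L2_set_def u_def by (simp add: sum_nonneg)
    then show ?thesis unfolding h_def
      by (simp add: u_def mult.commute[of "cnj _"] complex_norm_square[symmetric])
  qed
  ultimately have "b * b \<le> b * cmod \<zeta>" by (simp add: power2_eq_square norm_mult)
  then show ?thesis unfolding b_def[symmetric]
    using mult_le_cancel_left_pos[of b b "cmod \<zeta>"] by (cases "b > 0") (auto simp: b_def not_less intro: order_trans)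
qed

lemma disc_curve_interior:
  assumes v: "disc_curve s n \<theta> v" and \<zeta>: "cmod \<zeta> < 1"
  shows "v \<zeta> \<in> \<Omega>_interior s n \<theta>"
proof -
  have "v \<zeta> \<in> \<Omega> s n \<theta>" using v \<zeta> unfolding disc_curve_def by simp
  then show ?thesis using disc_curve_Schwarz[OF v _ \<zeta>] \<zeta>
    unfolding \<Omega>_def \<Omega>_interior_def by fastforce
qed

lemma disc_curve_component:
  assumes perm: "permutation_set s n \<theta>" and v: "disc_curve s n \<theta> v"
  obtains C where "algebraic_component (idx s n) (V s n \<theta>) C" "\<And>\<zeta>. cmod \<zeta> < 1 \<Longrightarrow> v \<zeta> \<in> C"
proof -
  have "irreducible_set (idx s n) (v ` ball 0 1)"
    using v unfolding disc_curve_def by (intro irreducible_set_curve) auto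
  moreover have "v ` ball 0 1 \<subseteq> V s n \<theta>" using v unfolding disc_curve_def \<Omega>_def by auto
  ultimately obtain C where "algebraic_component (idx s n) (V s n \<theta>) C" "v ` ball 0 1 \<subseteq> C"
    using irreducible_set_in_component[OF _ _ algebraic_set_V[OF perm]] by blast
  then show ?thesis using that by (auto simp: subset_iff)
qed

lemma disc_curve_line:
  assumes z: "z \<in> \<Omega> s n \<theta>"
  shows "disc_curve s n \<theta> (\<lambda>\<zeta> k. \<zeta> * z k)"
proof -
  have "(\<lambda>k. \<zeta> * z k) = block_scale (\<lambda>_. \<zeta>) z" for \<zeta> by (simp add: block_scale_def)
  moreover have "z \<in> cspace (idx s n)" using z V_subset_cspace unfolding \<Omega>_def by blast
  ultimately show ?thesis using z block_scale_in_\<Omega>[OF z] block_scale_in_cspace[of z]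
    unfolding disc_curve_def holomorphic_curve_def
    by (auto intro!: holomorphic_intros)
qed

text \<open>
  The whole disc lies in one component, on which \<open>f\<close> is locally the restriction of a function
  holomorphic in the ambient space.
\<close>

lemma holomorphic_on_\<Omega>_compose_disc_curve:
  assumes perm: "permutation_set s n \<theta>" and f: "holomorphic_on_\<Omega> s n \<theta> f"
    and v: "disc_curve s n \<theta> v"
  shows "(\<lambda>\<zeta>. f (v \<zeta>)) holomorphic_on ball 0 1"
  unfolding holomorphic_on_def
proof
  let ?K = "idx s n"
  fix \<xi> :: complex assume \<xi>: "\<xi> \<in> ball 0 1"
  obtain C where C: "algebraic_component ?K (V s n \<theta>) C" "\<And>\<zeta>. cmod \<zeta> < 1 \<Longrightarrow> v \<zeta> \<in> C"
    using disc_curve_component[OF perm v] by blast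
  have vC: "v \<zeta> \<in> C \<inter> \<Omega>_interior s n \<theta>" if "\<zeta> \<in> ball 0 1" for \<zeta>
    using C(2) disc_curve_interior[OF v] that by simp
  have vcurve: "holomorphic_curve ?K (ball 0 1) v" using v by (simp add: disc_curve_def)
  have "holomorphic_on_subvariety ?K (C \<inter> \<Omega>_interior s n \<theta>) f"
    using f C(1) unfolding holomorphic_on_\<Omega>_def by blast
  from bspec[OF this[unfolded holomorphic_on_subvariety_def] vC[OF \<xi>]]
  obtain U F where U: "open U" "v \<xi> \<in> U"
    and F': "\<forall>w \<in> U \<inter> cspace ?K. complex_differentiable_at ?K F w"
    and eq': "\<forall>w \<in> U \<inter> (C \<inter> \<Omega>_interior s n \<theta>). f w = F w"
    by (elim exE conjE)
  note F = bspec[OF F'] and eq = bspec[OF eq']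
  have "continuous_on (ball 0 1) v"
  proof (rule continuous_on_coordinatewise_then_product)
    fix k show "continuous_on (ball 0 1) (\<lambda>\<zeta>. v \<zeta> k)"
    proof (cases "k \<in> ?K")
      case True
      then show ?thesis using vcurve unfolding holomorphic_curve_def
        by (simp add: holomorphic_on_imp_continuous_on)
    next
      case False
      then have "v \<zeta> k = 0" if "\<zeta> \<in> ball 0 1" for \<zeta>
        using vcurve that unfolding holomorphic_curve_def cspace_def by blast
      then show ?thesis
        by (intro continuous_on_eq[OF continuous_on_const[of _ 0]]) simp
    qed
  qed
  then have op: "open (ball 0 1 \<inter> v -` U)"
    using U(1) by (intro continuous_open_preimage) auto
  have "v \<xi> \<in> cspace ?K" using vcurve \<xi> unfolding holomorphic_curve_def by blast
  then have "(\<lambda>\<zeta>. F (v \<zeta>)) field_differentiable at \<xi>"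
    using U(2) by (intro complex_differentiable_compose_curve[OF finite_idx open_ball \<xi> vcurve] F) blast
  then obtain D where D: "((\<lambda>\<zeta>. F (v \<zeta>)) has_field_derivative D) (at \<xi>)"
    unfolding field_differentiable_def by blast
  have "((\<lambda>\<zeta>. f (v \<zeta>)) has_field_derivative D) (at \<xi>)"
  proof (rule has_field_derivative_transform_within_open[OF D op])
    show "\<xi> \<in> ball 0 1 \<inter> v -` U" using \<xi> U by simp
    show "F (v \<zeta>) = f (v \<zeta>)" if "\<zeta> \<in> ball 0 1 \<inter> v -` U" for \<zeta>
      using eq[of "v \<zeta>"] vC[of \<zeta>] that by simp
  qed
  then show "(\<lambda>\<zeta>. f (v \<zeta>)) field_differentiable at \<xi> within ball 0 1"
    unfolding field_differentiable_def using has_field_derivative_at_within by blast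
qed

section \<open>The derivative at the origin\<close>

text \<open>
  Strict differentiability at the origin, relative to \<open>C\<close>: the estimate is for differences, as needed to
  compare \<open>f\<close> along two curves that are tangent to high order. The coefficients \<open>c\<close> matter only through
  the values of the linear form on \<open>C\<close>.
\<close>

definition strict_derivative_on ::
  "'k set \<Rightarrow> ('k \<Rightarrow> complex) set \<Rightarrow> (('k \<Rightarrow> complex) \<Rightarrow> complex) \<Rightarrow> ('k \<Rightarrow> complex) \<Rightarrow> bool" where
  "strict_derivative_on K C f c \<longleftrightarrow> (\<forall>\<epsilon>>0. \<exists>r>0. \<forall>w\<in>C. \<forall>w'\<in>C. cnorm K w < r \<longrightarrow> cnorm K w' < r \<longrightarrow>
     cmod (f w - f w' - (\<Sum>k\<in>K. c k * (w k - w' k))) \<le> \<epsilon> * cnorm K (\<lambda>k. w k - w' k))"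

lemma strict_derivative_on_sum:
  assumes "finite L" "\<And>l. l \<in> L \<Longrightarrow> strict_derivative_on K C (f l) (c l)"
  shows "strict_derivative_on K C (\<lambda>z. \<Sum>l\<in>L. a l * f l z) (\<lambda>k. \<Sum>l\<in>L. a l * c l k)"
  unfolding strict_derivative_on_def
proof (intro allI impI)
  fix \<epsilon> :: real assume \<epsilon>: "\<epsilon> > 0"
  define B where "B = 1 + (\<Sum>l\<in>L. cmod (a l))"
  have B: "B > 0" unfolding B_def by (simp add: add_pos_nonneg sum_nonneg)
  have "\<forall>l\<in>L. \<exists>r>0. \<forall>w\<in>C. \<forall>w'\<in>C. cnorm K w < r \<longrightarrow> cnorm K w' < r \<longrightarrow>
     cmod (f l w - f l w' - (\<Sum>k\<in>K. c l k * (w k - w' k))) \<le> \<epsilon> / B * cnorm K (\<lambda>k. w k - w' k)"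
  proof
    fix l assume "l \<in> L"
    have "\<epsilon> / B > 0" using \<epsilon> B by simp
    then show "\<exists>r>0. \<forall>w\<in>C. \<forall>w'\<in>C. cnorm K w < r \<longrightarrow> cnorm K w' < r \<longrightarrow>
     cmod (f l w - f l w' - (\<Sum>k\<in>K. c l k * (w k - w' k))) \<le> \<epsilon> / B * cnorm K (\<lambda>k. w k - w' k)"
      using assms(2)[OF \<open>l \<in> L\<close>] unfolding strict_derivative_on_def by blast
  qed
  from bchoice[OF this] obtain r where r': "\<forall>l\<in>L. r l > 0 \<and> (\<forall>w\<in>C. \<forall>w'\<in>C. cnorm K w < r l \<longrightarrow> cnorm K w' < r l \<longrightarrow>
     cmod (f l w - f l w' - (\<Sum>k\<in>K. c l k * (w k - w' k))) \<le> \<epsilon> / B * cnorm K (\<lambda>k. w k - w' k))"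
    by (elim exE)
  then have r: "r l > 0" "\<And>w w'. w \<in> C \<Longrightarrow> w' \<in> C \<Longrightarrow> cnorm K w < r l \<Longrightarrow> cnorm K w' < r l \<Longrightarrow>
     cmod (f l w - f l w' - (\<Sum>k\<in>K. c l k * (w k - w' k))) \<le> \<epsilon> / B * cnorm K (\<lambda>k. w k - w' k)"
    if "l \<in> L" for l
    using that by simp_all
  define \<rho> where "\<rho> = Min (insert 1 (r ` L))"
  have \<rho>: "\<rho> > 0" "\<And>l. l \<in> L \<Longrightarrow> \<rho> \<le> r l" unfolding \<rho>_def using assms(1) r(1) by auto
  have "cmod ((\<Sum>l\<in>L. a l * f l w) - (\<Sum>l\<in>L. a l * f l w') -
      (\<Sum>k\<in>K. (\<Sum>l\<in>L. a l * c l k) * (w k - w' k))) \<le> \<epsilon> * cnorm K (\<lambda>k. w k - w' k)"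
    if w: "w \<in> C" "w' \<in> C" "cnorm K w < \<rho>" "cnorm K w' < \<rho>" for w w'
  proof -
    let ?d = "cnorm K (\<lambda>k. w k - w' k)"
    have "(\<Sum>k\<in>K. (\<Sum>l\<in>L. a l * c l k) * (w k - w' k)) = (\<Sum>l\<in>L. a l * (\<Sum>k\<in>K. c l k * (w k - w' k)))"
      unfolding sum_distrib_right sum_distrib_left by (subst sum.swap) (simp add: mult.assoc)
    then have "(\<Sum>l\<in>L. a l * f l w) - (\<Sum>l\<in>L. a l * f l w') -
      (\<Sum>k\<in>K. (\<Sum>l\<in>L. a l * c l k) * (w k - w' k))
      = (\<Sum>l\<in>L. a l * (f l w - f l w' - (\<Sum>k\<in>K. c l k * (w k - w' k))))"
      by (simp add: right_diff_distrib sum_subtractf)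
    also have "cmod \<dots> \<le> (\<Sum>l\<in>L. cmod (a l) * (\<epsilon> / B * ?d))"
    proof (rule order_trans[OF norm_sum], rule sum_mono)
      fix l assume l: "l \<in> L"
      show "cmod (a l * (f l w - f l w' - (\<Sum>k\<in>K. c l k * (w k - w' k)))) \<le> cmod (a l) * (\<epsilon> / B * ?d)"
        unfolding norm_mult using r(2)[OF l w(1,2)] \<rho>(2)[OF l] w(3,4) by (intro mult_left_mono) auto
    qed
    also have "\<dots> = (B - 1) * (\<epsilon> / B * ?d)"
      unfolding sum_distrib_right[symmetric] by (simp add: B_def)
    also have "\<dots> \<le> B * (\<epsilon> / B * ?d)" using B \<epsilon> by (intro mult_right_mono) auto
    also have "\<dots> = \<epsilon> * ?d" using B by simp
    finally show ?thesis .
  qed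
  then show "\<exists>r>0. \<forall>w\<in>C. \<forall>w'\<in>C. cnorm K w < r \<longrightarrow> cnorm K w' < r \<longrightarrow>
     cmod ((\<Sum>l\<in>L. a l * f l w) - (\<Sum>l\<in>L. a l * f l w') -
      (\<Sum>k\<in>K. (\<Sum>l\<in>L. a l * c l k) * (w k - w' k))) \<le> \<epsilon> * cnorm K (\<lambda>k. w k - w' k)"
    using \<rho>(1) by blast
qed

text \<open>
  With \<open>v' = 0\<close> and \<open>q = 1\<close> this is the chain rule at the origin. For larger \<open>q\<close> it says that \<open>f\<close>
  acts on the leading term of the difference of two curves through its linear part.
\<close>

lemma strict_derivative_on_tendsto:
  assumes sd: "strict_derivative_on K C f c"
    and ev: "\<forall>\<^sub>F \<zeta> in at 0. v \<zeta> \<in> C" "\<forall>\<^sub>F \<zeta> in at 0. v' \<zeta> \<in> C"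
    and v: "\<And>k. k \<in> K \<Longrightarrow> ((\<lambda>\<zeta>. v \<zeta> k) \<longlongrightarrow> 0) (at 0)"
    and v': "\<And>k. k \<in> K \<Longrightarrow> ((\<lambda>\<zeta>. v' \<zeta> k) \<longlongrightarrow> 0) (at 0)"
    and P: "\<And>k. k \<in> K \<Longrightarrow> ((\<lambda>\<zeta>. (v \<zeta> k - v' \<zeta> k) / \<zeta> ^ q) \<longlongrightarrow> P k) (at (0::complex))"
  shows "((\<lambda>\<zeta>. (f (v \<zeta>) - f (v' \<zeta>)) / \<zeta> ^ q) \<longlongrightarrow> (\<Sum>k\<in>K. c k * P k)) (at 0)"
proof (rule tendsto_quotient_little_o[OF _ P])
  fix \<epsilon> :: real assume "\<epsilon> > 0"
  then obtain r where r: "r > 0" "\<forall>w\<in>C. \<forall>w'\<in>C. cnorm K w < r \<longrightarrow> cnorm K w' < r \<longrightarrow>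
     cmod (f w - f w' - (\<Sum>k\<in>K. c k * (w k - w' k))) \<le> \<epsilon> * cnorm K (\<lambda>k. w k - w' k)"
    using sd unfolding strict_derivative_on_def by blast
  have small: "((\<lambda>\<zeta>. cnorm K (v \<zeta>)) \<longlongrightarrow> 0) (at 0)" "((\<lambda>\<zeta>. cnorm K (v' \<zeta>)) \<longlongrightarrow> 0) (at 0)"
    using tendsto_cnorm[of K v "\<lambda>_. 0", OF v] tendsto_cnorm[of K v' "\<lambda>_. 0", OF v'] by simp_all
  show "\<forall>\<^sub>F \<zeta> in at 0. cmod (f (v \<zeta>) - f (v' \<zeta>) - (\<Sum>k\<in>K. c k * (v \<zeta> k - v' \<zeta> k)))
      \<le> \<epsilon> * cnorm K (\<lambda>k. v \<zeta> k - v' \<zeta> k)"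
    using order_tendstoD(2)[OF small(1) r(1)] order_tendstoD(2)[OF small(2) r(1)] ev
    by eventually_elim (use r(2) in blast)
qed

lemma zero_in_component:
  assumes perm: "permutation_set s n \<theta>" and C: "algebraic_component (idx s n) (V s n \<theta>) C"
  shows "(\<lambda>_. 0) \<in> C"
proof -
  obtain z where "z \<in> C"
    using C unfolding algebraic_component_def irreducible_algebraic_set_def by blast
  from component_scale_closed[OF perm C this, of "\<lambda>_. 0"] show ?thesis by (simp add: block_scale_def)
qed

lemma component_strict_derivative:
  assumes perm: "permutation_set s n \<theta>" and f: "holomorphic_on_\<Omega> s n \<theta> f"
    and C: "algebraic_component (idx s n) (V s n \<theta>) C"
  shows "\<exists>c. strict_derivative_on (idx s n) C f c"
proof -
  let ?K = "idx s n"
  have CV: "C \<subseteq> V s n \<theta>" using C unfolding algebraic_component_def by blast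
  have Ccs: "w \<in> cspace ?K" if "w \<in> C" for w using CV V_subset_cspace that by blast
  have small: "w \<in> C \<inter> \<Omega>_interior s n \<theta>" if "w \<in> C" "cnorm ?K w < 1" for w
  proof -
    have "block_norm n i w < 1" if "i \<in> {1..s}" for i
      using block_norm_le_cnorm[OF that, of n w] \<open>cnorm ?K w < 1\<close> by linarith
    then show ?thesis using that CV unfolding \<Omega>_interior_def by blast
  qed
  have 0: "(\<lambda>_. 0) \<in> C \<inter> \<Omega>_interior s n \<theta>"
    using small[OF zero_in_component[OF perm C]] by simp
  have "holomorphic_on_subvariety ?K (C \<inter> \<Omega>_interior s n \<theta>) f"
    using f C unfolding holomorphic_on_\<Omega>_def by blast
  from bspec[OF this[unfolded holomorphic_on_subvariety_def] 0]
  obtain U F where U: "open U" "(\<lambda>_. 0) \<in> U"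
    and F': "\<forall>w \<in> U \<inter> cspace ?K. complex_differentiable_at ?K F w"
    and eq': "\<forall>w \<in> U \<inter> (C \<inter> \<Omega>_interior s n \<theta>). f w = F w"
    by (elim exE conjE)
  note F = bspec[OF F'] and eq = bspec[OF eq']
  obtain R where R: "R > 0" "\<And>w. w \<in> cspace ?K \<Longrightarrow> cnorm ?K w < R \<Longrightarrow> w \<in> U"
    using cspace_neighbourhood[OF finite_idx U zero_in_cspace] by auto
  obtain c where c: "\<And>\<epsilon>. \<epsilon> > 0 \<Longrightarrow> \<exists>r>0. \<forall>w\<in>cspace ?K. \<forall>w'\<in>cspace ?K. cnorm ?K w < r \<longrightarrow> cnorm ?K w' < r \<longrightarrow>
     cmod (F w - F w' - (\<Sum>k\<in>?K. c k * (w k - w' k))) \<le> \<epsilon> * cnorm ?K (\<lambda>k. w k - w' k)"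
    using strict_derivative_at_0[OF finite_idx U F] by blast
  have "strict_derivative_on ?K C f c"
    unfolding strict_derivative_on_def
  proof (intro allI impI)
    fix \<epsilon> :: real assume "\<epsilon> > 0"
    then obtain r where r: "r > 0" "\<And>w w'. w \<in> cspace ?K \<Longrightarrow> w'\<in>cspace ?K \<Longrightarrow> cnorm ?K w < r \<Longrightarrow> cnorm ?K w' < r \<Longrightarrow>
     cmod (F w - F w' - (\<Sum>k\<in>?K. c k * (w k - w' k))) \<le> \<epsilon> * cnorm ?K (\<lambda>k. w k - w' k)"
      using c by blast
    have fF: "f w = F w" if "w \<in> C" "cnorm ?K w < min r (min R 1)" for w
      using that small Ccs by (intro eq) (auto intro: R(2))
    show "\<exists>r>0. \<forall>w\<in>C. \<forall>w'\<in>C. cnorm ?K w < r \<longrightarrow> cnorm ?K w' < r \<longrightarrow>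
     cmod (f w - f w' - (\<Sum>k\<in>?K. c k * (w k - w' k))) \<le> \<epsilon> * cnorm ?K (\<lambda>k. w k - w' k)"
      by (rule exI[of _ "min r (min R 1)"]) (use r R(1) fF Ccs in auto)
  qed
  then show ?thesis by blast
qed

lemma strict_derivative_on_line:
  assumes perm: "permutation_set s n \<theta>" and C: "algebraic_component (idx s n) (V s n \<theta>) C"
    and sd: "strict_derivative_on (idx s n) C f c" and f0: "f (\<lambda>_. 0) = 0" and z: "z \<in> C"
  shows "((\<lambda>\<zeta>. f (\<lambda>k. \<zeta> * z k) / \<zeta>) \<longlongrightarrow> (\<Sum>k\<in>idx s n. c k * z k)) (at 0)"
proof -
  have "((\<lambda>\<zeta>. (f (\<lambda>k. \<zeta> * z k) - f (\<lambda>_. 0)) / \<zeta> ^ 1) \<longlongrightarrow> (\<Sum>k\<in>idx s n. c k * z k)) (at 0)"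
  proof (rule strict_derivative_on_tendsto[OF sd])
    have "(\<lambda>k. \<zeta> * z k) \<in> C" for \<zeta>
      using component_scale_closed[OF perm C z, of "\<lambda>_. \<zeta>"] by (simp add: block_scale_def)
    then show "\<forall>\<^sub>F \<zeta> in at 0. (\<lambda>k. \<zeta> * z k) \<in> C" by simp
    show "\<forall>\<^sub>F \<zeta> in at (0::complex). (\<lambda>_. 0) \<in> C" using zero_in_component[OF perm C] by simp
    show "((\<lambda>\<zeta>. \<zeta> * z k) \<longlongrightarrow> 0) (at 0)" for k by (auto intro!: tendsto_eq_intros)
    show "((\<lambda>\<zeta>. (\<zeta> * z k - 0) / \<zeta> ^ 1) \<longlongrightarrow> z k) (at 0)" for k
      by (rule tendsto_eventually) (simp add: eventually_at_filter)
  qed auto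
  then show ?thesis by (simp add: f0)
qed

definition block_subspace :: "nat \<Rightarrow> (nat \<Rightarrow> nat) \<Rightarrow> nat \<Rightarrow> (nat \<times> nat \<Rightarrow> complex) set" where
  "block_subspace s n i = {z \<in> cspace (idx s n). \<forall>k. fst k \<noteq> i \<longrightarrow> z k = 0}"

text \<open>
  On the \<open>i\<close>-th block, both sides of every defining equation vanish, since they are products of
  coordinates from two different blocks.
\<close>

lemma block_in_component:
  assumes perm: "permutation_set s n \<theta>"
  obtains C where "algebraic_component (idx s n) (V s n \<theta>) C"
    "block_subspace s n i \<subseteq> C"
proof -
  let ?S = "block_subspace s n i"
  have "irreducible_set (idx s n) ?S"
    by (rule irreducible_set_if_complex_lines) (auto simp: block_subspace_def cspace_def)
  moreover have "?S \<subseteq> V s n \<theta>"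
  proof
    fix z assume "z \<in> ?S"
    then have z: "z \<in> {z \<in> cspace (idx s n). \<forall>k. fst k \<noteq> i \<longrightarrow> z k = 0}"
      unfolding block_subspace_def .
    have "z (a, p) * z (b, q) = z (a, p') * z (b, q')" if "a < b" for a b p q p' q'
    proof (cases "a = i")
      case True
      then have "z (b, x) = 0" for x using z that by simp
      then show ?thesis by simp
    next
      case False
      then have "z (a, x) = 0" for x using z by simp
      then show ?thesis by simp
    qed
    then show "z \<in> V s n \<theta>" using z unfolding V_def by blast
  qed
  ultimately show ?thesis
    using irreducible_set_in_component[OF _ _ algebraic_set_V[OF perm]] that by blast
qed

lemma block_subspace_subset_V:
  assumes "permutation_set s n \<theta>" shows "block_subspace s n i \<subseteq> V s n \<theta>"
proof -
  obtain C where "algebraic_component (idx s n) (V s n \<theta>) C" "block_subspace s n i \<subseteq> C"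
    using block_in_component[OF assms, of i] by blast
  then show ?thesis unfolding algebraic_component_def by blast
qed

lemma sum_idx: "(\<Sum>k\<in>idx s n. f k) = (\<Sum>i\<in>{1..s}. \<Sum>p\<in>{1..n i}. f (i, p))"
  unfolding idx_def by (simp add: sum.Sigma)

text \<open>
  On the component containing block \<open>i\<close>, the values of the linear form on that block are determined by
  \<open>f\<close>. For a point \<open>z\<close> of an arbitrary component \<open>C\<close>, the projections of \<open>z\<close> to the blocks lie in \<open>C\<close> as
  well, so every linear form that works on \<open>C\<close> has the value at \<open>z\<close> that is prescribed by the blocks.
\<close>

lemma common_strict_derivative:
  assumes perm: "permutation_set s n \<theta>" and f: "holomorphic_on_\<Omega> s n \<theta> f" and f0: "f (\<lambda>_. 0) = 0"
  obtains c where "\<And>C. algebraic_component (idx s n) (V s n \<theta>) C \<Longrightarrow> strict_derivative_on (idx s n) C f c"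
proof -
  let ?K = "idx s n" and ?comp = "algebraic_component (idx s n) (V s n \<theta>)"
  let ?S = "block_subspace s n"
  have "\<forall>i. \<exists>C c. ?comp C \<and> ?S i \<subseteq> C \<and> strict_derivative_on ?K C f c"
  proof
    fix i
    obtain C where "?comp C" "?S i \<subseteq> C" using block_in_component[OF perm] by blast
    then show "\<exists>C c. ?comp C \<and> ?S i \<subseteq> C \<and> strict_derivative_on ?K C f c"
      using component_strict_derivative[OF perm f] by blast
  qed
  from choice[OF this] obtain B
    where "\<forall>i. \<exists>c. ?comp (B i) \<and> ?S i \<subseteq> B i \<and> strict_derivative_on ?K (B i) f c" by (elim exE)
  from choice[OF this] obtain b
    where "\<forall>i. ?comp (B i) \<and> ?S i \<subseteq> B i \<and> strict_derivative_on ?K (B i) f (b i)" by (elim exE)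
  then have B: "?comp (B i)" "?S i \<subseteq> B i" "strict_derivative_on ?K (B i) f (b i)" for i
    by simp_all
  define c where "c k = b (fst k) k" for k
  have "strict_derivative_on ?K C f c" if C: "?comp C" for C
  proof -
    obtain a where a: "strict_derivative_on ?K C f a"
      using component_strict_derivative[OF perm f C] by blast
    have eq: "(\<Sum>k\<in>?K. a k * z k) = (\<Sum>k\<in>?K. c k * z k)" if z: "z \<in> C" for z
    proof -
      have blk: "(\<Sum>p\<in>{1..n i}. a (i, p) * z (i, p)) = (\<Sum>p\<in>{1..n i}. c (i, p) * z (i, p))"
        if i: "i \<in> {1..s}" for i
      proof -
        define y where "y = block_scale (\<lambda>j. if j = i then 1 else 0) z"
        have yC: "y \<in> C" unfolding y_def by (rule component_scale_closed[OF perm C z])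
        have "y \<in> ?S i" using yC C V_subset_cspace unfolding algebraic_component_def block_subspace_def
          by (auto simp: y_def block_scale_def)
        then have yB: "y \<in> B i" using B(2) by blast
        have "(\<Sum>k\<in>?K. a k * y k) = (\<Sum>k\<in>?K. b i k * y k)"
          by (rule LIM_unique[OF strict_derivative_on_line[OF perm C a f0 yC]
                strict_derivative_on_line[OF perm B(1) B(3) f0 yB]])
        moreover have "(\<Sum>k\<in>?K. g k * y k) = (\<Sum>p\<in>{1..n i}. g (i, p) * z (i, p))" for g
        proof -
          have "(\<Sum>k\<in>?K. g k * y k) = (\<Sum>j\<in>{1..s}. if j = i then \<Sum>p\<in>{1..n j}. g (j, p) * z (j, p) else 0)"
            unfolding sum_idx by (rule sum.cong) (auto simp: y_def block_scale_def)
          then show ?thesis using i by simp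
        qed
        ultimately show ?thesis by (simp add: c_def)
      qed
      show ?thesis unfolding sum_idx by (rule sum.cong[OF HOL.refl blk])
    qed
    have "(\<Sum>k\<in>?K. a k * (w k - w' k)) = (\<Sum>k\<in>?K. c k * (w k - w' k))" if "w \<in> C" "w' \<in> C" for w w'
      using eq[OF that(1)] eq[OF that(2)] by (simp add: right_diff_distrib sum_subtractf)
    then show ?thesis using a unfolding strict_derivative_on_def by auto
  qed
  then show ?thesis using that by blast
qed

section \<open>Holomorphic maps fixing the origin\<close>

definition apply_matrix ::
  "'l set \<Rightarrow> 'k set \<Rightarrow> ('l \<Rightarrow> 'k \<Rightarrow> complex) \<Rightarrow> ('k \<Rightarrow> complex) \<Rightarrow> 'l \<Rightarrow> complex" where
  "apply_matrix L K X z = (\<lambda>l. if l \<in> L then \<Sum>k\<in>K. X l k * z k else 0)"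

lemma apply_matrix_in_cspace [simp]: "apply_matrix L K X z \<in> cspace L"
  by (simp add: apply_matrix_def cspace_def)

lemma apply_matrix_mult: "apply_matrix L K X (\<lambda>k. \<zeta> * z k) = (\<lambda>l. \<zeta> * apply_matrix L K X z l)"
  by (auto simp: apply_matrix_def sum_distrib_left mult.left_commute)

definition unit_vector :: "'k \<Rightarrow> 'k \<Rightarrow> complex" where
  "unit_vector k = (\<lambda>j. if j = k then 1 else 0)"

lemma unit_vector_in_block_subspace:
  "k \<in> idx s n \<Longrightarrow> unit_vector k \<in> block_subspace s n (fst k)"
  by (auto simp: block_subspace_def unit_vector_def cspace_def)

lemma apply_matrix_unit_vector:
  assumes "finite K" "k \<in> K" "l \<in> L" shows "apply_matrix L K X (unit_vector k) l = X l k"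
proof -
  have "(\<Sum>j\<in>K. X l j * unit_vector k j) = (\<Sum>j\<in>K. if j = k then X l j else 0)"
    by (rule sum.cong) (auto simp: unit_vector_def)
  then show ?thesis using assms by (simp add: apply_matrix_def)
qed

definition pointed_holomorphic_map ::
  "nat \<Rightarrow> (nat \<Rightarrow> nat) \<Rightarrow> perms \<Rightarrow> nat \<Rightarrow> (nat \<Rightarrow> nat) \<Rightarrow> perms \<Rightarrow>
     ((nat \<times> nat \<Rightarrow> complex) \<Rightarrow> (nat \<times> nat \<Rightarrow> complex)) \<Rightarrow> bool" where
  "pointed_holomorphic_map s n \<theta> t m \<tau> g \<longleftrightarrow> (\<forall>z \<in> \<Omega> s n \<theta>. g z \<in> \<Omega> t m \<tau>) \<and>
     (\<forall>l \<in> idx t m. holomorphic_on_\<Omega> s n \<theta> (\<lambda>z. g z l)) \<and> g (\<lambda>_. 0) = (\<lambda>_. 0)"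

definition derivative_matrix ::
  "nat \<Rightarrow> (nat \<Rightarrow> nat) \<Rightarrow> perms \<Rightarrow> nat \<Rightarrow> (nat \<Rightarrow> nat) \<Rightarrow>
     ((nat \<times> nat \<Rightarrow> complex) \<Rightarrow> (nat \<times> nat \<Rightarrow> complex)) \<Rightarrow> (nat \<times> nat \<Rightarrow> nat \<times> nat \<Rightarrow> complex) \<Rightarrow> bool" where
  "derivative_matrix s n \<theta> t m g X \<longleftrightarrow> (\<forall>l \<in> idx t m. \<forall>C.
     algebraic_component (idx s n) (V s n \<theta>) C \<longrightarrow> strict_derivative_on (idx s n) C (\<lambda>z. g z l) (X l))"

lemma \<Omega>_subset_cspace: "z \<in> \<Omega> s n \<theta> \<Longrightarrow> z \<in> cspace (idx s n)"
  unfolding \<Omega>_def by (blast intro: V_subset_cspace)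

lemma disc_curve_compose:
  assumes perm: "permutation_set s n \<theta>" and g: "pointed_holomorphic_map s n \<theta> t m \<tau> g"
    and v: "disc_curve s n \<theta> v"
  shows "disc_curve t m \<tau> (\<lambda>\<zeta>. g (v \<zeta>))"
  unfolding disc_curve_def holomorphic_curve_def
proof (intro conjI ballI)
  fix \<zeta> :: complex assume "\<zeta> \<in> ball 0 1"
  then show "g (v \<zeta>) \<in> \<Omega> t m \<tau>"
    using v g unfolding disc_curve_def pointed_holomorphic_map_def by blast
  then show "g (v \<zeta>) \<in> cspace (idx t m)" by (rule \<Omega>_subset_cspace)
next
  fix l assume "l \<in> idx t m"
  then have "holomorphic_on_\<Omega> s n \<theta> (\<lambda>z. g z l)" using g unfolding pointed_holomorphic_map_def by blast
  from holomorphic_on_\<Omega>_compose_disc_curve[OF perm this v]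
  show "(\<lambda>\<zeta>. g (v \<zeta>) l) holomorphic_on ball 0 1" .
next
  show "g (v 0) = (\<lambda>_. 0)" using v g unfolding disc_curve_def pointed_holomorphic_map_def by simp
qed

lemma derivative_matrix_exists:
  assumes perm: "permutation_set s n \<theta>" and g: "pointed_holomorphic_map s n \<theta> t m \<tau> g"
  obtains X where "derivative_matrix s n \<theta> t m g X"
proof -
  have "\<forall>l\<in>idx t m. \<exists>c. \<forall>C. algebraic_component (idx s n) (V s n \<theta>) C \<longrightarrow>
      strict_derivative_on (idx s n) C (\<lambda>z. g z l) c"
  proof
    fix l assume l: "l \<in> idx t m"
    have hol: "holomorphic_on_\<Omega> s n \<theta> (\<lambda>z. g z l)" and 0: "g (\<lambda>_. 0) l = 0"
      using g l unfolding pointed_holomorphic_map_def by simp_all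
    show "\<exists>c. \<forall>C. algebraic_component (idx s n) (V s n \<theta>) C \<longrightarrow>
      strict_derivative_on (idx s n) C (\<lambda>z. g z l) c"
      by (rule common_strict_derivative[OF perm hol 0]) blast
  qed
  from bchoice[OF this] show ?thesis unfolding derivative_matrix_def[symmetric]
    by (elim exE) (rule that)
qed

lemma disc_curve_tendsto_0:
  assumes v: "disc_curve s n \<theta> v" and k: "k \<in> idx s n"
  shows "((\<lambda>\<zeta>. v \<zeta> k) \<longlongrightarrow> 0) (at 0)"
proof -
  have "continuous_on (ball 0 1) (\<lambda>\<zeta>. v \<zeta> k)"
    using v k unfolding disc_curve_def holomorphic_curve_def
    by (simp add: holomorphic_on_imp_continuous_on)
  then have "isCont (\<lambda>\<zeta>. v \<zeta> k) 0"
    using continuous_on_eq_continuous_at[OF open_ball] by (metis centre_in_ball zero_less_one)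
  then show ?thesis using v by (simp add: isCont_def disc_curve_def)
qed

lemma eventually_at_0_disc: "\<forall>\<^sub>F \<zeta> in at (0::complex). cmod \<zeta> < 1 \<and> \<zeta> \<noteq> 0"
  using eventually_at_in_open[of "ball 0 1" "0::complex"] by simp

lemma derivative_along_disc_curve:
  assumes perm: "permutation_set s n \<theta>" and g: "pointed_holomorphic_map s n \<theta> t m \<tau> g"
    and X: "derivative_matrix s n \<theta> t m g X" and v: "disc_curve s n \<theta> v"
    and lim: "\<And>k. k \<in> idx s n \<Longrightarrow> ((\<lambda>\<zeta>. v \<zeta> k / \<zeta>) \<longlongrightarrow> z k) (at 0)"
    and l: "l \<in> idx t m"
  shows "((\<lambda>\<zeta>. g (v \<zeta>) l / \<zeta>) \<longlongrightarrow> apply_matrix (idx t m) (idx s n) X z l) (at 0)"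
proof -
  obtain C where C: "algebraic_component (idx s n) (V s n \<theta>) C" "\<And>\<zeta>. cmod \<zeta> < 1 \<Longrightarrow> v \<zeta> \<in> C"
    using disc_curve_component[OF perm v] by blast
  have sd: "strict_derivative_on (idx s n) C (\<lambda>z. g z l) (X l)"
    using X l C(1) unfolding derivative_matrix_def by blast
  have "((\<lambda>\<zeta>. (g (v \<zeta>) l - g (\<lambda>_. 0) l) / \<zeta> ^ 1) \<longlongrightarrow> (\<Sum>k\<in>idx s n. X l k * z k)) (at 0)"
  proof (rule strict_derivative_on_tendsto[OF sd])
    show "\<forall>\<^sub>F \<zeta> in at 0. v \<zeta> \<in> C"
      using eventually_at_0_disc by eventually_elim (simp add: C(2))
    show "\<forall>\<^sub>F \<zeta> in at (0::complex). (\<lambda>_. 0) \<in> C" using zero_in_component[OF perm C(1)] by simp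
    show "((\<lambda>\<zeta>. v \<zeta> k) \<longlongrightarrow> 0) (at 0)" if "k \<in> idx s n" for k
      by (rule disc_curve_tendsto_0[OF v that])
    show "((\<lambda>\<zeta>. (v \<zeta> k - 0) / \<zeta> ^ 1) \<longlongrightarrow> z k) (at 0)" if "k \<in> idx s n" for k
      using lim[OF that] by simp
  qed auto
  then show ?thesis using g l by (simp add: apply_matrix_def pointed_holomorphic_map_def)
qed

lemma derivative_along_line:
  assumes perm: "permutation_set s n \<theta>" and g: "pointed_holomorphic_map s n \<theta> t m \<tau> g"
    and X: "derivative_matrix s n \<theta> t m g X" and z: "z \<in> \<Omega> s n \<theta>" and l: "l \<in> idx t m"
  shows "((\<lambda>\<zeta>. g (\<lambda>k. \<zeta> * z k) l / \<zeta>) \<longlongrightarrow> apply_matrix (idx t m) (idx s n) X z l) (at 0)"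
proof (rule derivative_along_disc_curve[OF perm g X disc_curve_line[OF z] _ l])
  show "((\<lambda>\<zeta>. \<zeta> * z k / \<zeta>) \<longlongrightarrow> z k) (at 0)" for k
    by (rule tendsto_eventually) (simp add: eventually_at_filter)
qed

text \<open>
  The image is the limit of \<open>g (\<zeta> z) / \<zeta>\<close>, which lies in the cone \<open>V\<close> and has block norms at most \<open>1\<close>
  by the Schwarz lemma.
\<close>

lemma derivative_maps_\<Omega>:
  assumes perm: "permutation_set s n \<theta>" and perm': "permutation_set t m \<tau>"
    and g: "pointed_holomorphic_map s n \<theta> t m \<tau> g"
    and X: "derivative_matrix s n \<theta> t m g X" and z: "z \<in> \<Omega> s n \<theta>"
  shows "apply_matrix (idx t m) (idx s n) X z \<in> \<Omega> t m \<tau>"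
proof -
  let ?y = "apply_matrix (idx t m) (idx s n) X z"
  define v where "v \<zeta> = g (\<lambda>k. \<zeta> * z k)" for \<zeta>
  have v: "disc_curve t m \<tau> v"
    unfolding v_def by (rule disc_curve_compose[OF perm g disc_curve_line[OF z]])
  have lim: "((\<lambda>\<zeta>. v \<zeta> l / \<zeta>) \<longlongrightarrow> ?y l) (at 0)" if "l \<in> idx t m" for l
    unfolding v_def by (rule derivative_along_line[OF perm g X z that])
  have scale: "(\<lambda>k. v \<zeta> k / \<zeta>) = block_scale (\<lambda>_. 1 / \<zeta>) (v \<zeta>)" for \<zeta>
    by (simp add: block_scale_def)
  have "?y \<in> V t m \<tau>"
  proof (rule algebraic_set_limit[OF algebraic_set_V[OF perm'] lim])
    show "\<forall>\<^sub>F \<zeta> in at 0. (\<lambda>k. v \<zeta> k / \<zeta>) \<in> V t m \<tau>"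
      using eventually_at_0_disc
    proof eventually_elim
      case (elim \<zeta>)
      then have "v \<zeta> \<in> V t m \<tau>" using v unfolding disc_curve_def \<Omega>_def by simp
      then show ?case unfolding scale by (rule block_scale_in_V)
    qed
  qed auto
  moreover have "block_norm m j ?y \<le> 1" if j: "j \<in> {1..t}" for j
  proof (rule tendsto_upperbound)
    show "((\<lambda>\<zeta>. block_norm m j (\<lambda>k. v \<zeta> k / \<zeta>)) \<longlongrightarrow> block_norm m j ?y) (at 0)"
      by (rule tendsto_block_norm, rule lim) (use j in \<open>simp add: idx_def\<close>)
    show "\<forall>\<^sub>F \<zeta> in at 0. block_norm m j (\<lambda>k. v \<zeta> k / \<zeta>) \<le> 1"
      using eventually_at_0_disc
    proof eventually_elim
      case (elim \<zeta>)
      then show ?case using disc_curve_Schwarz[OF v j, of \<zeta>]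
        unfolding scale block_norm_scale by (simp add: norm_divide field_simps)
    qed
  qed simp
  ultimately show ?thesis unfolding \<Omega>_def by blast
qed

lemma derivative_left_inverse:
  assumes perm: "permutation_set s n \<theta>" and perm': "permutation_set t m \<tau>"
    and g: "pointed_holomorphic_map s n \<theta> t m \<tau> g" and h: "pointed_holomorphic_map t m \<tau> s n \<theta> h"
    and X: "derivative_matrix s n \<theta> t m g X" and Y: "derivative_matrix t m \<tau> s n h Y"
    and inv: "\<And>z. z \<in> \<Omega> s n \<theta> \<Longrightarrow> h (g z) = z" and z: "z \<in> \<Omega> s n \<theta>"
  shows "apply_matrix (idx s n) (idx t m) Y (apply_matrix (idx t m) (idx s n) X z) = z"
proof (rule cspace_eqI[OF apply_matrix_in_cspace \<Omega>_subset_cspace[OF z]])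
  fix k assume k: "k \<in> idx s n"
  have line: "(\<lambda>k. \<zeta> * z k) \<in> \<Omega> s n \<theta>" if "cmod \<zeta> < 1" for \<zeta>
    using disc_curve_line[OF z] that unfolding disc_curve_def by simp
  have "((\<lambda>\<zeta>. h (g (\<lambda>k. \<zeta> * z k)) k / \<zeta>) \<longlongrightarrow>
      apply_matrix (idx s n) (idx t m) Y (apply_matrix (idx t m) (idx s n) X z) k) (at 0)"
    by (rule derivative_along_disc_curve[OF perm' h Y disc_curve_compose[OF perm g disc_curve_line[OF z]] _ k])
       (rule derivative_along_line[OF perm g X z])
  moreover have "((\<lambda>\<zeta>. h (g (\<lambda>k. \<zeta> * z k)) k / \<zeta>) \<longlongrightarrow> z k) (at 0)"
  proof (rule tendsto_eventually)
    show "\<forall>\<^sub>F \<zeta> in at 0. h (g (\<lambda>k. \<zeta> * z k)) k / \<zeta> = z k"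
      using eventually_at_0_disc by eventually_elim (simp add: inv line)
  qed
  ultimately show "apply_matrix (idx s n) (idx t m) Y (apply_matrix (idx t m) (idx s n) X z) k = z k"
    by (rule LIM_unique)
qed

section \<open>Cartan's uniqueness theorem\<close>

text \<open>
  Suppose \<open>\<Phi> (\<zeta> z) = \<zeta> z + \<zeta>\<^sup>q P + \<dots>\<close> with \<open>q \<ge> 2\<close>. Then the \<open>N\<close>-th iterate is
  \<open>\<zeta> z + N \<zeta>\<^sup>q P + \<dots>\<close>, because \<open>\<Phi>\<close> acts on differences of nearby points like the identity. All
  iterates take values in \<open>\<Omega>\<close>, so their coefficients are bounded and \<open>P = 0\<close>. The hypothesis on disc
  curves stands for the holomorphy of \<open>\<Phi>\<close>: only compositions with discs matter.
\<close>

lemma Cartan_uniqueness: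
  assumes perm: "permutation_set s n \<theta>"
    and curves: "\<And>v. disc_curve s n \<theta> v \<Longrightarrow> disc_curve s n \<theta> (\<lambda>\<zeta>. \<Phi> (v \<zeta>))"
    and deriv: "\<And>k C. k \<in> idx s n \<Longrightarrow> algebraic_component (idx s n) (V s n \<theta>) C \<Longrightarrow>
       strict_derivative_on (idx s n) C (\<lambda>z. \<Phi> z k) (\<lambda>k'. if k' = k then 1 else 0)"
    and z: "z \<in> \<Omega> s n \<theta>" and \<zeta>: "cmod \<zeta> < 1"
  shows "\<Phi> (\<lambda>k. \<zeta> * z k) = (\<lambda>k. \<zeta> * z k)"
proof -
  let ?K = "idx s n"
  define w where "w N \<zeta> = (\<Phi> ^^ N) (\<lambda>k. \<zeta> * z k)" for N \<zeta>
  define x where "x N k \<zeta> = w N \<zeta> k - \<zeta> * z k" for N k \<zeta>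
  have w0: "w 0 \<zeta> = (\<lambda>k. \<zeta> * z k)" and wSuc: "w (Suc N) \<zeta> = \<Phi> (w N \<zeta>)" for N \<zeta>
    by (simp_all add: w_def)
  have line: "disc_curve s n \<theta> (\<lambda>\<zeta> k. \<zeta> * z k)" by (rule disc_curve_line[OF z])
  have wc: "disc_curve s n \<theta> (w N)" for N
  proof (induction N)
    case 0
    show ?case using line by (simp add: w0[abs_def])
  next
    case (Suc N)
    show ?case using curves[OF Suc] by (simp add: wSuc[abs_def])
  qed
  have xhol: "x N k holomorphic_on ball 0 1" if "k \<in> ?K" for N k
    using wc[of N] that unfolding x_def disc_curve_def holomorphic_curve_def
    by (auto intro!: holomorphic_intros)
  have xle: "cmod (x N k \<zeta>) \<le> 2" if k: "k \<in> ?K" and \<zeta>: "cmod \<zeta> < 1" for N k \<zeta>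
  proof -
    have "cmod (w N \<zeta> k) \<le> 1" "cmod (\<zeta> * z k) \<le> 1"
      using wc[of N] line \<zeta> unfolding disc_curve_def by (auto intro!: cmod_le_1_of_\<Omega>[OF _ k])
    then show ?thesis using norm_triangle_ineq4[of "w N \<zeta> k" "\<zeta> * z k"] unfolding x_def by linarith
  qed
  \<comment> \<open>The component containing the curve \<open>w N\<close> is a closed cone, so it also contains the tangent line
    \<open>\<zeta> z\<close>; hence the derivative of \<open>\<Phi>\<close> on that single component controls the difference.\<close>
  have step: "((\<lambda>\<zeta>. (\<Phi> (w N \<zeta>) k - \<Phi> (\<lambda>k. \<zeta> * z k) k) / \<zeta> ^ q) \<longlongrightarrow> P k) (at 0)"
    if k: "k \<in> ?K" and tang: "\<And>k. k \<in> ?K \<Longrightarrow> ((\<lambda>\<zeta>. x N k \<zeta> / \<zeta>) \<longlongrightarrow> 0) (at 0)"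
      and P: "\<And>k. k \<in> ?K \<Longrightarrow> ((\<lambda>\<zeta>. x N k \<zeta> / \<zeta> ^ q) \<longlongrightarrow> P k) (at 0)" for N q P k
  proof -
    obtain C where C: "algebraic_component ?K (V s n \<theta>) C" "\<And>\<zeta>. cmod \<zeta> < 1 \<Longrightarrow> w N \<zeta> \<in> C"
      using disc_curve_component[OF perm wc] by blast
    have alg: "algebraic_set ?K C"
      using C(1) unfolding algebraic_component_def irreducible_algebraic_set_def by blast
    have "z \<in> C"
    proof (rule algebraic_set_limit[OF alg, where F = "at 0" and w = "\<lambda>\<zeta> k. w N \<zeta> k / \<zeta>"])
      show "((\<lambda>\<zeta>. w N \<zeta> k / \<zeta>) \<longlongrightarrow> z k) (at 0)" if "k \<in> ?K" for k
      proof -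
        have "((\<lambda>\<zeta>. x N k \<zeta> / \<zeta> + z k) \<longlongrightarrow> 0 + z k) (at 0)"
          by (intro tendsto_add tang that tendsto_const)
        moreover have "\<forall>\<^sub>F \<zeta> in at 0. x N k \<zeta> / \<zeta> + z k = w N \<zeta> k / \<zeta>"
          using eventually_at_0_disc by eventually_elim (simp add: x_def field_simps)
        ultimately show ?thesis
          using tendsto_cong[of "\<lambda>\<zeta>. x N k \<zeta> / \<zeta> + z k" "\<lambda>\<zeta>. w N \<zeta> k / \<zeta>" "at 0"] by simp
      qed
      show "\<forall>\<^sub>F \<zeta> in at 0. (\<lambda>k. w N \<zeta> k / \<zeta>) \<in> C"
        using eventually_at_0_disc
      proof eventually_elim
        case (elim \<zeta>)
        then have "w N \<zeta> \<in> C" using C(2) by blast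
        from component_scale_closed[OF perm C(1) this, of "\<lambda>_. 1 / \<zeta>"]
        show ?case by (simp add: block_scale_def)
      qed
    qed (use z \<Omega>_subset_cspace in auto)
    then have lineC: "(\<lambda>k. \<zeta> * z k) \<in> C" for \<zeta>
      using component_scale_closed[OF perm C(1), of z "\<lambda>_. \<zeta>"] by (simp add: block_scale_def)
    have "((\<lambda>\<zeta>. (\<Phi> (w N \<zeta>) k - \<Phi> (\<lambda>k. \<zeta> * z k) k) / \<zeta> ^ q) \<longlongrightarrow>
        (\<Sum>k'\<in>?K. (if k' = k then 1 else 0) * P k')) (at 0)"
    proof (rule strict_derivative_on_tendsto[OF deriv[OF k C(1)]])
      show "\<forall>\<^sub>F \<zeta> in at 0. w N \<zeta> \<in> C"
        using eventually_at_0_disc by eventually_elim (simp add: C(2))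
      show "((\<lambda>\<zeta>. (w N \<zeta> k - \<zeta> * z k) / \<zeta> ^ q) \<longlongrightarrow> P k) (at 0)" if "k \<in> ?K" for k
        using P[OF that] by (simp add: x_def)
    qed (use lineC disc_curve_tendsto_0[OF wc] disc_curve_tendsto_0[OF line] in auto)
    also have "(\<Sum>k'\<in>?K. (if k' = k then 1 else 0) * P k') = (\<Sum>k'\<in>?K. if k' = k then P k' else 0)"
      by (rule sum.cong) auto
    also have "\<dots> = P k" using k by simp
    finally show ?thesis .
  qed
  \<comment> \<open>\<open>\<Phi>\<close> agrees with the identity to every order along the line: if the coefficient \<open>P\<close> at the next
    order did not vanish, it would grow linearly with the number of iterations.\<close>
  have order: "((\<lambda>\<zeta>. x 1 k \<zeta> / \<zeta> ^ Suc q) \<longlongrightarrow> 0) (at 0)" if "k \<in> ?K" for q k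
    using that
  proof (induction q arbitrary: k)
    case 0
    obtain C where C: "algebraic_component ?K (V s n \<theta>) C" "\<And>\<zeta>. cmod \<zeta> < 1 \<Longrightarrow> (\<lambda>k. \<zeta> * z k) \<in> C"
      using disc_curve_component[OF perm line] by blast
    have "((\<lambda>\<zeta>. (\<Phi> (\<lambda>k. \<zeta> * z k) k - \<Phi> (\<lambda>_. 0) k) / \<zeta> ^ 1) \<longlongrightarrow>
        (\<Sum>k'\<in>?K. (if k' = k then 1 else 0) * z k')) (at 0)"
    proof (rule strict_derivative_on_tendsto[OF deriv[OF 0 C(1)]])
      show "\<forall>\<^sub>F \<zeta> in at 0. (\<lambda>k. \<zeta> * z k) \<in> C"
        using eventually_at_0_disc by eventually_elim (simp add: C(2))
      show "((\<lambda>\<zeta>. (\<zeta> * z k - 0) / \<zeta> ^ 1) \<longlongrightarrow> z k) (at 0)" for k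
        by (rule tendsto_eventually) (simp add: eventually_at_filter)
    qed (use zero_in_component[OF perm C(1)] disc_curve_tendsto_0[OF line] in auto)
    also have "(\<Sum>k'\<in>?K. (if k' = k then 1 else 0) * z k') = (\<Sum>k'\<in>?K. if k' = k then z k' else 0)"
      by (rule sum.cong) auto
    also have "\<dots> = z k" using 0 by simp
    also have "\<Phi> (\<lambda>_. 0) = (\<lambda>_. 0)" using curves[OF line] by (simp add: disc_curve_def)
    finally have "((\<lambda>\<zeta>. \<Phi> (\<lambda>k. \<zeta> * z k) k / \<zeta> - z k) \<longlongrightarrow> z k - z k) (at 0)"
      by (intro tendsto_diff tendsto_const) simp
    moreover have "\<forall>\<^sub>F \<zeta> in at 0. \<Phi> (\<lambda>k. \<zeta> * z k) k / \<zeta> - z k = x 1 k \<zeta> / \<zeta> ^ Suc 0"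
      using eventually_at_0_disc by eventually_elim (simp add: x_def w_def field_simps)
    ultimately show ?case
      using tendsto_cong[of "\<lambda>\<zeta>. \<Phi> (\<lambda>k. \<zeta> * z k) k / \<zeta> - z k" "\<lambda>\<zeta>. x 1 k \<zeta> / \<zeta> ^ Suc 0"] by simp
  next
    case (Suc q)
    have "\<exists>L. ((\<lambda>\<zeta>. x 1 k \<zeta> / \<zeta> ^ Suc (Suc q)) \<longlongrightarrow> L) (at 0)" if k: "k \<in> ?K" for k
    proof -
      obtain g where g: "g holomorphic_on ball 0 1" "g 0 = 0"
          "\<And>\<zeta>. cmod \<zeta> < 1 \<Longrightarrow> x 1 k \<zeta> = \<zeta> ^ Suc q * g \<zeta>"
        using Schwarz_power[OF xhol[OF k] xle[OF k] Suc.IH[OF k]] by auto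
      obtain h where h: "h holomorphic_on ball 0 1" "\<And>\<zeta>. cmod \<zeta> < 1 \<Longrightarrow> g \<zeta> = \<zeta> * h \<zeta>"
        using Schwarz3[OF g(1,2)] by blast
      have "isCont h 0"
        using h(1) continuous_on_eq_continuous_at[OF open_ball] holomorphic_on_imp_continuous_on
        by (metis centre_in_ball zero_less_one)
      then have "(h \<longlongrightarrow> h 0) (at 0)" by (simp add: isCont_def)
      moreover have "\<forall>\<^sub>F \<zeta> in at 0. h \<zeta> = x 1 k \<zeta> / \<zeta> ^ Suc (Suc q)"
        using eventually_at_0_disc by eventually_elim (use g(3) h(2) in auto)
      ultimately show ?thesis using tendsto_cong[of h "\<lambda>\<zeta>. x 1 k \<zeta> / \<zeta> ^ Suc (Suc q)"] by blast
    qed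
    then obtain P where P: "\<And>k. k \<in> ?K \<Longrightarrow> ((\<lambda>\<zeta>. x 1 k \<zeta> / \<zeta> ^ Suc (Suc q)) \<longlongrightarrow> P k) (at 0)"
      by metis
    have it: "((\<lambda>\<zeta>. x N k \<zeta> / \<zeta> ^ Suc (Suc q)) \<longlongrightarrow> of_nat N * P k) (at 0)" if "k \<in> ?K" for N k
      using that
    proof (induction N arbitrary: k)
      case 0
      show ?case by (simp add: x_def w0)
    next
      case (Suc N)
      have tang: "((\<lambda>\<zeta>. x N k \<zeta> / \<zeta>) \<longlongrightarrow> 0) (at 0)" if "k \<in> ?K" for k
      proof -
        have "((\<lambda>\<zeta>. \<zeta> ^ Suc q * (x N k \<zeta> / \<zeta> ^ Suc (Suc q))) \<longlongrightarrow> 0 ^ Suc q * (of_nat N * P k)) (at 0)"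
          by (intro tendsto_mult Suc.IH[OF that] tendsto_power tendsto_ident_at)
        moreover have "\<forall>\<^sub>F \<zeta> in at 0. \<zeta> ^ Suc q * (x N k \<zeta> / \<zeta> ^ Suc (Suc q)) = x N k \<zeta> / \<zeta>"
          using eventually_at_0_disc by eventually_elim simp
        ultimately show ?thesis
          using tendsto_cong[of "\<lambda>\<zeta>. \<zeta> ^ Suc q * (x N k \<zeta> / \<zeta> ^ Suc (Suc q))" "\<lambda>\<zeta>. x N k \<zeta> / \<zeta>"] by simp
      qed
      from tendsto_add[OF step[OF Suc.prems tang Suc.IH] P[OF Suc.prems]]
      have "((\<lambda>\<zeta>. (\<Phi> (w N \<zeta>) k - \<Phi> (\<lambda>k. \<zeta> * z k) k) / \<zeta> ^ Suc (Suc q) + x 1 k \<zeta> / \<zeta> ^ Suc (Suc q))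
          \<longlongrightarrow> of_nat N * P k + P k) (at 0)" by simp
      moreover have "(\<Phi> (w N \<zeta>) k - \<Phi> (\<lambda>k. \<zeta> * z k) k) / \<zeta> ^ Suc (Suc q) + x 1 k \<zeta> / \<zeta> ^ Suc (Suc q)
          = x (Suc N) k \<zeta> / \<zeta> ^ Suc (Suc q)" for \<zeta>
        unfolding x_def wSuc by (simp add: w_def flip: add_divide_distrib)
      ultimately show ?case by (simp add: algebra_simps)
    qed
    have "cmod (of_nat N * P k) \<le> 2" for N
      using Schwarz_power[OF xhol[OF Suc.prems] xle[OF Suc.prems] it[OF Suc.prems]]
      by (metis norm_zero zero_less_one)
    then have "real N * cmod (P k) \<le> 2" for N by (simp add: norm_mult)
    moreover have "\<exists>N. real N * cmod (P k) > 2" if "P k \<noteq> 0"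
      using reals_Archimedean3[of "cmod (P k)"] that by auto
    ultimately have "P k = 0" by (meson not_less)
    then show ?case using P[OF Suc.prems] by simp
  qed
  have "x 1 k \<zeta> = 0" if k: "k \<in> ?K" for k
  proof -
    have le: "cmod (x 1 k \<zeta>) \<le> 2 * cmod \<zeta> ^ Suc q" for q
    proof -
      obtain g where "cmod (g \<zeta>) \<le> 2" "x 1 k \<zeta> = \<zeta> ^ Suc q * g \<zeta>"
        using Schwarz_power[OF xhol[OF k] xle[OF k] order[OF k]] \<zeta> by blast
      then show ?thesis
        by (simp add: norm_mult norm_power mult.commute mult_right_mono del: power_Suc)
    qed
    have "(\<lambda>q. 2 * cmod \<zeta> ^ Suc q) \<longlonglongrightarrow> 2 * 0"
      using \<zeta> by (intro tendsto_mult tendsto_const LIMSEQ_Suc LIMSEQ_power_zero) simp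
    then have "cmod (x 1 k \<zeta>) \<le> 2 * 0" by (rule LIMSEQ_le_const) (use le in blast)
    then show ?thesis by simp
  qed
  moreover have "\<Phi> (\<lambda>k. \<zeta> * z k) = w 1 \<zeta>" by (simp add: w_def)
  moreover have "w 1 \<zeta> \<in> cspace ?K" "(\<lambda>k. \<zeta> * z k) \<in> cspace ?K"
    using wc[of 1] line \<zeta> unfolding disc_curve_def by (auto intro!: \<Omega>_subset_cspace)
  ultimately show ?thesis by (intro cspace_eqI[of _ ?K]) (auto simp: x_def)
qed

section \<open>Homogeneous extension to the varieties\<close>

lemma block_norm_mult: "block_norm n i (\<lambda>k. c * z k) = cmod c * block_norm n i z"
  using block_norm_scale[of n i "\<lambda>_. c" z] by (simp add: block_scale_def)

lemma V_mult: "z \<in> V s n \<theta> \<Longrightarrow> (\<lambda>k. c * z k) \<in> V s n \<theta>"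
  using block_scale_in_V[of z s n \<theta> "\<lambda>_. c"] by (simp add: block_scale_def)

lemma V_rescale:
  assumes z: "z \<in> V s n \<theta>" and R: "R > 0" and le: "\<And>i. i \<in> {1..s} \<Longrightarrow> block_norm n i z \<le> R"
  shows "(\<lambda>k. of_real (1 / R) * z k) \<in> \<Omega> s n \<theta>"
proof -
  have "block_norm n i (\<lambda>k. of_real (1 / R) * z k) \<le> 1" if "i \<in> {1..s}" for i
    unfolding block_norm_mult using le[OF that] R by (simp add: norm_divide)
  then show ?thesis using V_mult[OF z, of "of_real (1 / R)"] unfolding \<Omega>_def by blast
qed

lemma V_bounded:
  "\<exists>R>0. \<forall>i\<in>{1..s}. block_norm n i z \<le> R"
proof (intro exI conjI ballI)
  show "0 < cnorm (idx s n) z + 1" using cnorm_nonneg[of "idx s n" z] by linarith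
  show "block_norm n i z \<le> cnorm (idx s n) z + 1" if "i \<in> {1..s}" for i
    using block_norm_le_cnorm[OF that, of n z] by linarith
qed

lemma left_inverse_on_V:
  assumes inv: "\<And>z. z \<in> \<Omega> s n \<theta> \<Longrightarrow> apply_matrix K L Y (apply_matrix L K' X z) = z"
    and z: "z \<in> V s n \<theta>"
  shows "apply_matrix K L Y (apply_matrix L K' X z) = z"
proof -
  obtain R where R: "R > 0" "\<And>i. i \<in> {1..s} \<Longrightarrow> block_norm n i z \<le> R" using V_bounded by blast
  from inv[OF V_rescale[OF z R]]
  have "(\<lambda>k. of_real (1 / R) * apply_matrix K L Y (apply_matrix L K' X z) k) = (\<lambda>k. of_real (1 / R) * z k)"
    unfolding apply_matrix_mult .
  then have "of_real (1 / R) * apply_matrix K L Y (apply_matrix L K' X z) k = of_real (1 / R) * z k" for k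
    by (rule fun_cong)
  then show ?thesis using R(1) by auto
qed

section \<open>Biholomorphic maps fixing the origin are linear\<close>

text \<open>
  Cartan's theorem for \<open>Y \<circ> g\<close> gives \<open>g = X\<close> on the interior, and continuity extends this to points
  whose block norms equal \<open>1\<close>.
\<close>

lemma biholomorphic_eq_derivative:
  assumes perm: "permutation_set s n \<theta>" and perm': "permutation_set t m \<tau>"
    and g: "pointed_holomorphic_map s n \<theta> t m \<tau> g" and h: "pointed_holomorphic_map t m \<tau> s n \<theta> h"
    and X: "derivative_matrix s n \<theta> t m g X" and Y: "derivative_matrix t m \<tau> s n h Y"
    and hg: "\<And>z. z \<in> \<Omega> s n \<theta> \<Longrightarrow> h (g z) = z" and gh: "\<And>w. w \<in> \<Omega> t m \<tau> \<Longrightarrow> g (h w) = w"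
    and cont: "continuous_on (\<Omega> s n \<theta>) g" and z: "z \<in> \<Omega> s n \<theta>"
  shows "g z = apply_matrix (idx t m) (idx s n) X z"
proof -
  let ?K = "idx s n" and ?L = "idx t m"
  define \<Phi> where "\<Phi> z = apply_matrix ?K ?L Y (g z)" for z
  have basis: "(\<Sum>l\<in>?L. Y k l * X l k') = (if k' = k then 1 else 0)" if k: "k \<in> ?K" "k' \<in> ?K" for k k'
  proof -
    have "unit_vector k' \<in> V s n \<theta>"
      using unit_vector_in_block_subspace[OF k(2)] block_subspace_subset_V[OF perm] by blast
    from left_inverse_on_V[OF derivative_left_inverse[OF perm perm' g h X Y hg] this]
    have "apply_matrix ?K ?L Y (apply_matrix ?L ?K X (unit_vector k')) k = unit_vector k' k" by simp
    moreover have "apply_matrix ?K ?L Y (apply_matrix ?L ?K X (unit_vector k')) k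
        = (\<Sum>l\<in>?L. Y k l * apply_matrix ?L ?K X (unit_vector k') l)"
      unfolding apply_matrix_def[of ?K] using k by simp
    moreover have "\<dots> = (\<Sum>l\<in>?L. Y k l * X l k')"
      by (rule sum.cong) (simp_all add: apply_matrix_unit_vector k)
    ultimately show ?thesis by (auto simp: unit_vector_def)
  qed
  have fixed: "\<Phi> (\<lambda>k. \<zeta> * z k) = (\<lambda>k. \<zeta> * z k)" if "cmod \<zeta> < 1" for \<zeta>
  proof (rule Cartan_uniqueness[OF perm _ _ z that])
    show "disc_curve s n \<theta> (\<lambda>\<zeta>. \<Phi> (v \<zeta>))" if v: "disc_curve s n \<theta> v" for v
    proof -
      have gv: "disc_curve t m \<tau> (\<lambda>\<zeta>. g (v \<zeta>))" by (rule disc_curve_compose[OF perm g v])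
      have "holomorphic_curve ?K (ball 0 1) (\<lambda>\<zeta>. \<Phi> (v \<zeta>))"
        using gv unfolding \<Phi>_def holomorphic_curve_def disc_curve_def
        by (auto simp: apply_matrix_def[abs_def] cspace_def intro!: holomorphic_intros)
      moreover have "\<Phi> (v \<zeta>) \<in> \<Omega> s n \<theta>" if "\<zeta> \<in> ball 0 1" for \<zeta>
        unfolding \<Phi>_def using gv that
        by (intro derivative_maps_\<Omega>[OF perm' perm h Y]) (auto simp: disc_curve_def)
      moreover have "\<Phi> (v 0) = (\<lambda>_. 0)"
        using gv by (auto simp: \<Phi>_def disc_curve_def apply_matrix_def)
      ultimately show ?thesis unfolding disc_curve_def by blast
    qed
    show "strict_derivative_on ?K C (\<lambda>z. \<Phi> z k) (\<lambda>k'. if k' = k then 1 else 0)"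
      if k: "k \<in> ?K" and C: "algebraic_component ?K (V s n \<theta>) C" for k C
    proof -
      have "strict_derivative_on ?K C (\<lambda>z. \<Sum>l\<in>?L. Y k l * g z l) (\<lambda>k'. \<Sum>l\<in>?L. Y k l * X l k')"
        by (rule strict_derivative_on_sum) (use X C in \<open>auto simp: derivative_matrix_def\<close>)
      moreover have "(\<Sum>k'\<in>?K. (\<Sum>l\<in>?L. Y k l * X l k') * d k') = (\<Sum>k'\<in>?K. (if k' = k then 1 else 0) * d k')" for d
        by (rule sum.cong) (simp_all add: basis[OF k])
      ultimately show ?thesis using k unfolding strict_derivative_on_def \<Phi>_def by (simp add: apply_matrix_def)
    qed
  qed
  have line: "(\<lambda>k. \<zeta> * z k) \<in> \<Omega> s n \<theta>" if "cmod \<zeta> \<le> 1" for \<zeta>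
    using block_scale_in_\<Omega>[OF z, of "\<lambda>_. \<zeta>"] that by (simp add: block_scale_def)
  have inner: "g (\<lambda>k. \<zeta> * z k) = (\<lambda>l. \<zeta> * apply_matrix ?L ?K X z l)" if "cmod \<zeta> < 1" for \<zeta>
  proof -
    have "g (\<lambda>k. \<zeta> * z k) \<in> \<Omega> t m \<tau>"
      using g line that unfolding pointed_holomorphic_map_def by simp
    from derivative_left_inverse[OF perm' perm h g Y X gh this] fixed[OF that]
    show ?thesis by (simp add: \<Phi>_def apply_matrix_mult)
  qed
  show ?thesis
  proof
    fix l
    \<comment> \<open>interior parameters approaching \<open>1\<close>\<close>
    define r where "r N = complex_of_real (1 - inverse (real (Suc N)))" for N
    have r: "cmod (r N) < 1" for N
    proof -
      have "0 < inverse (real (Suc N))" "inverse (real (Suc N)) \<le> 1" by (simp_all add: field_simps)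
      then have "\<bar>1 - inverse (real (Suc N))\<bar> < 1" by linarith
      then show ?thesis unfolding r_def norm_of_real .
    qed
    have rlim: "r \<longlonglongrightarrow> 1"
    proof -
      have "(\<lambda>N. 1 - inverse (real (Suc N))) \<longlonglongrightarrow> 1 - 0"
        by (intro tendsto_diff tendsto_const LIMSEQ_inverse_real_of_nat)
      from tendsto_of_real[OF this] show ?thesis unfolding r_def diff_0_right of_real_1 .
    qed
    have "continuous_on (cball 0 1) (\<lambda>\<zeta>. g (\<lambda>k. \<zeta> * z k) l)"
    proof (rule continuous_on_compose2[of "\<Omega> s n \<theta>" "\<lambda>z. g z l"])
      show "continuous_on (\<Omega> s n \<theta>) (\<lambda>z. g z l)"
        by (rule continuous_on_product_then_coordinatewise[OF cont])
      show "continuous_on (cball 0 1) (\<lambda>\<zeta> k. \<zeta> * z k)"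
        by (intro continuous_on_coordinatewise_then_product continuous_intros)
    qed (use line in auto)
    then have "(\<lambda>N. g (\<lambda>k. r N * z k) l) \<longlonglongrightarrow> g (\<lambda>k. 1 * z k) l"
      by (rule continuous_on_tendsto_compose[OF _ rlim]) (use r in \<open>auto intro!: always_eventually less_imp_le\<close>)
    moreover have "(\<lambda>N. r N * apply_matrix ?L ?K X z l) \<longlonglongrightarrow> 1 * apply_matrix ?L ?K X z l"
      by (intro tendsto_mult rlim tendsto_const)
    ultimately show "g z l = apply_matrix ?L ?K X z l"
      using LIMSEQ_unique by (simp add: inner[OF r])
  qed
qed

section \<open>Linear maps and block norms\<close>

lemma apply_matrix_linear:
  "apply_matrix L K X (\<lambda>k. a * x k + b * y k) = (\<lambda>l. a * apply_matrix L K X x l + b * apply_matrix L K X y l)"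
proof
  fix l
  have "(\<Sum>k\<in>K. X l k * (a * x k + b * y k)) = a * (\<Sum>k\<in>K. X l k * x k) + b * (\<Sum>k\<in>K. X l k * y k)"
    by (simp add: distrib_left sum.distrib sum_distrib_left mult.left_commute)
  then show "apply_matrix L K X (\<lambda>k. a * x k + b * y k) l = a * apply_matrix L K X x l + b * apply_matrix L K X y l"
    by (simp add: apply_matrix_def)
qed

lemma apply_matrix_zero:
  assumes "\<And>k. k \<in> K \<Longrightarrow> w k = 0" shows "apply_matrix L K X w = (\<lambda>_. 0)"
  using assms unfolding apply_matrix_def by (auto intro!: sum.neutral)

lemma block_norm_parallelogram:
  "(block_norm n i (\<lambda>k. x k + y k))\<^sup>2 + (block_norm n i (\<lambda>k. x k - y k))\<^sup>2
     = 2 * (block_norm n i x)\<^sup>2 + 2 * (block_norm n i y)\<^sup>2"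
proof -
  have cm: "(cmod (a + b))\<^sup>2 + (cmod (a - b))\<^sup>2 = 2 * (cmod a)\<^sup>2 + 2 * (cmod b)\<^sup>2" for a b :: complex
    unfolding cmod_power2 by (simp add: power2_eq_square algebra_simps)
  have bn: "(block_norm n i z)\<^sup>2 = (\<Sum>p\<in>{1..n i}. (cmod (z (i, p)))\<^sup>2)" for z
    unfolding block_norm_def L2_set_def by (simp add: sum_nonneg)
  show ?thesis unfolding bn sum.distrib[symmetric] sum_distrib_left cm ..
qed

lemma block_norm_eq_0_iff: "block_norm n i z = 0 \<longleftrightarrow> (\<forall>p\<in>{1..n i}. z (i, p) = 0)"
  unfolding block_norm_def by (simp add: L2_set_eq_0_iff)

lemma apply_matrix_bound:
  assumes A: "\<And>z. z \<in> \<Omega> s n \<theta> \<Longrightarrow> apply_matrix (idx t m) (idx s n) X z \<in> \<Omega> t m \<tau>"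
    and z: "z \<in> V s n \<theta>" and R: "R > 0" and le: "\<And>i. i \<in> {1..s} \<Longrightarrow> block_norm n i z \<le> R"
  shows "apply_matrix (idx t m) (idx s n) X z \<in> V t m \<tau>"
    and "j \<in> {1..t} \<Longrightarrow> block_norm m j (apply_matrix (idx t m) (idx s n) X z) \<le> R"
proof -
  let ?A = "apply_matrix (idx t m) (idx s n) X"
  from A[OF V_rescale[OF z R le]] have *: "(\<lambda>l. of_real (1 / R) * ?A z l) \<in> \<Omega> t m \<tau>"
    unfolding apply_matrix_mult .
  have "of_real R * (of_real (1 / R) * ?A z l) = ?A z l" for l using R by simp
  moreover have "(\<lambda>l. of_real R * (of_real (1 / R) * ?A z l)) \<in> V t m \<tau>"
    by (rule V_mult) (use * in \<open>auto simp: \<Omega>_def\<close>)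
  ultimately show "?A z \<in> V t m \<tau>" by simp
  show "block_norm m j (?A z) \<le> R" if "j \<in> {1..t}"
  proof -
    have "block_norm m j (\<lambda>l. of_real (1 / R) * ?A z l) \<le> 1" using * that unfolding \<Omega>_def by blast
    then show ?thesis unfolding block_norm_mult using R by (simp add: norm_divide)
  qed
qed

text \<open>
  Induction on the number of subspaces: if \<open>z\<close> avoids all subspaces considered so far and \<open>y\<close> avoids
  the new one, then each of the subspaces contains at most one point \<open>z + c y\<close> of the line.
\<close>

lemma finite_union_of_subspaces:
  fixes E :: "('k \<Rightarrow> complex) set"
  assumes fin: "finite I" and ne: "E \<noteq> {}"
    and E: "\<And>x y a b. x \<in> E \<Longrightarrow> y \<in> E \<Longrightarrow> (\<lambda>k. a * x k + b * y k) \<in> E"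
    and W: "\<And>i x y a b. i \<in> I \<Longrightarrow> x \<in> W i \<Longrightarrow> y \<in> W i \<Longrightarrow> (\<lambda>k. a * x k + b * y k) \<in> W i"
    and not: "\<And>i. i \<in> I \<Longrightarrow> \<not> E \<subseteq> W i"
  shows "\<exists>z\<in>E. \<forall>i\<in>I. z \<notin> W i"
  using fin W not
proof (induction I)
  case empty
  then show ?case using ne by auto
next
  case (insert j I)
  obtain z where z: "z \<in> E" "\<And>i. i \<in> I \<Longrightarrow> z \<notin> W i" using insert by (metis insertCI)
  obtain y where y: "y \<in> E" "y \<notin> W j" using insert.prems(2)[of j] by auto
  define p where "p c = (\<lambda>k. 1 * z k + c * y k)" for c
  define S where "S i = {c. p c \<in> W i}" for i
  have "finite (S i)" if i: "i \<in> insert j I" for i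
  proof -
    have one: "c = d" if cd: "c \<in> S i" "d \<in> S i" for c d
    proof (rule ccontr)
      assume ne: "c \<noteq> d"
      have lin: "(\<lambda>k. a * p c k + b * p d k) \<in> W i" for a b
        using insert.prems(1)[OF i] cd unfolding S_def by blast
      show False
      proof (cases "i = j")
        case True
        have "(\<lambda>k. 1 / (c - d) * p c k + (- 1 / (c - d)) * p d k) = y"
        proof
          fix k
          have "1 / (c - d) * p c k + (- 1 / (c - d)) * p d k = (p c k - p d k) / (c - d)"
            by (simp add: diff_divide_distrib)
          also have "p c k - p d k = (c - d) * y k" unfolding p_def by (simp add: algebra_simps)
          finally show "1 / (c - d) * p c k + (- 1 / (c - d)) * p d k = y k" using ne by simp
        qed
        then show False using lin[of "1 / (c - d)" "- 1 / (c - d)"] y True by simp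
      next
        case False
        have "(\<lambda>k. d / (d - c) * p c k + (- c / (d - c)) * p d k) = z"
        proof
          fix k
          have "d / (d - c) * p c k + (- c / (d - c)) * p d k = (d * p c k - c * p d k) / (d - c)"
            by (simp add: diff_divide_distrib)
          also have "d * p c k - c * p d k = (d - c) * z k" unfolding p_def by (simp add: algebra_simps)
          finally show "d / (d - c) * p c k + (- c / (d - c)) * p d k = z k" using ne by simp
        qed
        then show False using lin[of "d / (d - c)" "- c / (d - c)"] z(2)[of i] False i by simp
      qed
    qed
    show ?thesis
    proof (cases "S i = {}")
      case False
      then obtain c where "c \<in> S i" by blast
      then have "S i \<subseteq> {c}" using one by blast
      then show ?thesis using finite_subset by blast
    qed simp
  qed
  then have "finite (\<Union>i\<in>insert j I. S i)" using insert.hyps(1) by blast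
  then obtain c where "c \<notin> (\<Union>i\<in>insert j I. S i)"
    using ex_new_if_finite[OF infinite_UNIV_char_0] by blast
  then have "\<forall>i\<in>insert j I. p c \<notin> W i" unfolding S_def by blast
  moreover have "p c \<in> E" unfolding p_def by (rule E[OF z(1) y(1)])
  ultimately show ?case by blast
qed

definition block_part :: "nat \<Rightarrow> (nat \<times> nat \<Rightarrow> complex) \<Rightarrow> nat \<times> nat \<Rightarrow> complex" where
  "block_part i z = block_scale (\<lambda>j. if j = i then 1 else 0) z"

lemma block_part_in_subspace: "z \<in> cspace (idx s n) \<Longrightarrow> block_part i z \<in> block_subspace s n i"
  unfolding block_subspace_def block_part_def
  using block_scale_in_cspace[of z "idx s n"] by (simp add: block_scale_def)

lemma block_norm_block_part: "block_norm n j (block_part i z) = (if j = i then block_norm n i z else 0)"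
  unfolding block_part_def block_norm_scale by simp

lemma block_norm_block_subspace: "z \<in> block_subspace s n i \<Longrightarrow> j \<noteq> i \<Longrightarrow> block_norm n j z = 0"
  unfolding block_subspace_def by (simp add: block_norm_eq_0_iff)

lemma apply_matrix_sum_block_parts:
  "apply_matrix L (idx s n) X z l = (\<Sum>i\<in>{1..s}. apply_matrix L (idx s n) X (block_part i z) l)"
proof (cases "l \<in> L")
  case True
  have "(\<Sum>k\<in>idx s n. X l k * block_part i z k) = (\<Sum>p\<in>{1..n i}. X l (i, p) * z (i, p))"
    if i: "i \<in> {1..s}" for i
  proof -
    have "(\<Sum>k\<in>idx s n. X l k * block_part i z k)
        = (\<Sum>j\<in>{1..s}. if j = i then \<Sum>p\<in>{1..n j}. X l (j, p) * z (j, p) else 0)"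
      unfolding sum_idx by (rule sum.cong) (auto simp: block_part_def block_scale_def)
    then show ?thesis using i by simp
  qed
  then show ?thesis using True unfolding apply_matrix_def by (simp add: sum_idx)
qed (simp add: apply_matrix_def)

lemma block_norm_eq_sum:
  assumes z: "z \<in> block_subspace s n i" and i: "i \<in> {1..s}"
  shows "(block_norm n i z)\<^sup>2 = (\<Sum>k\<in>idx s n. (cmod (z k))\<^sup>2)"
proof -
  have "(\<Sum>k\<in>idx s n. (cmod (z k))\<^sup>2) = (\<Sum>j\<in>{1..s}. if j = i then \<Sum>p\<in>{1..n j}. (cmod (z (j, p)))\<^sup>2 else 0)"
    unfolding sum_idx using z by (intro sum.cong) (auto simp: block_subspace_def)
  also have "\<dots> = (\<Sum>p\<in>{1..n i}. (cmod (z (i, p)))\<^sup>2)" using i by simp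
  finally show ?thesis unfolding block_norm_def L2_set_def by (simp add: sum_nonneg)
qed

section \<open>Mutually inverse linear maps between the spaces\<close>

text \<open>
  The situation that remains after linearisation. Below, \<open>A\<close> and \<open>B\<close> are the maps given by \<open>X\<close> and
  \<open>Y\<close>. They extend from the spaces to the varieties by homogeneity.
\<close>

locale inverse_matrices =
  fixes s t :: nat and n m :: "nat \<Rightarrow> nat" and \<theta> \<tau> :: perms
    and X Y :: "nat \<times> nat \<Rightarrow> nat \<times> nat \<Rightarrow> complex"
  assumes perm: "permutation_set s n \<theta>" and perm': "permutation_set t m \<tau>"
    and A\<Omega>: "\<And>z. z \<in> \<Omega> s n \<theta> \<Longrightarrow> apply_matrix (idx t m) (idx s n) X z \<in> \<Omega> t m \<tau>"
    and B\<Omega>: "\<And>w. w \<in> \<Omega> t m \<tau> \<Longrightarrow> apply_matrix (idx s n) (idx t m) Y w \<in> \<Omega> s n \<theta>"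
    and BA\<Omega>: "\<And>z. z \<in> \<Omega> s n \<theta> \<Longrightarrow>
      apply_matrix (idx s n) (idx t m) Y (apply_matrix (idx t m) (idx s n) X z) = z"
    and AB\<Omega>: "\<And>w. w \<in> \<Omega> t m \<tau> \<Longrightarrow>
      apply_matrix (idx t m) (idx s n) X (apply_matrix (idx s n) (idx t m) Y w) = w"
begin

abbreviation "A \<equiv> apply_matrix (idx t m) (idx s n) X"
abbreviation "B \<equiv> apply_matrix (idx s n) (idx t m) Y"

lemma A_V: "z \<in> V s n \<theta> \<Longrightarrow> A z \<in> V t m \<tau>"
  using V_bounded[of s n z] apply_matrix_bound(1)[OF A\<Omega>] by blast

lemma B_V: "w \<in> V t m \<tau> \<Longrightarrow> B w \<in> V s n \<theta>"
  using V_bounded[of t m w] apply_matrix_bound(1)[OF B\<Omega>] by blast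

lemma BA: "z \<in> V s n \<theta> \<Longrightarrow> B (A z) = z"
  by (rule left_inverse_on_V[OF BA\<Omega>])

lemma AB: "w \<in> V t m \<tau> \<Longrightarrow> A (B w) = w"
  by (rule left_inverse_on_V[OF AB\<Omega>])

lemma B_block_contraction:
  assumes w: "w \<in> block_subspace t m k" and k: "k \<in> {1..t}" and i: "i \<in> {1..s}"
  shows "block_norm n i (B w) \<le> block_norm m k w"
proof (cases "block_norm m k w > 0")
  case True
  have wV: "w \<in> V t m \<tau>" using w block_subspace_subset_V[OF perm'] by blast
  have "block_norm m j w \<le> block_norm m k w" for j
    using block_norm_block_subspace[OF w, of j] by (cases "j = k") auto
  then show ?thesis using apply_matrix_bound(2)[OF B\<Omega> wV True _ i] by blast
next
  case False
  then have "block_norm m k w = 0" using block_norm_nonneg[of m k w] by linarith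
  then have "w (j, p) = 0" if "(j, p) \<in> idx t m" for j p
    using that w unfolding block_norm_eq_0_iff block_subspace_def idx_def by (cases "j = k") auto
  then have "B w = (\<lambda>_. 0)" by (intro apply_matrix_zero) auto
  then have "block_norm n i (B w) = 0" by (simp add: block_norm_eq_0_iff)
  then show ?thesis by simp
qed

text \<open>
  Otherwise all blocks of \<open>B w\<close> have norm at most some \<open>R\<close> smaller than the norm of \<open>w\<close>, and then so
  does \<open>A (B w) = w\<close>.
\<close>

lemma B_block_attained:
  assumes w: "w \<in> block_subspace t m k" and k: "k \<in> {1..t}" and pos: "block_norm m k w > 0"
  shows "\<exists>i\<in>{1..s}. block_norm n i (B w) = block_norm m k w"
proof (rule ccontr)
  assume neg: "\<not> ?thesis"
  have wV: "w \<in> V t m \<tau>" using w block_subspace_subset_V[OF perm'] by blast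
  \<comment> \<open>the extra element makes \<open>R\<close> positive, also if all blocks of \<open>B w\<close> vanish or \<open>s = 0\<close>\<close>
  define R where "R = Max (insert (block_norm m k w / 2) ((\<lambda>i. block_norm n i (B w)) ` {1..s}))"
  have lt: "block_norm n i (B w) < block_norm m k w" if "i \<in> {1..s}" for i
    using B_block_contraction[OF w k that] neg that by (metis order_less_le)
  have R: "R < block_norm m k w" unfolding R_def using lt pos by auto
  have "block_norm m k w / 2 \<le> R" unfolding R_def by (rule Max_ge) auto
  then have R0: "R > 0" using pos by linarith
  have "block_norm n i (B w) \<le> R" if "i \<in> {1..s}" for i
    unfolding R_def using that by (intro Max_ge) auto
  from apply_matrix_bound(2)[OF A\<Omega> B_V[OF wV] R0 this k]
  have "block_norm m k (A (B w)) \<le> R" .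
  then show False using AB[OF wV] R by simp
qed

text \<open>
  For fixed \<open>i\<close>, the vectors of block \<open>k\<close> whose norm is attained in block \<open>i\<close> form a subspace: the
  difference of the two squared norms is non-negative and satisfies the parallelogram law, so its zero
  set is closed under linear combinations. By \<open>B_block_attained\<close> these subspaces cover all non-zero
  vectors of block \<open>k\<close>.
\<close>

lemma B_block_isometric:
  assumes k: "k \<in> {1..t}"
  shows "\<exists>i\<in>{1..s}. \<forall>w\<in>block_subspace t m k. block_norm n i (B w) = block_norm m k w"
proof (rule ccontr)
  assume neg: "\<not> ?thesis"
  define W where "W i = {w \<in> block_subspace t m k. block_norm n i (B w) = block_norm m k w}" for i
  have E: "(\<lambda>l. a * x l + b * y l) \<in> block_subspace t m k"
    if "x \<in> block_subspace t m k" "y \<in> block_subspace t m k" for x y a b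
    using that unfolding block_subspace_def cspace_def by simp
  have "\<exists>w\<in>block_subspace t m k. \<forall>i\<in>{1..s}. w \<notin> W i"
  proof (rule finite_union_of_subspaces[OF _ _ E])
    show "finite {1..s}" by simp
    have "(\<lambda>_. 0) \<in> block_subspace t m k" by (simp add: block_subspace_def)
    then show "block_subspace t m k \<noteq> {}" by blast
    show "\<not> block_subspace t m k \<subseteq> W i" if "i \<in> {1..s}" for i
      using neg that unfolding W_def by blast
    fix i x y a b assume i: "i \<in> {1..s}" and xy: "x \<in> W i" "y \<in> W i"
    define x' y' where "x' = (\<lambda>l. a * x l)" and "y' = (\<lambda>l. b * y l)"
    have sub: "(\<lambda>l. x' l + y' l) \<in> block_subspace t m k" "(\<lambda>l. x' l - y' l) \<in> block_subspace t m k"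
      using E[of x y a b] E[of x y a "-b"] xy unfolding W_def x'_def y'_def by simp_all
    have "block_norm n i (B x') = block_norm m k x'" "block_norm n i (B y') = block_norm m k y'"
      using xy unfolding x'_def y'_def apply_matrix_mult block_norm_mult W_def by simp_all
    then have "(block_norm n i (B (\<lambda>l. x' l + y' l)))\<^sup>2 + (block_norm n i (B (\<lambda>l. x' l - y' l)))\<^sup>2
      = (block_norm m k (\<lambda>l. x' l + y' l))\<^sup>2 + (block_norm m k (\<lambda>l. x' l - y' l))\<^sup>2"
      using block_norm_parallelogram[of n i "B x'" "B y'"] block_norm_parallelogram[of m k x' y']
        apply_matrix_linear[of "idx s n" "idx t m" Y 1 x' 1 y']
        apply_matrix_linear[of "idx s n" "idx t m" Y 1 x' "-1" y'] by simp
    moreover have "(block_norm n i (B (\<lambda>l. x' l + y' l)))\<^sup>2 \<le> (block_norm m k (\<lambda>l. x' l + y' l))\<^sup>2"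
      "(block_norm n i (B (\<lambda>l. x' l - y' l)))\<^sup>2 \<le> (block_norm m k (\<lambda>l. x' l - y' l))\<^sup>2"
      using B_block_contraction[OF _ k i] sub by (auto intro: power_mono)
    ultimately have "(block_norm n i (B (\<lambda>l. x' l + y' l)))\<^sup>2 = (block_norm m k (\<lambda>l. x' l + y' l))\<^sup>2"
      by linarith
    then have "block_norm n i (B (\<lambda>l. x' l + y' l)) = block_norm m k (\<lambda>l. x' l + y' l)"
      by (simp add: power2_eq_iff_nonneg)
    then show "(\<lambda>l. a * x l + b * y l) \<in> W i"
      using sub(1) unfolding W_def x'_def y'_def by simp
  qed
  then obtain w where w: "w \<in> block_subspace t m k"
    "\<And>i. i \<in> {1..s} \<Longrightarrow> block_norm n i (B w) \<noteq> block_norm m k w"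
    unfolding W_def by blast
  \<comment> \<open>The zero vector attains its norm in every block, so \<open>w = 0\<close> would mean \<open>s = 0\<close>. This is refuted
    by a non-zero vector of block \<open>k\<close>, whose norm is attained somewhere.\<close>
  show False
  proof (cases "block_norm m k w > 0")
    case True
    then show False using B_block_attained[OF w(1) k] w(2) by blast
  next
    case False
    then have 0: "block_norm m k w = 0" using block_norm_nonneg[of m k w] by linarith
    have s0: "i \<notin> {1..s}" for i
      using B_block_contraction[OF w(1) k, of i] block_norm_nonneg[of n i "B w"] 0 w(2)[of i] by force
    define e where "e = unit_vector (k, 1::nat)"
    have mk: "1 \<le> m k" using perm' k unfolding permutation_set_def by blast
    have e: "e \<in> block_subspace t m k"
      using unit_vector_in_block_subspace[of "(k, 1)" t m] k mk by (simp add: e_def idx_def)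
    have "block_norm m k e \<noteq> 0" unfolding block_norm_eq_0_iff e_def unit_vector_def using mk by auto
    then have "block_norm m k e > 0" using block_norm_nonneg[of m k e] by linarith
    then show False using B_block_attained[OF e k] s0 by blast
  qed
qed

text \<open>
  Normalise blocks \<open>k\<close> and \<open>k'\<close> of \<open>y\<close>, both of them non-zero, to unit vectors \<open>u\<close>
  and \<open>u'\<close>. Since \<open>V\<close> is a cone in each block,
  \<open>u + u'\<close> and \<open>u - u'\<close> are points of \<open>\<Omega>\<close>. Hence block \<open>i\<close> of \<open>B u + B u'\<close> and of \<open>B u - B u'\<close> has norm at
  most \<open>1\<close>, while that of \<open>B u\<close> has norm exactly \<open>1\<close>; the parallelogram law forces that of \<open>B u'\<close> to
  vanish.
\<close>

lemma B_other_block: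
  assumes k: "k \<in> {1..t}" and i: "i \<in> {1..s}"
    and iso: "\<And>w. w \<in> block_subspace t m k \<Longrightarrow> block_norm n i (B w) = block_norm m k w"
    and y: "y \<in> V t m \<tau>" and yk: "block_norm m k y \<noteq> 0" and k': "k' \<in> {1..t}" "k' \<noteq> k"
  shows "block_norm n i (B (block_part k' y)) = 0"
proof (cases "block_norm m k' y = 0")
  case True
  have "block_part k' y \<in> block_subspace t m k'"
    using block_part_in_subspace[OF V_subset_cspace[OF y]] .
  from B_block_contraction[OF this k'(1) i] show ?thesis
    using True block_norm_nonneg[of n i "B (block_part k' y)"] by (simp add: block_norm_block_part)
next
  case False
  define a b where "a = complex_of_real (1 / block_norm m k y)" and "b = complex_of_real (1 / block_norm m k' y)"
  define u u' where "u = (\<lambda>l. a * block_part k y l)" and "u' = (\<lambda>l. b * block_part k' y l)"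
  have le: "block_norm n i (B (\<lambda>l. u l + c * u' l)) \<le> 1" if c: "c = 1 \<or> c = -1" for c
  proof (rule apply_matrix_bound(2)[OF B\<Omega> _ _ _ i])
    let ?a = "\<lambda>j. if j = k then a else if j = k' then c * b else 0"
    have eq: "(\<lambda>l. u l + c * u' l) = block_scale ?a y"
      unfolding u_def u'_def block_part_def block_scale_def using k'(2) by auto
    show "(\<lambda>l. u l + c * u' l) \<in> V t m \<tau>" unfolding eq by (rule block_scale_in_V[OF y])
    show "block_norm m j (\<lambda>l. u l + c * u' l) \<le> 1" for j
      unfolding eq block_norm_scale using yk False c
      by (auto simp: a_def b_def norm_divide norm_mult)
  qed simp_all
  have "block_norm n i (B (\<lambda>l. u l + u' l)) \<le> 1" "block_norm n i (B (\<lambda>l. u l - u' l)) \<le> 1"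
    using le[of 1] le[of "-1"] by simp_all
  then have "(block_norm n i (B (\<lambda>l. u l + u' l)))\<^sup>2 \<le> 1" "(block_norm n i (B (\<lambda>l. u l - u' l)))\<^sup>2 \<le> 1"
    by (simp_all add: power_le_one)
  moreover have "B (\<lambda>l. u l + u' l) = (\<lambda>k. B u k + B u' k)" "B (\<lambda>l. u l - u' l) = (\<lambda>k. B u k - B u' k)"
    using apply_matrix_linear[of "idx s n" "idx t m" Y 1 u 1 u']
      apply_matrix_linear[of "idx s n" "idx t m" Y 1 u "-1" u'] by simp_all
  ultimately have "2 * (block_norm n i (B u))\<^sup>2 + 2 * (block_norm n i (B u'))\<^sup>2 \<le> 2"
    using block_norm_parallelogram[of n i "B u" "B u'"] by simp
  moreover have "block_norm n i (B u) = 1"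
    using iso[OF block_part_in_subspace[OF V_subset_cspace[OF y]]] yk
    unfolding u_def apply_matrix_mult block_norm_mult
    by (simp add: block_norm_block_part a_def norm_divide)
  ultimately have "block_norm n i (B u') = 0" by simp
  then show ?thesis using False unfolding u'_def apply_matrix_mult block_norm_mult by (simp add: b_def)
qed

lemma B_selects_block:
  assumes k: "k \<in> {1..t}" and i: "i \<in> {1..s}"
    and iso: "\<And>w. w \<in> block_subspace t m k \<Longrightarrow> block_norm n i (B w) = block_norm m k w"
    and y: "y \<in> V t m \<tau>" and yk: "block_norm m k y \<noteq> 0"
  shows "block_norm n i (B y) = block_norm m k y"
proof -
  have "B y (i, p) = B (block_part k y) (i, p)" if p: "p \<in> {1..n i}" for p
  proof -
    have "B y (i, p) = (\<Sum>j\<in>{1..t}. B (block_part j y) (i, p))"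
      by (rule apply_matrix_sum_block_parts)
    also have "\<dots> = (\<Sum>j\<in>{1..t}. if j = k then B (block_part k y) (i, p) else 0)"
    proof (rule sum.cong[OF HOL.refl])
      fix j assume j: "j \<in> {1..t}"
      have "B (block_part j y) (i, p) = 0" if "j \<noteq> k"
        using B_other_block[OF k i iso y yk j that] p unfolding block_norm_eq_0_iff by blast
      then show "B (block_part j y) (i, p) = (if j = k then B (block_part k y) (i, p) else 0)" by simp
    qed
    also have "\<dots> = B (block_part k y) (i, p)" using k by simp
    finally show ?thesis .
  qed
  then have "block_norm n i (B y) = block_norm n i (B (block_part k y))"
    unfolding block_norm_def by (intro L2_set_cong) auto
  also have "\<dots> = block_norm m k (block_part k y)"
    by (rule iso[OF block_part_in_subspace[OF V_subset_cspace[OF y]]])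
  finally show ?thesis by (simp add: block_norm_block_part)
qed

text \<open>
  The vector with all coordinates equal to \<open>1\<close> lies in the variety of any permutation set, and none of
  its blocks vanishes. Two blocks with the same \<open>i\<close> would contradict the preceding estimate at this
  vector.
\<close>

lemma selected_block_unique:
  assumes k: "k \<in> {1..t}" "k' \<in> {1..t}" and i: "i \<in> {1..s}"
    and iso: "\<And>w. w \<in> block_subspace t m k \<Longrightarrow> block_norm n i (B w) = block_norm m k w"
    and iso': "\<And>w. w \<in> block_subspace t m k' \<Longrightarrow> block_norm n i (B w) = block_norm m k' w"
  shows "k = k'"
proof (rule ccontr)
  assume ne: "k \<noteq> k'"
  define y where "y = (\<lambda>l. if l \<in> idx t m then 1 else 0 :: complex)"
  have y: "y \<in> V t m \<tau>"
    unfolding V_def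
  proof (intro CollectI conjI allI impI)
    show "y \<in> cspace (idx t m)" by (simp add: y_def cspace_def)
    fix i j p q p' q'
    assume h: "1 \<le> i \<and> i < j \<and> j \<le> t \<and> p \<in> {1..m i} \<and> q \<in> {1..m j} \<and> \<tau> i j (p, q) = (p', q')"
    then have "(p', q') \<in> {1..m i} \<times> {1..m j}"
      using perm' bij_betwE unfolding permutation_set_def by (metis SigmaI)
    then show "y (i, p) * y (j, q) = y (i, p') * y (j, q')" using h by (simp add: y_def idx_def)
  qed
  have nz: "block_norm m j y \<noteq> 0" if "j \<in> {1..t}" for j
    using that perm' unfolding block_norm_eq_0_iff y_def idx_def permutation_set_def by fastforce
  have "block_norm n i (B (block_part k' y)) = 0"
    using B_other_block[OF k(1) i iso y nz[OF k(1)] k(2)] ne by simp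
  moreover have "block_norm n i (B (block_part k' y)) = block_norm m k' y"
    using iso'[OF block_part_in_subspace[OF V_subset_cspace[OF y]]] by (simp add: block_norm_block_part)
  ultimately show False using nz[OF k(2)] by simp
qed

lemma A_block_zero:
  assumes z: "z \<in> V s n \<theta>" and 0: "\<And>k. k \<in> {1..t} \<Longrightarrow> block_norm m k (A z) = 0"
  shows "z = (\<lambda>_. 0)"
proof -
  have "A z l = 0" if "l \<in> idx t m" for l
    using 0 that unfolding block_norm_eq_0_iff idx_def by auto
  then have "B (A z) = (\<lambda>_. 0)" by (intro apply_matrix_zero)
  then show ?thesis using BA[OF z] by simp
qed

text \<open>
  The permutation is the inverse of the selection \<open>\<kappa>\<close> of an isometric block. For \<open>z\<close> in block \<open>i\<close>, a
  non-zero block \<open>k\<close> of \<open>A z\<close> forces \<open>B (A z) = z\<close> to have the same norm in block \<open>\<kappa> k\<close>, so \<open>\<kappa> k = i\<close>.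
  Injectivity of \<open>\<kappa>\<close> leaves room for only one such \<open>k\<close>, and \<open>z \<noteq> 0\<close> provides one.
\<close>

lemma blocks_correspond:
  "s = t \<and> (\<exists>\<sigma>. \<sigma> permutes {1..s} \<and> (\<forall>i\<in>{1..s}. \<forall>z\<in>block_subspace s n i.
     A z \<in> block_subspace t m (\<sigma> i) \<and> block_norm m (\<sigma> i) (A z) = block_norm n i z))"
proof -
  have "\<forall>k\<in>{1..t}. \<exists>i. i \<in> {1..s} \<and> (\<forall>w\<in>block_subspace t m k. block_norm n i (B w) = block_norm m k w)"
    using B_block_isometric by blast
  from bchoice[OF this] obtain \<kappa>
    where "\<forall>k\<in>{1..t}. \<kappa> k \<in> {1..s} \<and> (\<forall>w\<in>block_subspace t m k. block_norm n (\<kappa> k) (B w) = block_norm m k w)"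
    by (elim exE)
  then have \<kappa>: "\<kappa> k \<in> {1..s}" "w \<in> block_subspace t m k \<Longrightarrow> block_norm n (\<kappa> k) (B w) = block_norm m k w"
    if "k \<in> {1..t}" for k w
    using that by simp_all
  have inj: "inj_on \<kappa> {1..t}"
  proof (rule inj_onI)
    fix k k' assume k: "k \<in> {1..t}" "k' \<in> {1..t}" "\<kappa> k = \<kappa> k'"
    show "k = k'"
      using selected_block_unique[OF k(1,2) \<kappa>(1)[OF k(1)] \<kappa>(2)[OF k(1)]] \<kappa>(2)[OF k(2)] k(3) by simp
  qed
  have sel: "\<kappa> k = i \<and> block_norm n i z = block_norm m k (A z)"
    if z: "z \<in> block_subspace s n i" and k: "k \<in> {1..t}" and nz: "block_norm m k (A z) \<noteq> 0" for i k z
  proof -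
    have zV: "z \<in> V s n \<theta>" using z block_subspace_subset_V[OF perm] by blast
    have eq: "block_norm n (\<kappa> k) z = block_norm m k (A z)"
      using B_selects_block[OF k \<kappa>(1)[OF k] \<kappa>(2)[OF k] A_V[OF zV] nz] BA[OF zV] by simp
    then have "\<kappa> k = i" using block_norm_block_subspace[OF z, of "\<kappa> k"] nz by auto
    then show ?thesis using eq by simp
  qed
  have surj: "\<exists>k\<in>{1..t}. \<kappa> k = i" if i: "i \<in> {1..s}" for i
  proof -
    define e where "e = unit_vector (i, 1::nat)"
    have "1 \<le> n i" using perm i unfolding permutation_set_def by blast
    then have e: "e \<in> block_subspace s n i"
      using unit_vector_in_block_subspace[of "(i, 1)" s n] i by (simp add: e_def idx_def)
    have "e \<noteq> (\<lambda>_. 0)" by (auto simp: e_def unit_vector_def fun_eq_iff)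
    then obtain k where "k \<in> {1..t}" "block_norm m k (A e) \<noteq> 0"
      using A_block_zero[of e] e block_subspace_subset_V[OF perm] by blast
    then show ?thesis using sel[OF e] by blast
  qed
  have bij: "bij_betw \<kappa> {1..t} {1..s}"
    unfolding bij_betw_def using inj \<kappa>(1) surj by blast
  then have st: "s = t" using bij_betw_same_card by fastforce
  define p where "p k = (if k \<in> {1..s} then \<kappa> k else k)" for k
  have "bij_betw p {1..s} {1..s}"
    using bij st by (subst bij_betw_cong[of _ _ \<kappa>]) (auto simp: p_def)
  moreover have "p k = k" if "k \<notin> {1..s}" for k using that unfolding p_def by (rule if_not_P)
  ultimately have p: "p permutes {1..s}" by (rule bij_imp_permutes)
  define \<sigma> where "\<sigma> = inv_into UNIV p"
  have \<sigma>: "\<sigma> permutes {1..s}" unfolding \<sigma>_def by (rule permutes_inv[OF p])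
  have "A z \<in> block_subspace t m (\<sigma> i) \<and> block_norm m (\<sigma> i) (A z) = block_norm n i z"
    if i: "i \<in> {1..s}" and z: "z \<in> block_subspace s n i" for i z
  proof
    have zV: "z \<in> V s n \<theta>" using z block_subspace_subset_V[OF perm] by blast
    have only: "k = \<sigma> i" if "k \<in> {1..t}" "block_norm m k (A z) \<noteq> 0" for k
    proof -
      have "p k = i" using sel[OF z that] that(1) st by (simp add: p_def)
      then show ?thesis using permutes_inverses(2)[OF p] unfolding \<sigma>_def by metis
    qed
    have "A z l = 0" if l: "fst l \<noteq> \<sigma> i" for l
    proof (cases "l \<in> idx t m")
      case True
      then have "fst l \<in> {1..t}" "snd l \<in> {1..m (fst l)}" unfolding idx_def by auto
      then show ?thesis using only[of "fst l"] l unfolding block_norm_eq_0_iff by (metis prod.collapse)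
    next
      case False
      then show ?thesis by (simp add: apply_matrix_def)
    qed
    then show "A z \<in> block_subspace t m (\<sigma> i)" unfolding block_subspace_def by simp
    show "block_norm m (\<sigma> i) (A z) = block_norm n i z"
    proof (cases "\<exists>k\<in>{1..t}. block_norm m k (A z) \<noteq> 0")
      case True
      then show ?thesis using only sel[OF z] by metis
    next
      case False
      then have "z = (\<lambda>_. 0)" using A_block_zero[OF zV] by blast
      then have "block_norm n i z = 0" by (simp add: block_norm_eq_0_iff)
      moreover have "block_norm m (\<sigma> i) (A z) = 0"
        using False permutes_in_image[OF \<sigma>, of i] i st by blast
      ultimately show ?thesis by simp
    qed
  qed
  then show ?thesis using st \<sigma> by blast
qed

text \<open>
  The columns of \<open>X\<close> are orthonormal: inside one block by polarisation, and for different blocks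
  because their supports are disjoint. The rows are orthonormal because the right inverse \<open>Y\<close> then
  has to be the adjoint.
\<close>

lemma X_unitary:
  assumes \<sigma>: "\<sigma> permutes {1..s}" and st: "s = t"
    and iso: "\<And>i z. i \<in> {1..s} \<Longrightarrow> z \<in> block_subspace s n i \<Longrightarrow>
      A z \<in> block_subspace t m (\<sigma> i) \<and> block_norm m (\<sigma> i) (A z) = block_norm n i z"
  shows "unitary_matrix (idx t m) (idx s n) X"
    and "(i, p) \<in> idx s n \<Longrightarrow> (j, q) \<in> idx t m \<Longrightarrow> j \<noteq> \<sigma> i \<Longrightarrow> X (j, q) (i, p) = 0"
proof -
  let ?K = "idx s n" and ?L = "idx t m"
  have supp: "X (j, q) (i, p) = 0" if k: "(i, p) \<in> ?K" and l: "(j, q) \<in> ?L" and ne: "j \<noteq> \<sigma> i" for i p j q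
  proof -
    have "unit_vector (i, p) \<in> block_subspace s n i"
      using unit_vector_in_block_subspace[OF k] by simp
    then have "A (unit_vector (i, p)) \<in> block_subspace t m (\<sigma> i)"
      using iso[of i] k unfolding idx_def by blast
    then have "A (unit_vector (i, p)) (j, q) = 0" using ne unfolding block_subspace_def by simp
    then show ?thesis using apply_matrix_unit_vector[OF finite_idx k l] by simp
  qed
  then show "(i, p) \<in> ?K \<Longrightarrow> (j, q) \<in> ?L \<Longrightarrow> j \<noteq> \<sigma> i \<Longrightarrow> X (j, q) (i, p) = 0" by blast
  have norm: "(\<Sum>l\<in>?L. (cmod (A z l))\<^sup>2) = (\<Sum>k\<in>?K. (cmod (z k))\<^sup>2)"
    if i: "i \<in> {1..s}" and z: "z \<in> block_subspace s n i" for i z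
    using iso[OF i z] block_norm_eq_sum[OF z i] permutes_in_image[OF \<sigma>] i st
      block_norm_eq_sum[of "A z" t m "\<sigma> i"] by simp
  define G where "G k k' = (\<Sum>l\<in>?L. cnj (X l k) * X l k')" for k k'
  have G_diag: "G k k = 1" if k: "k \<in> ?K" for k
  proof -
    have fk: "fst k \<in> {1..s}" using k unfolding idx_def by auto
    have "G k k = of_real (\<Sum>l\<in>?L. (cmod (X l k))\<^sup>2)"
      unfolding G_def of_real_sum by (intro sum.cong HOL.refl) (metis complex_norm_square mult.commute)
    also have "(\<Sum>l\<in>?L. (cmod (X l k))\<^sup>2) = (\<Sum>l\<in>?L. (cmod (A (unit_vector k) l))\<^sup>2)"
      using k by (simp add: apply_matrix_unit_vector)
    also have "\<dots> = (\<Sum>j\<in>?K. (cmod (unit_vector k j))\<^sup>2)"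
      by (rule norm[OF fk unit_vector_in_block_subspace[OF k]])
    also have "\<dots> = (\<Sum>j\<in>?K. if j = k then 1 else 0)"
      by (rule sum.cong) (auto simp: unit_vector_def)
    also have "\<dots> = 1" using k by simp
    finally show ?thesis by simp
  qed
  have G_off: "G k k' = 0" if k: "k \<in> ?K" and k': "k' \<in> ?K" and ne: "k \<noteq> k'" for k k'
  proof (cases "fst k = fst k'")
    case False
    then have "\<sigma> (fst k) \<noteq> \<sigma> (fst k')" using permutes_inj[OF \<sigma>] by (simp add: inj_eq)
    then have "cnj (X l k) * X l k' = 0" if "l \<in> ?L" for l
      using supp[of "fst k" "snd k" "fst l" "snd l"] supp[of "fst k'" "snd k'" "fst l" "snd l"] k k' that
      unfolding prod.collapse by (cases "fst l = \<sigma> (fst k)") auto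
    then show ?thesis unfolding G_def by (intro sum.neutral) blast
  next
    case True
    \<comment> \<open>this coefficient turns the cross term of the polarised norm into \<open>2 |G k k'|\<^sup>2\<close>\<close>
    define c where "c = cnj (G k k')"
    define z where "z = (\<lambda>j. 1 * unit_vector k j + c * unit_vector k' j)"
    have fk: "fst k \<in> {1..s}" using k unfolding idx_def by auto
    have "z \<in> block_subspace s n (fst k)"
      using unit_vector_in_block_subspace[OF k] unit_vector_in_block_subspace[OF k'] True
      unfolding z_def block_subspace_def cspace_def by simp
    from norm[OF fk this]
    have eq: "(\<Sum>l\<in>?L. (cmod (X l k + c * X l k'))\<^sup>2) = (\<Sum>j\<in>?K. (cmod (z j))\<^sup>2)"
      using k k' unfolding z_def apply_matrix_linear by (simp add: apply_matrix_unit_vector)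
    have "(cmod (z j))\<^sup>2 = (if j = k then 1 else 0) + (if j = k' then (cmod c)\<^sup>2 else 0)" for j
      using ne by (auto simp: z_def unit_vector_def)
    then have rhs: "(\<Sum>j\<in>?K. (cmod (z j))\<^sup>2) = 1 + (cmod c)\<^sup>2" using k k' by (simp add: sum.distrib)
    have "complex_of_real ((cmod (X l k + c * X l k'))\<^sup>2) = cnj (X l k) * X l k + (c * cnj c) * (cnj (X l k') * X l k')
        + c * (cnj (X l k) * X l k') + cnj c * cnj (cnj (X l k) * X l k')" for l
      unfolding complex_norm_square by (simp add: algebra_simps)
    then have "complex_of_real (\<Sum>l\<in>?L. (cmod (X l k + c * X l k'))\<^sup>2)
        = G k k + (c * cnj c) * G k' k' + c * G k k' + cnj c * cnj (G k k')"
      unfolding of_real_sum G_def cnj_sum by (simp only: sum.distrib sum_distrib_left)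
    also have "\<dots> = 1 + of_real ((cmod c)\<^sup>2) + 2 * of_real ((cmod c)\<^sup>2)"
      unfolding complex_norm_square by (simp add: G_diag k k' c_def mult.commute)
    finally have "complex_of_real (1 + (cmod c)\<^sup>2) = complex_of_real (1 + (cmod c)\<^sup>2 + 2 * (cmod c)\<^sup>2)"
      unfolding eq rhs by simp
    then have "1 + (cmod c)\<^sup>2 = 1 + (cmod c)\<^sup>2 + 2 * (cmod c)\<^sup>2" by (simp only: of_real_eq_iff)
    then show ?thesis by (simp add: c_def)
  qed
  have G: "G k k' = (if k = k' then 1 else 0)" if "k \<in> ?K" "k' \<in> ?K" for k k'
    using G_diag G_off that by simp
  have XY: "(\<Sum>k\<in>?K. X l k * Y k l') = (if l = l' then 1 else 0)" if l: "l \<in> ?L" "l' \<in> ?L" for l l'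
  proof -
    have "unit_vector l' \<in> V t m \<tau>"
      using unit_vector_in_block_subspace[OF l(2)] block_subspace_subset_V[OF perm'] by blast
    from AB[OF this] have "A (B (unit_vector l')) l = unit_vector l' l" by simp
    moreover have "A (B (unit_vector l')) l = (\<Sum>k\<in>?K. X l k * B (unit_vector l') k)"
      unfolding apply_matrix_def[of ?L] using l by simp
    moreover have "\<dots> = (\<Sum>k\<in>?K. X l k * Y k l')"
      by (rule sum.cong) (simp_all add: apply_matrix_unit_vector l)
    ultimately show ?thesis by (simp add: unit_vector_def)
  qed
  have adj: "Y k l = cnj (X l k)" if k: "k \<in> ?K" and l: "l \<in> ?L" for k l
  proof -
    have "Y k l = (\<Sum>k'\<in>?K. if k = k' then Y k' l else 0)" using k by simp
    also have "\<dots> = (\<Sum>k'\<in>?K. G k k' * Y k' l)" by (rule sum.cong) (auto simp: G k)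
    also have "\<dots> = (\<Sum>k'\<in>?K. \<Sum>l'\<in>?L. cnj (X l' k) * (X l' k' * Y k' l))"
      unfolding G_def sum_distrib_right by (simp add: mult.assoc)
    also have "\<dots> = (\<Sum>l'\<in>?L. cnj (X l' k) * (\<Sum>k'\<in>?K. X l' k' * Y k' l))"
      unfolding sum_distrib_left by (rule sum.swap)
    also have "\<dots> = (\<Sum>l'\<in>?L. if l' = l then cnj (X l' k) else 0)"
      by (rule sum.cong) (auto simp: XY l)
    also have "\<dots> = cnj (X l k)" using l by simp
    finally show ?thesis .
  qed
  show "unitary_matrix ?L ?K X"
    unfolding unitary_matrix_def
  proof (intro conjI ballI)
    show "(\<Sum>l\<in>?L. cnj (X l k) * X l k') = (if k = k' then 1 else 0)" if "k \<in> ?K" "k' \<in> ?K" for k k'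
      using G[OF that] unfolding G_def .
    show "(\<Sum>k\<in>?K. X l k * cnj (X l' k)) = (if l = l' then 1 else 0)" if l: "l \<in> ?L" "l' \<in> ?L" for l l'
      unfolding XY[OF l, symmetric] by (rule sum.cong) (auto simp: adj l)
  qed
qed

end

text \<open>
  The sum of \<open>|X l k|\<^sup>2\<close> over the \<open>i\<close>-th column block is computed by columns and by rows.
\<close>

lemma unitary_block_sizes:
  assumes U: "unitary_matrix (idx t m) (idx s n) X" and \<sigma>: "\<sigma> permutes {1..s}" and st: "s = t"
    and supp: "\<And>i p j q. (i, p) \<in> idx s n \<Longrightarrow> (j, q) \<in> idx t m \<Longrightarrow> j \<noteq> \<sigma> i \<Longrightarrow> X (j, q) (i, p) = 0"
    and i: "i \<in> {1..s}"
  shows "n i = m (\<sigma> i)"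
proof -
  have \<sigma>i: "\<sigma> i \<in> {1..t}" using permutes_in_image[OF \<sigma>] i st by simp
  have col: "(\<Sum>q\<in>{1..m (\<sigma> i)}. cnj (X (\<sigma> i, q) (i, p)) * X (\<sigma> i, q) (i, p)) = 1" if p: "p \<in> {1..n i}" for p
  proof -
    have k: "(i, p) \<in> idx s n" using i p by (simp add: idx_def)
    have "1 = (\<Sum>l\<in>idx t m. cnj (X l (i, p)) * X l (i, p))" using U k unfolding unitary_matrix_def by simp
    also have "\<dots> = (\<Sum>j\<in>{1..t}. if j = \<sigma> i then \<Sum>q\<in>{1..m j}. cnj (X (j, q) (i, p)) * X (j, q) (i, p) else 0)"
      unfolding sum_idx by (rule sum.cong) (auto intro!: sum.neutral simp: supp[OF k] idx_def)
    also have "\<dots> = (\<Sum>q\<in>{1..m (\<sigma> i)}. cnj (X (\<sigma> i, q) (i, p)) * X (\<sigma> i, q) (i, p))" using \<sigma>i by simp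
    finally show ?thesis ..
  qed
  have row: "(\<Sum>p\<in>{1..n i}. X (\<sigma> i, q) (i, p) * cnj (X (\<sigma> i, q) (i, p))) = 1" if q: "q \<in> {1..m (\<sigma> i)}" for q
  proof -
    have l: "(\<sigma> i, q) \<in> idx t m" using \<sigma>i q by (simp add: idx_def)
    have zero: "X (\<sigma> i, q) (i', p) = 0" if "(i', p) \<in> idx s n" "i' \<noteq> i" for i' p
      using supp[OF that(1) l] that(2) permutes_inj[OF \<sigma>] by (simp add: inj_eq)
    have "1 = (\<Sum>k\<in>idx s n. X (\<sigma> i, q) k * cnj (X (\<sigma> i, q) k))" using U l unfolding unitary_matrix_def by simp
    also have "\<dots> = (\<Sum>i'\<in>{1..s}. if i' = i then \<Sum>p\<in>{1..n i'}. X (\<sigma> i, q) (i', p) * cnj (X (\<sigma> i, q) (i', p)) else 0)"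
      unfolding sum_idx by (rule sum.cong) (auto intro!: sum.neutral simp: zero idx_def)
    also have "\<dots> = (\<Sum>p\<in>{1..n i}. X (\<sigma> i, q) (i, p) * cnj (X (\<sigma> i, q) (i, p)))" using i by simp
    finally show ?thesis ..
  qed
  have "complex_of_nat (n i) = (\<Sum>p\<in>{1..n i}. \<Sum>q\<in>{1..m (\<sigma> i)}. cnj (X (\<sigma> i, q) (i, p)) * X (\<sigma> i, q) (i, p))"
    using col by simp
  also have "\<dots> = (\<Sum>q\<in>{1..m (\<sigma> i)}. \<Sum>p\<in>{1..n i}. X (\<sigma> i, q) (i, p) * cnj (X (\<sigma> i, q) (i, p)))"
    by (subst sum.swap) (simp add: mult.commute)
  also have "\<dots> = complex_of_nat (m (\<sigma> i))" using row by simp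
  finally show ?thesis by (simp only: of_nat_eq_iff)
qed

theorem proposition6p3:
  fixes s t :: nat and n m :: "nat \<Rightarrow> nat" and \<theta> \<tau> :: perms
    and \<gamma> :: "(nat \<times> nat \<Rightarrow> complex) \<Rightarrow> (nat \<times> nat \<Rightarrow> complex)"
  assumes "permutation_set s n \<theta>" and "cancelative s n \<theta>"
    and "permutation_set t m \<tau>" and "cancelative t m \<tau>"
    and "biholomorphic_map s n \<theta> t m \<tau> \<gamma>"
    and "\<gamma> (\<lambda>k. 0) = (\<lambda>k. 0)"
  shows "(\<Sum>i=1..s. n i) = (\<Sum>j=1..t. m j) \<and>
    (\<exists>X. unitary_matrix (idx t m) (idx s n) X \<and>
       (\<forall>z \<in> \<Omega> s n \<theta>. \<forall>l \<in> idx t m. \<gamma> z l = (\<Sum>k\<in>idx s n. X l k * z k)) \<and>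
       s = t \<and>
       (\<exists>\<sigma>. \<sigma> permutes {1..s} \<and> (\<forall>i\<in>{1..s}. n i = m (\<sigma> i)) \<and>
          (\<forall>(i, p) \<in> idx s n. \<forall>(j, q) \<in> idx t m. j \<noteq> \<sigma> i \<longrightarrow> X (j, q) (i, p) = 0)))"
proof -
  note perm = assms(1) and perm' = assms(3)
  obtain \<delta> where hom: "homeomorphism (\<Omega> s n \<theta>) (\<Omega> t m \<tau>) \<gamma> \<delta>"
    and \<gamma>h: "\<forall>k \<in> idx t m. holomorphic_on_\<Omega> s n \<theta> (\<lambda>z. \<gamma> z k)"
    and \<delta>h: "\<forall>k \<in> idx s n. holomorphic_on_\<Omega> t m \<tau> (\<lambda>w. \<delta> w k)"
    using assms(5) unfolding biholomorphic_map_def by blast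
  have \<delta>\<gamma>: "\<delta> (\<gamma> z) = z" and \<gamma>im: "\<gamma> z \<in> \<Omega> t m \<tau>" if "z \<in> \<Omega> s n \<theta>" for z
    using hom that unfolding homeomorphism_def by blast+
  have \<gamma>\<delta>: "\<gamma> (\<delta> w) = w" and \<delta>im: "\<delta> w \<in> \<Omega> s n \<theta>" if "w \<in> \<Omega> t m \<tau>" for w
    using hom that unfolding homeomorphism_def by blast+
  have "(\<lambda>_. 0) \<in> \<Omega> s n \<theta>"
    by (simp add: \<Omega>_def V_def block_norm_def L2_set_0')
  then have \<delta>0: "\<delta> (\<lambda>_. 0) = (\<lambda>_. 0)" using \<delta>\<gamma>[of "\<lambda>_. 0"] assms(6) by simp
  have g: "pointed_holomorphic_map s n \<theta> t m \<tau> \<gamma>" and h: "pointed_holomorphic_map t m \<tau> s n \<theta> \<delta>"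
    unfolding pointed_holomorphic_map_def using \<gamma>im \<delta>im \<gamma>h \<delta>h assms(6) \<delta>0 by blast+
  obtain X where X: "derivative_matrix s n \<theta> t m \<gamma> X" by (rule derivative_matrix_exists[OF perm g])
  obtain Y where Y: "derivative_matrix t m \<tau> s n \<delta> Y" by (rule derivative_matrix_exists[OF perm' h])
  interpret inverse_matrices s t n m \<theta> \<tau> X Y
  proof
    show "permutation_set s n \<theta>" "permutation_set t m \<tau>" by (fact perm perm')+
  qed (intro derivative_maps_\<Omega>[OF perm perm' g X] derivative_maps_\<Omega>[OF perm' perm h Y]
      derivative_left_inverse[OF perm perm' g h X Y \<delta>\<gamma>] derivative_left_inverse[OF perm' perm h g Y X \<gamma>\<delta>]; assumption)+
  obtain \<sigma> where st: "s = t" and \<sigma>: "\<sigma> permutes {1..s}"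
    and iso: "\<forall>i\<in>{1..s}. \<forall>z\<in>block_subspace s n i.
      A z \<in> block_subspace t m (\<sigma> i) \<and> block_norm m (\<sigma> i) (A z) = block_norm n i z"
    using blocks_correspond by blast
  have U: "unitary_matrix (idx t m) (idx s n) X"
    and supp: "\<And>i p j q. (i, p) \<in> idx s n \<Longrightarrow> (j, q) \<in> idx t m \<Longrightarrow> j \<noteq> \<sigma> i \<Longrightarrow> X (j, q) (i, p) = 0"
    using X_unitary[OF \<sigma> st] iso by blast+
  have sizes: "n i = m (\<sigma> i)" if "i \<in> {1..s}" for i
    by (rule unitary_block_sizes[OF U \<sigma> st supp that])
  have "(\<Sum>i=1..s. n i) = (\<Sum>i=1..s. m (\<sigma> i))" by (rule sum.cong) (auto simp: sizes)
  also have "\<dots> = (\<Sum>j=1..t. m j)" using sum.permute[OF \<sigma>, of m] st by (simp add: o_def)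
  finally have total: "(\<Sum>i=1..s. n i) = (\<Sum>j=1..t. m j)" .
  have lin: "\<gamma> z l = (\<Sum>k\<in>idx s n. X l k * z k)" if "z \<in> \<Omega> s n \<theta>" "l \<in> idx t m" for z l
    using biholomorphic_eq_derivative[OF perm perm' g h X Y \<delta>\<gamma> \<gamma>\<delta> _ that(1)] hom that(2)
    by (simp add: homeomorphism_def apply_matrix_def)
  show ?thesis
    using total U lin st \<sigma> sizes supp by (intro conjI exI[of _ X] exI[of _ \<sigma>]) auto
qed

end
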